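(* Let $K:\mathbb{R}\to\mathbb{R}\cup\{\infty\}$ be a function which may be infinite only at $t=0$ and which satisfies: (I)(a) $K\in L^1_{loc}(\mathbb{R})$, $K$ is symmetric around zero, and $K(t)>0$ for all $t\neq 0$; (I)(b) $K(t)\to 0$ as $t\to\infty$ and $K$ is eventually decreasing; (I)(c) the improper integral $\mathcal{K}_{\cos}(\omega)=\int_0^\infty K(t)\cos(\omega t)\,dt$ is positive for all $\omega\neq 0$; (II) $K(t)\sim t^{-1}$ as $t\to\infty$. Let $m,\beta>0$, let $\nu$ be a non-negative absolutely continuous measure on $\mathbb{R}$ with $\int_{\mathbb{R}}(1+x^2)^{-k}\,\nu(dx)<\infty$ for some integer $k$, and let $V$ be the operator associated with $\nu$. Then $V$ is a weak solution of the generalized Langevin equation $$m\dot V(t)=-\beta\int_{-\infty}^t K(t-s)V(s)\,ds+\sqrt{\beta}\,F(t)$$ if and only if $\nu(d\omega)=\widehat r(\omega)\,d\omega$, where $$\widehat r(\omega)=\frac{1}{2\pi}\,\frac{2\beta\mathcal{K}_{\cos}(\omega)}{[\beta\mathcal{K}_{\cos}(\omega)]^2+[m\omega-\beta\mathcal{K}_{\sin}(\omega)]^2}.$$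
   Context: Notation: $f(t)\sim g(t)$ as $t\to\infty$ means $f(t)/g(t)\to c$ for some constant $c\in(0,\infty)$ (not necessarily $1$). $\mathcal{K}_{\cos}(\omega)=\int_0^\infty K(t)\cos(t\omega)\,dt$ and $\mathcal{K}_{\sin}(\omega)=\int_0^\infty K(t)\sin(t\omega)\,dt$ are improper integrals. "Eventually decreasing" means decreasing on $[A,\infty)$ for some $A$. Fourier conventions: $\widehat\varphi(\omega)=\int_{\mathbb{R}}e^{it\omega}\varphi(t)\,dt$. $\mathcal{S}$ is the Schwartz space, $\mathcal{S}'$ the tempered distributions, $\mathcal{F}[g]$ the Fourier transform of $g\in\mathcal{S}'$, defined by $\langle\mathcal{F}[g],\varphi\rangle=\langle g,\widehat\varphi\rangle$. Operator associated with $\nu$: a linear map $V$ from $\mathrm{Dom}(V)$ to square-integrable complex-valued Gaussian random variables, where $\mathrm{Dom}(V)$ is the set of $g\in\mathcal{S}'$ such that $\mathcal{F}[g]$ is a complex-valued function belonging to $L^2(\nu)$, and $$\mathbb{E}\big[\langle V,g_1\rangle\overline{\langle V,g_2\rangle}\big]=\int_{\mathbb{R}}\mathcal{F}[g_1](\omega)\overline{\mathcal{F}[g_2](\omega)}\,\nu(d\omega),\qquad g_1,g_2\in\mathrm{Dom}(V).$$ $\nu$ is called the spectral measure of $V$. Weak solution: let $K^+(t)=K(t)1_{\{t\ge0\}}$ and $\widetilde f(x)=f(-x)$, so $\widetilde{K^+*\widetilde\varphi}(t)=\int_{\mathbb{R}}K^+(u)\varphi(t+u)\,du$. The noise $F$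 is the stationary random distribution on $\mathcal{S}$ with $\mathbb{E}[\langle F,\varphi_1\rangle\overline{\langle F,\varphi_2\rangle}]=\int_{\mathbb{R}}K(t)(\varphi_1*\varphi_2^{*})(t)\,dt$, where $\varphi_2^*(t)=\overline{\varphi_2(-t)}$. $V$ is a weak solution of the equation if (a) $K^+*\varphi\in\mathrm{Dom}(V)$ for every $\varphi\in\mathcal{S}$, and (b) for all $\varphi,\psi\in\mathcal{S}$, $$\mathbb{E}\big[\langle V,-m\varphi'+\beta\widetilde{K^+*\widetilde\varphi}\rangle\overline{\langle V,-m\psi'+\beta\widetilde{K^+*\widetilde\psi}\rangle}\big]=\mathbb{E}\big[\langle\sqrt\beta F,\varphi\rangle\overline{\langle\sqrt\beta F,\psi\rangle}\big].$$ *)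

theory Defs
  imports "HOL-Probability.Probability"
begin

section \<open>Schwartz functions and tempered distributions on the line\<close>

definition iter_deriv :: "nat \<Rightarrow> (real \<Rightarrow> complex) \<Rightarrow> real \<Rightarrow> complex" where
  "iter_deriv k = (\<lambda>f x. vector_derivative f (at x)) ^^ k"

definition schwartz :: "(real \<Rightarrow> complex) set" where
  "schwartz = {\<phi>. (\<forall>k x. iter_deriv k \<phi> differentiable (at x)) \<and>
                   (\<forall>j k. bounded (range (\<lambda>x. of_real x ^ j * iter_deriv k \<phi> x)))}"

text \<open>Convergence in the seminorms \<open>sup\<^sub>x \<bar>x^j \<phi>^(k)(x)\<bar>\<close>.  They generate a metrizable topology,
  so continuity on the Schwartz space may be tested on sequences.\<close>

definition schwartz_tendsto :: "(nat \<Rightarrow> real \<Rightarrow> complex) \<Rightarrow> (real \<Rightarrow> complex) \<Rightarrow> bool" where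
  "schwartz_tendsto \<phi>s \<phi> \<longleftrightarrow>
     (\<forall>j k. uniform_limit UNIV (\<lambda>n x. of_real x ^ j * iter_deriv k (\<phi>s n) x)
                               (\<lambda>x. of_real x ^ j * iter_deriv k \<phi> x) sequentially)"

text \<open>Functionals are total in HOL.  Requiring the value \<open>0\<close> off the Schwartz space makes two
  tempered distributions equal in HOL exactly when they agree on all Schwartz functions.\<close>

definition tempered :: "((real \<Rightarrow> complex) \<Rightarrow> complex) set" where
  "tempered = {T.
     (\<forall>\<phi>\<in>schwartz. \<forall>\<psi>\<in>schwartz. \<forall>a b. T (\<lambda>x. a * \<phi> x + b * \<psi> x) = a * T \<phi> + b * T \<psi>) \<and>
     (\<forall>\<phi>s \<phi>. (\<forall>n. \<phi>s n \<in> schwartz) \<longrightarrow> \<phi> \<in> schwartz \<longrightarrow> schwartz_tendsto \<phi>s \<phi> \<longrightarrow>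
        (\<lambda>n. T (\<phi>s n)) \<longlonglongrightarrow> T \<phi>) \<and>
     (\<forall>\<phi>. \<phi> \<notin> schwartz \<longrightarrow> T \<phi> = 0)}"

text \<open>The functional \<open>\<phi> \<mapsto> \<integral> f \<phi>\<close> given by a function (bilinear pairing, no conjugation).\<close>

definition dist_of :: "(real \<Rightarrow> complex) \<Rightarrow> (real \<Rightarrow> complex) \<Rightarrow> complex" where
  "dist_of f = (\<lambda>\<phi>. if \<phi> \<in> schwartz then (LINT t|lebesgue. f t * \<phi> t) else 0)"

definition is_function :: "((real \<Rightarrow> complex) \<Rightarrow> complex) \<Rightarrow> (real \<Rightarrow> complex) \<Rightarrow> bool" where
  "is_function T h \<longleftrightarrow> h \<in> borel_measurable borel \<and>
     (\<forall>\<phi>\<in>schwartz. integrable lebesgue (\<lambda>x. h x * \<phi> x)) \<and> T = dist_of h"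

definition fourier :: "(real \<Rightarrow> complex) \<Rightarrow> real \<Rightarrow> complex" where
  "fourier \<phi> \<omega> = (LINT t|lebesgue. exp (\<i> * of_real (t * \<omega>)) * \<phi> t)"

definition fourier_dist :: "((real \<Rightarrow> complex) \<Rightarrow> complex) \<Rightarrow> (real \<Rightarrow> complex) \<Rightarrow> complex" where
  "fourier_dist g = (\<lambda>\<phi>. if \<phi> \<in> schwartz then g (fourier \<phi>) else 0)"

definition conv :: "(real \<Rightarrow> complex) \<Rightarrow> (real \<Rightarrow> complex) \<Rightarrow> real \<Rightarrow> complex" where
  "conv f g t = (LINT u|lebesgue. f u * g (t - u))"

definition reflect :: "(real \<Rightarrow> complex) \<Rightarrow> real \<Rightarrow> complex" where
  "reflect f x = f (- x)"

definition star :: "(real \<Rightarrow> complex) \<Rightarrow> real \<Rightarrow> complex" where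
  "star \<phi> t = cnj (\<phi> (- t))"


section \<open>The operator associated with a measure\<close>

definition square_integrable :: "'a measure \<Rightarrow> ('a \<Rightarrow> complex) \<Rightarrow> bool" where
  "square_integrable M f \<longleftrightarrow> f \<in> borel_measurable M \<and> integrable M (\<lambda>x. (cmod (f x))\<^sup>2)"

text \<open>Degenerate (constant) Gaussians are allowed: for example \<open>\<langle>V, 0\<rangle>\<close> is almost surely \<open>0\<close>.\<close>

definition gaussian_law :: "real measure \<Rightarrow> bool" where
  "gaussian_law N \<longleftrightarrow> (\<exists>\<mu>. N = return borel \<mu>) \<or>
     (\<exists>\<mu> \<sigma>. \<sigma> > 0 \<and> N = density lborel (\<lambda>x. ennreal (normal_density \<mu> \<sigma> x)))"

text \<open>A complex variable is Gaussian if its real and imaginary parts are jointly Gaussian,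
  that is, if all their real linear combinations are Gaussian.\<close>

definition complex_gaussian :: "'w measure \<Rightarrow> ('w \<Rightarrow> complex) \<Rightarrow> bool" where
  "complex_gaussian M X \<longleftrightarrow> X \<in> borel_measurable M \<and>
     (\<forall>a b. gaussian_law (distr M borel (\<lambda>w. a * Re (X w) + b * Im (X w))))"

definition Dom :: "real measure \<Rightarrow> ((real \<Rightarrow> complex) \<Rightarrow> complex) set" where
  "Dom \<nu> = {g \<in> tempered. \<exists>h. is_function (fourier_dist g) h \<and> square_integrable \<nu> h}"

text \<open>The function \<open>F[g]\<close> is determined only almost everywhere, so the covariance identity is
  stated for every representative.  This is consistent for the measures \<open>\<nu>\<close> considered, which
  are absolutely continuous.  Random variables are identified when almost surely equal, so
  linearity is required almost surely.\<close>

definition associated_operator ::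
  "'w measure \<Rightarrow> real measure \<Rightarrow> (((real \<Rightarrow> complex) \<Rightarrow> complex) \<Rightarrow> 'w \<Rightarrow> complex) \<Rightarrow> bool" where
  "associated_operator M \<nu> V \<longleftrightarrow> prob_space M \<and>
     (\<forall>g\<in>Dom \<nu>. complex_gaussian M (V g) \<and> square_integrable M (V g)) \<and>
     (\<forall>g1\<in>Dom \<nu>. \<forall>g2\<in>Dom \<nu>. \<forall>a b.
        AE w in M. V (\<lambda>\<phi>. a * g1 \<phi> + b * g2 \<phi>) w = a * V g1 w + b * V g2 w) \<and>
     (\<forall>g1\<in>Dom \<nu>. \<forall>g2\<in>Dom \<nu>. \<forall>h1 h2.
        is_function (fourier_dist g1) h1 \<longrightarrow> square_integrable \<nu> h1 \<longrightarrow>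
        is_function (fourier_dist g2) h2 \<longrightarrow> square_integrable \<nu> h2 \<longrightarrow>
        (LINT w|M. V g1 w * cnj (V g2 w)) = (LINT x|\<nu>. h1 x * cnj (h2 x)))"


section \<open>The memory kernel, the noise and weak solutions\<close>

text \<open>The kernel may be infinite at \<open>0\<close>.  Integrals use \<^const>\<open>real_of_ereal\<close>, which alters
  the kernel at the single point \<open>0\<close> only.\<close>

definition K_cos :: "(real \<Rightarrow> ereal) \<Rightarrow> real \<Rightarrow> real" where
  "K_cos K \<omega> = Lim at_top (\<lambda>T. LINT t:{0..T}|lebesgue. real_of_ereal (K t) * cos (t * \<omega>))"

definition K_sin :: "(real \<Rightarrow> ereal) \<Rightarrow> real \<Rightarrow> real" where
  "K_sin K \<omega> = Lim at_top (\<lambda>T. LINT t:{0..T}|lebesgue. real_of_ereal (K t) * sin (t * \<omega>))"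

definition K_plus :: "(real \<Rightarrow> ereal) \<Rightarrow> real \<Rightarrow> complex" where
  "K_plus K t = (if t \<ge> 0 then of_real (real_of_ereal (K t)) else 0)"

definition locally_integrable :: "(real \<Rightarrow> real) \<Rightarrow> bool" where
  "locally_integrable f \<longleftrightarrow> (\<forall>a b. set_integrable lebesgue {a..b} f)"

text \<open>The limit of the quotient need not be \<open>1\<close>, unlike in \<^const>\<open>asymp_equiv\<close>.\<close>

definition sim_at_top :: "(real \<Rightarrow> real) \<Rightarrow> (real \<Rightarrow> real) \<Rightarrow> bool" where
  "sim_at_top f g \<longleftrightarrow> (\<exists>c>0. ((\<lambda>t. f t / g t) \<longlongrightarrow> c) at_top)"

text \<open>A stationary random distribution: a continuous linear map from the Schwartz space to
  \<open>L\<^sup>2(N)\<close> whose first and second moments are invariant under translations.\<close>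

definition stationary_random_distribution ::
  "'v measure \<Rightarrow> ((real \<Rightarrow> complex) \<Rightarrow> 'v \<Rightarrow> complex) \<Rightarrow> bool" where
  "stationary_random_distribution N F \<longleftrightarrow> prob_space N \<and>
     (\<forall>\<phi>\<in>schwartz. square_integrable N (F \<phi>)) \<and>
     (\<forall>\<phi>\<in>schwartz. \<forall>\<psi>\<in>schwartz. \<forall>a b.
        AE w in N. F (\<lambda>x. a * \<phi> x + b * \<psi> x) w = a * F \<phi> w + b * F \<psi> w) \<and>
     (\<forall>\<phi>s \<phi>. (\<forall>n. \<phi>s n \<in> schwartz) \<longrightarrow> \<phi> \<in> schwartz \<longrightarrow> schwartz_tendsto \<phi>s \<phi> \<longrightarrow>
        (\<lambda>n. LINT w|N. (cmod (F (\<phi>s n) w - F \<phi> w))\<^sup>2) \<longlonglongrightarrow> 0) \<and>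
     (\<forall>\<phi>\<in>schwartz. \<forall>s. (LINT w|N. F (\<lambda>t. \<phi> (t + s)) w) = (LINT w|N. F \<phi> w)) \<and>
     (\<forall>\<phi>\<in>schwartz. \<forall>\<psi>\<in>schwartz. \<forall>s.
        (LINT w|N. F (\<lambda>t. \<phi> (t + s)) w * cnj (F (\<lambda>t. \<psi> (t + s)) w)) =
        (LINT w|N. F \<phi> w * cnj (F \<psi> w)))"

definition noise ::
  "(real \<Rightarrow> ereal) \<Rightarrow> 'v measure \<Rightarrow> ((real \<Rightarrow> complex) \<Rightarrow> 'v \<Rightarrow> complex) \<Rightarrow> bool" where
  "noise K N F \<longleftrightarrow> stationary_random_distribution N F \<and>
     (\<forall>\<phi>\<in>schwartz. \<forall>\<psi>\<in>schwartz. (LINT w|N. F \<phi> w * cnj (F \<psi> w)) =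
        (LINT t|lebesgue. of_real (real_of_ereal (K t)) * conv \<phi> (star \<psi>) t))"

text \<open>The function \<open>-m \<phi>' + \<beta> (K\<^sup>+ * \<phi>~)~\<close>, where \<open>f~(x) = f(-x)\<close>.\<close>

definition gle_test ::
  "real \<Rightarrow> real \<Rightarrow> (real \<Rightarrow> ereal) \<Rightarrow> (real \<Rightarrow> complex) \<Rightarrow> real \<Rightarrow> complex" where
  "gle_test m \<beta> K \<phi> t = - of_real m * vector_derivative \<phi> (at t) +
     of_real \<beta> * reflect (conv (K_plus K) (reflect \<phi>)) t"

text \<open>Here \<open>\<nu>\<close> enters through the domain of \<open>V\<close>.  The test functionals in the second part lie
  in that domain as a consequence of the first part.\<close>

definition weak_solution ::
  "real \<Rightarrow> real \<Rightarrow> (real \<Rightarrow> ereal) \<Rightarrow> 'v measure \<Rightarrow> ((real \<Rightarrow> complex) \<Rightarrow> 'v \<Rightarrow> complex) \<Rightarrow>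
   'w measure \<Rightarrow> real measure \<Rightarrow> (((real \<Rightarrow> complex) \<Rightarrow> complex) \<Rightarrow> 'w \<Rightarrow> complex) \<Rightarrow> bool" where
  "weak_solution m \<beta> K N F M \<nu> V \<longleftrightarrow>
     (\<forall>\<phi>\<in>schwartz. dist_of (conv (K_plus K) \<phi>) \<in> Dom \<nu>) \<and>
     (\<forall>\<phi>\<in>schwartz. \<forall>\<psi>\<in>schwartz.
        (LINT w|M. V (dist_of (gle_test m \<beta> K \<phi>)) w * cnj (V (dist_of (gle_test m \<beta> K \<psi>)) w)) =
        (LINT w|N. (of_real (sqrt \<beta>) * F \<phi> w) * cnj (of_real (sqrt \<beta>) * F \<psi> w)))"

definition r_hat :: "real \<Rightarrow> real \<Rightarrow> (real \<Rightarrow> ereal) \<Rightarrow> real \<Rightarrow> real" where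
  "r_hat m \<beta> K \<omega> = 1 / (2 * pi) *
     (2 * \<beta> * K_cos K \<omega> / ((\<beta> * K_cos K \<omega>)\<^sup>2 + (m * \<omega> - \<beta> * K_sin K \<omega>)\<^sup>2))"

end

(*
  Write Khat = K_cos + i K_sin.  On the Fourier side, convolution with K^+ is multiplication by
  Khat, so the test functional -m phi' + beta (K^+ * phi~)~ becomes z * phi^ with
  z = beta * cnj Khat + i m omega, whose squared modulus is the denominator of r_hat, while the
  covariance of the noise is integration of K_cos / pi against phi^ * cnj psi^.  Hence V is a weak
  solution iff |z|^2 nu and (beta / pi) K_cos d omega agree on all products phi^ * cnj psi^.
  Modulated Gaussians are Fourier transforms of Schwartz functions, so uniqueness of characteristic
  functions identifies the two measures, and z vanishes at most at 0.

  K is not integrable at infinity.  The transforms of its truncations are therefore bounded,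
  uniformly in the truncation, by M * (1 + |omega|^(-1/2)), which is locally integrable and allows
  passing to the limit by dominated convergence.  The logarithmic singularity at 0 is thus harmless.
*)
theory Submission
  imports Defs
begin

section \<open>Schwartz functions\<close>

text \<open>The convolution of K^+ with a Schwartz function is bounded but in general not
  integrable, so its transform exists only through pairings. Formulas are therefore proved for
  truncated kernels, which are integrable, and passed to the limit inside the pairing. Each
  hypothesis on nu answers one difficulty. The transform of a distribution is a function only up to
  null sets, and the comparison of measures says nothing at frequency 0; absolute continuity settles
  both. Condition (a) of a weak solution speaks of K^+ alone, not of the derivative term; the moment
  condition makes omega phi^ square integrable and so closes this gap. Positivity of K_cos gives Re
  z > 0 off 0, which allows division by |z|^2. K itself is only Lebesgue measurable and may be
  infinite at 0, so the analysis is done for a Borel kernel that equals it almost everywhere and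
  keeps monotonicity and decay at every point far out.\<close>

lemma iter_deriv_0 [simp]: "iter_deriv 0 f = f"
  by (simp add: iter_deriv_def)

lemma iter_deriv_Suc: "iter_deriv (Suc k) f = (\<lambda>x. vector_derivative (iter_deriv k f) (at x))"
  by (simp add: iter_deriv_def)

lemma iter_deriv_deriv: "iter_deriv k (\<lambda>x. vector_derivative f (at x)) = iter_deriv (Suc k) f"
  by (simp only: iter_deriv_def funpow_Suc_right o_def)

text \<open>Being closed under differentiation, \<open>S\<close> contains all iterated derivatives
  of \<open>f\<close>, so the seminorms reduce to the decay of undifferentiated members. Each use
  only has to guess \<open>S\<close>, which avoids formulas for k-th derivatives.\<close>

lemma schwartz_coinduct:
  assumes "f \<in> S"
    and diff: "\<And>f x. f \<in> S \<Longrightarrow> f differentiable (at x)"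
    and deriv: "\<And>f. f \<in> S \<Longrightarrow> (\<lambda>x. vector_derivative f (at x)) \<in> S"
    and bdd: "\<And>f j. f \<in> S \<Longrightarrow> \<exists>C. \<forall>x. \<bar>x\<bar> ^ j * cmod (f x) \<le> C"
  shows "f \<in> schwartz"
proof -
  have S: "iter_deriv k f \<in> S" for k
    by (induction k) (auto simp: iter_deriv_Suc assms(1) intro: deriv)
  have "bounded (range (\<lambda>x. complex_of_real x ^ j * iter_deriv k f x))" for j k
  proof -
    obtain C where "\<forall>x. \<bar>x\<bar> ^ j * cmod (iter_deriv k f x) \<le> C"
      using bdd[OF S] by blast
    then show ?thesis
      by (intro boundedI[where B = C]) (auto simp: norm_mult norm_power)
  qed
  with S diff show ?thesis
    by (simp add: schwartz_def)
qed

lemma schwartz_iter_deriv_differentiable: "\<phi> \<in> schwartz \<Longrightarrow> iter_deriv k \<phi> differentiable (at x)"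
  by (simp add: schwartz_def)

lemma schwartz_differentiable: "\<phi> \<in> schwartz \<Longrightarrow> \<phi> differentiable (at x)"
  using schwartz_iter_deriv_differentiable[of \<phi> 0] by simp

lemma schwartz_has_vector_derivative:
  "\<phi> \<in> schwartz \<Longrightarrow> (\<phi> has_vector_derivative vector_derivative \<phi> (at x)) (at x)"
  using schwartz_differentiable vector_derivative_works by blast

lemma schwartz_deriv: "\<phi> \<in> schwartz \<Longrightarrow> (\<lambda>x. vector_derivative \<phi> (at x)) \<in> schwartz"
  unfolding schwartz_def by (simp add: iter_deriv_deriv)

lemma schwartz_bound:
  assumes "\<phi> \<in> schwartz"
  obtains C where "\<And>x. \<bar>x\<bar> ^ j * cmod (\<phi> x) \<le> C"
proof -
  have "bounded (range (\<lambda>x. complex_of_real x ^ j * iter_deriv 0 \<phi> x))"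
    using assms unfolding schwartz_def by blast
  then obtain C where "\<And>x. cmod (complex_of_real x ^ j * iter_deriv 0 \<phi> x) \<le> C"
    unfolding bounded_iff by auto
  then show ?thesis
    by (intro that[of C]) (simp add: norm_mult norm_power)
qed

lemma schwartz_continuous: "\<phi> \<in> schwartz \<Longrightarrow> continuous_on A \<phi>"
  by (meson continuous_at_imp_continuous_on differentiable_imp_continuous_within schwartz_differentiable)

lemma schwartz_borel [measurable_dest]: "\<phi> \<in> schwartz \<Longrightarrow> \<phi> \<in> borel_measurable borel"
  by (intro borel_measurable_continuous_onI schwartz_continuous)

lemma schwartz_lincomb:
  assumes "\<phi> \<in> schwartz" "\<psi> \<in> schwartz"
  shows "(\<lambda>x. a * \<phi> x + b * \<psi> x) \<in> schwartz"
proof -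
  define S where "S = {\<lambda>x. a * \<phi> x + b * \<psi> x | \<phi> \<psi>. \<phi> \<in> schwartz \<and> \<psi> \<in> schwartz}"
  have SI: "(\<lambda>x. a * \<phi> x + b * \<psi> x) \<in> S" if "\<phi> \<in> schwartz" "\<psi> \<in> schwartz" for \<phi> \<psi>
    unfolding S_def using that by blast
  show ?thesis
  proof (rule schwartz_coinduct[where S = S])
    show "(\<lambda>x. a * \<phi> x + b * \<psi> x) \<in> S"
      by (rule SI[OF assms])
  next
    fix f j assume "f \<in> S"
    then obtain \<phi> \<psi> where f: "f = (\<lambda>x. a * \<phi> x + b * \<psi> x)" and S: "\<phi> \<in> schwartz" "\<psi> \<in> schwartz"
      unfolding S_def by blast
    have D: "(f has_vector_derivative a * vector_derivative \<phi> (at x) + b * vector_derivative \<psi> (at x)) (at x)" for x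
      unfolding f by (intro has_vector_derivative_add has_vector_derivative_mult_right
          schwartz_has_vector_derivative[OF S(1)] schwartz_has_vector_derivative[OF S(2)])
    show "f differentiable (at x)" for x
      using D by (rule differentiableI_vector)
    show "(\<lambda>x. vector_derivative f (at x)) \<in> S"
      unfolding vector_derivative_at[OF D] by (rule SI[OF S[THEN schwartz_deriv]])
    obtain C1 where C1: "\<And>x. \<bar>x\<bar> ^ j * cmod (\<phi> x) \<le> C1" using S(1) schwartz_bound by blast
    obtain C2 where C2: "\<And>x. \<bar>x\<bar> ^ j * cmod (\<psi> x) \<le> C2" using S(2) schwartz_bound by blast
    have "\<bar>x\<bar> ^ j * cmod (f x) \<le> cmod a * C1 + cmod b * C2" for x
    proof -
      have "\<bar>x\<bar> ^ j * cmod (f x) \<le> \<bar>x\<bar> ^ j * (cmod a * cmod (\<phi> x) + cmod b * cmod (\<psi> x))"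
        unfolding f by (intro mult_left_mono) (metis norm_triangle_ineq norm_mult, simp)
      also have "\<dots> = cmod a * (\<bar>x\<bar> ^ j * cmod (\<phi> x)) + cmod b * (\<bar>x\<bar> ^ j * cmod (\<psi> x))"
        by (simp add: algebra_simps)
      also have "\<dots> \<le> cmod a * C1 + cmod b * C2"
        by (intro add_mono mult_left_mono C1 C2) auto
      finally show ?thesis .
    qed
    then show "\<exists>C. \<forall>x. \<bar>x\<bar> ^ j * cmod (f x) \<le> C" by blast
  qed
qed

lemma schwartz_cmult: "\<phi> \<in> schwartz \<Longrightarrow> (\<lambda>x. a * \<phi> x) \<in> schwartz"
  using schwartz_lincomb[of \<phi> \<phi> a 0] by simp

lemma schwartz_add: "\<phi> \<in> schwartz \<Longrightarrow> \<psi> \<in> schwartz \<Longrightarrow> (\<lambda>x. \<phi> x + \<psi> x) \<in> schwartz"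
  using schwartz_lincomb[of \<phi> \<psi> 1 1] by simp

lemma schwartz_times_x:
  assumes "\<phi> \<in> schwartz"
  shows "(\<lambda>x. of_real x * \<phi> x) \<in> schwartz"
proof -
  \<comment> \<open>Differentiating x phi produces the extra term phi; the free summand
    \<open>\<psi>\<close> absorbs it and closes the class.\<close>
  define S where "S = {\<lambda>x. of_real x * \<phi> x + \<psi> x | \<phi> \<psi>. \<phi> \<in> schwartz \<and> \<psi> \<in> schwartz}"
  have SI: "(\<lambda>x. of_real x * \<phi> x + \<psi> x) \<in> S" if "\<phi> \<in> schwartz" "\<psi> \<in> schwartz" for \<phi> \<psi>
    unfolding S_def using that by blast
  show ?thesis
  proof (rule schwartz_coinduct[where S = S])
    have "(\<lambda>x. of_real x * \<phi> x + 0 * \<phi> x) \<in> S"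
      by (rule SI[OF assms schwartz_cmult[OF assms]])
    then show "(\<lambda>x. of_real x * \<phi> x) \<in> S" by simp
  next
    fix f j assume "f \<in> S"
    then obtain \<phi> \<psi> where f: "f = (\<lambda>x. of_real x * \<phi> x + \<psi> x)" and S: "\<phi> \<in> schwartz" "\<psi> \<in> schwartz"
      unfolding S_def by blast
    have D: "(f has_vector_derivative of_real x * vector_derivative \<phi> (at x) + (\<phi> x + vector_derivative \<psi> (at x))) (at x)" for x
    proof -
      have "((\<lambda>x. complex_of_real x * \<phi> x + \<psi> x) has_vector_derivative
          (of_real x * vector_derivative \<phi> (at x) + of_real 1 * \<phi> x) + vector_derivative \<psi> (at x)) (at x)"
        by (intro has_vector_derivative_add has_vector_derivative_mult has_vector_derivative_of_real
            schwartz_has_vector_derivative[OF S(1)] schwartz_has_vector_derivative[OF S(2)] DERIV_ident)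
      then show ?thesis by (simp add: f add.assoc)
    qed
    show "f differentiable (at x)" for x
      using D by (rule differentiableI_vector)
    show "(\<lambda>x. vector_derivative f (at x)) \<in> S"
      unfolding vector_derivative_at[OF D]
      by (rule SI[OF schwartz_deriv[OF S(1)] schwartz_add[OF S(1) schwartz_deriv[OF S(2)]]])
    obtain C1 where C1: "\<And>x. \<bar>x\<bar> ^ Suc j * cmod (\<phi> x) \<le> C1" using S(1) schwartz_bound by blast
    obtain C2 where C2: "\<And>x. \<bar>x\<bar> ^ j * cmod (\<psi> x) \<le> C2" using S(2) schwartz_bound by blast
    have "\<bar>x\<bar> ^ j * cmod (f x) \<le> C1 + C2" for x
    proof -
      have "\<bar>x\<bar> ^ j * cmod (f x) \<le> \<bar>x\<bar> ^ j * (\<bar>x\<bar> * cmod (\<phi> x) + cmod (\<psi> x))"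
        unfolding f by (intro mult_left_mono) (metis norm_triangle_ineq norm_mult norm_of_real, simp)
      also have "\<dots> = \<bar>x\<bar> ^ Suc j * cmod (\<phi> x) + \<bar>x\<bar> ^ j * cmod (\<psi> x)"
        by (simp add: algebra_simps)
      also have "\<dots> \<le> C1 + C2"
        by (intro add_mono C1 C2)
      finally show ?thesis .
    qed
    then show "\<exists>C. \<forall>x. \<bar>x\<bar> ^ j * cmod (f x) \<le> C" by blast
  qed
qed

lemma schwartz_reflect:
  assumes "\<phi> \<in> schwartz"
  shows "reflect \<phi> \<in> schwartz"
proof (rule schwartz_coinduct[where S = "reflect ` schwartz"])
  show "reflect \<phi> \<in> reflect ` schwartz" using assms by blast
next
  fix f j assume "f \<in> reflect ` schwartz"
  then obtain \<phi> where f: "f = reflect \<phi>" and S: "\<phi> \<in> schwartz" by blast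
  have D: "(f has_vector_derivative reflect (\<lambda>x. (-1) * vector_derivative \<phi> (at x)) x) (at x)" for x
  proof -
    have "((\<phi> \<circ> uminus) has_vector_derivative (-1) *\<^sub>R vector_derivative \<phi> (at (- x))) (at x)"
      by (rule vector_diff_chain_at)
         (auto intro!: derivative_eq_intros schwartz_has_vector_derivative[OF S])
    then show ?thesis
      by (simp add: f reflect_def[abs_def] o_def)
  qed
  show "f differentiable (at x)" for x
    using D by (rule differentiableI_vector)
  show "(\<lambda>x. vector_derivative f (at x)) \<in> reflect ` schwartz"
    unfolding vector_derivative_at[OF D] using schwartz_cmult[OF schwartz_deriv[OF S]] by blast
  obtain C where C: "\<And>x. \<bar>x\<bar> ^ j * cmod (\<phi> x) \<le> C" using S schwartz_bound by blast
  then have "\<bar>x\<bar> ^ j * cmod (f x) \<le> C" for x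
    using C[of "- x"] by (simp add: f reflect_def)
  then show "\<exists>C. \<forall>x. \<bar>x\<bar> ^ j * cmod (f x) \<le> C" by blast
qed

lemma schwartz_decay:
  assumes "\<phi> \<in> schwartz"
  obtains C where "C \<ge> 0" "\<And>x. (1 + x\<^sup>2) ^ n * cmod (\<phi> x) \<le> C"
proof -
  have "\<exists>C. \<forall>x. (1 + x\<^sup>2) ^ n * cmod (\<phi> x) \<le> C"
    using assms
  \<comment> \<open>Since (1 + x^2)^(n+1) = (1 + x^2)^n + (1 + x^2)^n x^2, the hypothesis is applied
    to phi and to x^2 phi.\<close>
  proof (induction n arbitrary: \<phi>)
    case 0
    then show ?case using schwartz_bound[of \<phi> 0] by (metis power_0)
  next
    case (Suc n)
    obtain C where C: "\<And>x. (1 + x\<^sup>2) ^ n * cmod (\<phi> x) \<le> C"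
      using Suc by blast
    obtain D where D: "\<And>x. (1 + x\<^sup>2) ^ n * cmod (of_real x * (of_real x * \<phi> x)) \<le> D"
      using Suc.IH[OF schwartz_times_x[OF schwartz_times_x[OF Suc.prems]]] by blast
    have "(1 + x\<^sup>2) ^ Suc n * cmod (\<phi> x) \<le> C + D" for x
      using C[of x] D[of x] by (simp add: norm_mult algebra_simps power2_eq_square)
    then show ?case by blast
  qed
  then obtain C where C: "\<And>x. (1 + x\<^sup>2) ^ n * cmod (\<phi> x) \<le> C" by blast
  moreover have "0 \<le> (1 + 0\<^sup>2) ^ n * cmod (\<phi> 0)" by simp
  ultimately show ?thesis using that order_trans by blast
qed

section \<open>Integrability against Schwartz functions\<close>

lemma integrable_Cauchy: "integrable lborel (\<lambda>x::real. 1 / (1 + x\<^sup>2))"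
proof -
  have "set_integrable lborel (einterval (-\<infinity>) \<infinity>) (\<lambda>x::real. inverse (1 + x\<^sup>2))"
    by (rule integrable_inverse_1_plus_square)
  then show ?thesis
    by (simp add: set_integrable_def divide_inverse)
qed

lemma integrable_mult_schwartz:
  assumes "\<phi> \<in> schwartz" and [measurable]: "f \<in> borel_measurable borel"
    and bound: "\<And>x. cmod (f x) \<le> B * (1 + x\<^sup>2) ^ n"
  shows "integrable lborel (\<lambda>x. f x * \<phi> x)"
proof -
  \<comment> \<open>One power beyond the growth of \<open>f\<close> is kept in reserve, leaving a
    multiple of 1 / (1 + x^2) as majorant.\<close>
  obtain C where C: "C \<ge> 0" "\<And>x. (1 + x\<^sup>2) ^ Suc n * cmod (\<phi> x) \<le> C"
    using schwartz_decay[OF assms(1)] by blast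
  have [measurable]: "\<phi> \<in> borel_measurable borel" using assms(1) by (rule schwartz_borel)
  have B: "B \<ge> 0" using order_trans[OF norm_ge_zero bound[of 0]] by simp
  show ?thesis
  proof (rule Bochner_Integration.integrable_bound)
    show "integrable lborel (\<lambda>x. (B * C) * (1 / (1 + x\<^sup>2)))"
      by (intro integrable_mult_right integrable_Cauchy)
    show "AE x in lborel. norm (f x * \<phi> x) \<le> norm (B * C * (1 / (1 + x\<^sup>2)))"
    proof (intro AE_I2)
      fix x :: real
      have p: "1 + x\<^sup>2 > 0" by (simp add: add_pos_nonneg)
      have "norm (f x * \<phi> x) \<le> B * (1 + x\<^sup>2) ^ n * cmod (\<phi> x)"
        unfolding norm_mult by (intro mult_right_mono bound) auto
      then have "norm (f x * \<phi> x) * (1 + x\<^sup>2) \<le> B * ((1 + x\<^sup>2) ^ Suc n * cmod (\<phi> x))"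
        using p mult_right_mono[of _ _ "1 + x\<^sup>2"] by (fastforce simp: algebra_simps)
      also have "\<dots> \<le> B * C" by (intro mult_left_mono C B)
      finally show "norm (f x * \<phi> x) \<le> norm (B * C * (1 / (1 + x\<^sup>2)))"
        using p B C by (simp add: field_simps)
    qed
  qed measurable
qed

lemma integrable_bounded_schwartz:
  assumes "\<phi> \<in> schwartz" "f \<in> borel_measurable borel" "\<And>x. cmod (f x) \<le> B"
  shows "integrable lborel (\<lambda>x. f x * \<phi> x)"
  by (rule integrable_mult_schwartz[where n = 0 and B = B]) (use assms in auto)

lemma integrable_schwartz: "\<phi> \<in> schwartz \<Longrightarrow> integrable lborel \<phi>"
  using integrable_bounded_schwartz[of \<phi> "\<lambda>_. 1" 1] by simp

lemma schwartz_bounded: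
  assumes "\<phi> \<in> schwartz"
  obtains B where "B > 0" "\<And>x. cmod (\<phi> x) \<le> B"
proof -
  obtain C where "\<And>x. \<bar>x\<bar> ^ 0 * cmod (\<phi> x) \<le> C" using assms schwartz_bound by blast
  then have "cmod (\<phi> x) \<le> max C 1" for x by (simp add: le_max_iff_disj)
  then show ?thesis using that[of "max C 1"] by simp
qed

text \<open>These are the test functions of the uniqueness arguments: the Gaussian factor restores
  integrability, and varying \<open>s\<close> reads off the Fourier transform of the
  product.\<close>

lemma schwartz_gaussian:
  "(\<lambda>x. iexp (s * x) * of_real (exp (- x\<^sup>2 / 2))) \<in> schwartz"
proof -
  define G where "G = (\<lambda>p x. poly p (of_real x) * (iexp (s * x) * of_real (exp (- x\<^sup>2 / 2))))"
  have D: "(G p has_vector_derivative G (pderiv p + [:\<i> * of_real s, -1:] * p) x) (at x)" for p x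
  proof -
    have "((\<lambda>x. poly p (of_real x)) has_vector_derivative (poly (pderiv p) (of_real x))) (at x)"
      using has_vector_derivative_real_field[OF poly_DERIV, of p x] by (simp add: o_def)
    moreover have "((\<lambda>x. iexp (s * x)) has_vector_derivative (\<i> * of_real s * iexp (s * x))) (at x)"
    proof -
      have "((\<lambda>z. exp (\<i> * (of_real s * z))) has_field_derivative \<i> * of_real s * iexp (s * x)) (at (of_real x))"
        by (auto intro!: derivative_eq_intros)
      from has_vector_derivative_real_field[OF this] show ?thesis by (simp add: o_def)
    qed
    moreover have "((\<lambda>x. complex_of_real (exp (- x\<^sup>2 / 2))) has_vector_derivative of_real (- x * exp (- x\<^sup>2 / 2))) (at x)"
      by (intro has_vector_derivative_of_real) (auto intro!: derivative_eq_intros simp: has_real_derivative_iff_has_vector_derivative[symmetric])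
    ultimately show ?thesis
      unfolding G_def
      by (auto intro!: derivative_eq_intros simp: algebra_simps)
  qed
  have B: "\<exists>C. \<forall>x. \<bar>x\<bar> ^ j * cmod (G p x) \<le> C" for p j
  \<comment> \<open>Writing the polynomial as a + x p costs one more power of x for p, so
    \<open>j\<close> must vary.\<close>
  proof (induction p arbitrary: j)
    case 0
    then show ?case by (auto simp: G_def)
  next
    case (pCons a p)
    obtain C where C: "\<And>x. \<bar>x\<bar> ^ Suc j * cmod (G p x) \<le> C" using pCons by blast
    \<comment> \<open>A single term of the exponential series bounds x^(2j) by 2^j j! exp(x^2 / 2),
      and |x|^j is at most 1 + x^(2j) whatever the size of x.\<close>
    have E: "\<bar>x\<bar> ^ j * exp (- x\<^sup>2 / 2) \<le> 1 + 2 ^ j * fact j" for x :: real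
    proof -
      have "(x\<^sup>2 / 2) ^ j / fact j \<le> exp (x\<^sup>2 / 2)"
      proof -
        have sums: "(\<lambda>i. (x\<^sup>2 / 2) ^ i /\<^sub>R fact i) sums exp (x\<^sup>2 / 2)"
          by (rule exp_converges)
        have "(\<Sum>i\<in>{j}. (x\<^sup>2 / 2) ^ i /\<^sub>R fact i) \<le> (\<Sum>i. (x\<^sup>2 / 2) ^ i /\<^sub>R fact i)"
          by (intro sum_le_suminf sums_summable[OF sums]) auto
        then show ?thesis unfolding sums_unique[OF sums, symmetric]
          by (simp add: field_simps)
      qed
      then have 1: "\<bar>x\<bar> ^ (2 * j) \<le> 2 ^ j * fact j * exp (x\<^sup>2 / 2)"
        by (simp add: field_simps power_divide power_even_abs flip: power_mult)
      have "\<bar>x\<bar> ^ j \<le> 1 + \<bar>x\<bar> ^ (2 * j)"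
      proof (cases "\<bar>x\<bar> \<le> 1")
        case True
        have "\<bar>x\<bar> ^ j \<le> 1" by (rule power_le_one) (use True in auto)
        then show ?thesis by (simp add: add_increasing2)
      next
        case False
        then have "\<bar>x\<bar> ^ j \<le> \<bar>x\<bar> ^ (2 * j)" by (intro power_increasing) auto
        then show ?thesis by simp
      qed
      also have "\<dots> \<le> (1 + 2 ^ j * fact j) * exp (x\<^sup>2 / 2)"
        using add_mono[OF one_le_exp_iff[THEN iffD2, of "x\<^sup>2 / 2"] 1] by (simp add: algebra_simps)
      finally show ?thesis
        by (simp add: exp_minus field_simps)
    qed
    have "\<bar>x\<bar> ^ j * cmod (G (pCons a p) x) \<le> cmod a * (1 + 2 ^ j * fact j) + C" for x
    proof -
      have "G (pCons a p) x = a * (iexp (s * x) * of_real (exp (- x\<^sup>2 / 2))) + of_real x * G p x"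
        by (simp add: G_def algebra_simps)
      then have "cmod (G (pCons a p) x) \<le> cmod a * exp (- x\<^sup>2 / 2) + \<bar>x\<bar> * cmod (G p x)"
        by (auto intro!: order_trans[OF norm_triangle_ineq] simp: norm_mult)
      then have "\<bar>x\<bar> ^ j * cmod (G (pCons a p) x) \<le> \<bar>x\<bar> ^ j * (cmod a * exp (- x\<^sup>2 / 2) + \<bar>x\<bar> * cmod (G p x))"
        by (intro mult_left_mono) auto
      also have "\<dots> = cmod a * (\<bar>x\<bar> ^ j * exp (- x\<^sup>2 / 2)) + \<bar>x\<bar> ^ Suc j * cmod (G p x)"
        by (simp add: algebra_simps)
      also have "\<dots> \<le> cmod a * (1 + 2 ^ j * fact j) + C"
        by (intro add_mono mult_left_mono E C) auto
      finally show ?thesis .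
    qed
    then show ?case by blast
  qed
  have "G 1 \<in> schwartz"
  proof (rule schwartz_coinduct[where S = "range G"])
    fix f j assume "f \<in> range G"
    then obtain p where f: "f = G p" by blast
    show "f differentiable (at x)" for x
      unfolding f using D by (rule differentiableI_vector)
    show "(\<lambda>x. vector_derivative f (at x)) \<in> range G"
      unfolding f vector_derivative_at[OF D] by blast
    show "\<exists>C. \<forall>x. \<bar>x\<bar> ^ j * cmod (f x) \<le> C"
      unfolding f by (rule B)
  qed auto
  then show ?thesis by (simp add: G_def[abs_def])
qed

section \<open>The Fourier transform\<close>

text \<open>The definitions integrate over \<open>lebesgue\<close>, whereas Fubini, affine
  substitution and characteristic functions are used over \<open>lborel\<close>. For Borel
  integrands the completion changes nothing.\<close>

lemma integral_lebesgue_lborel: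
  fixes f :: "real \<Rightarrow> 'b::{banach, second_countable_topology}"
  shows "f \<in> borel_measurable borel \<Longrightarrow> integral\<^sup>L lebesgue f = integral\<^sup>L lborel f"
  by (rule integral_completion) simp

lemma integrable_lebesgue_lborel:
  fixes f :: "real \<Rightarrow> 'b::{banach, second_countable_topology}"
  shows "f \<in> borel_measurable borel \<Longrightarrow> integrable lebesgue f \<longleftrightarrow> integrable lborel f"
  by (rule integrable_completion) simp

lemma fourier_lborel:
  assumes [measurable]: "f \<in> borel_measurable borel"
  shows "fourier f \<omega> = (CLBINT t. iexp (t * \<omega>) * f t)"
  unfolding fourier_def by (rule integral_lebesgue_lborel) measurable

lemma fourier_borel [measurable]:
  assumes [measurable]: "f \<in> borel_measurable borel"
  shows "fourier f \<in> borel_measurable borel"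
  unfolding fourier_lborel[OF assms, abs_def] by measurable

lemma borel_measurable_cnj [measurable (raw)]:
  "f \<in> borel_measurable M \<Longrightarrow> (\<lambda>x. cnj (f x)) \<in> borel_measurable M"
  by (rule borel_measurable_continuous_on[where f = cnj]) (auto intro!: continuous_intros)

lemma integrable_iexp_mult:
  assumes "integrable lborel f"
  shows "integrable lborel (\<lambda>t. iexp (t * \<omega>) * f t)"
proof -
  have [measurable]: "f \<in> borel_measurable borel" using assms by auto
  show ?thesis
    by (rule Bochner_Integration.integrable_bound[OF assms]) (auto simp: norm_mult)
qed

lemma fourier_bound:
  assumes "integrable lborel f"
  shows "cmod (fourier f \<omega>) \<le> (LBINT t. cmod (f t))"
proof -
  have [measurable]: "f \<in> borel_measurable borel" using assms by auto
  have "cmod (fourier f \<omega>) \<le> (LBINT t. cmod (iexp (t * \<omega>) * f t))"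
    unfolding fourier_lborel[OF \<open>f \<in> borel_measurable borel\<close>] by (rule integral_norm_bound)
  then show ?thesis by (simp add: norm_mult)
qed

lemma fourier_cmult: "fourier (\<lambda>t. a * f t) \<omega> = a * fourier f \<omega>"
proof -
  have "(\<lambda>t. iexp (t * \<omega>) * (a * f t)) = (\<lambda>t. a * (iexp (t * \<omega>) * f t))"
    by (simp add: mult.left_commute)
  then show ?thesis
    unfolding fourier_def by simp
qed

lemma fourier_reflect:
  assumes [measurable]: "f \<in> borel_measurable borel"
  shows "fourier (reflect f) \<omega> = fourier f (- \<omega>)"
proof -
  have [measurable]: "reflect f \<in> borel_measurable borel"
    unfolding reflect_def[abs_def] by measurable
  show ?thesis
    unfolding fourier_lborel[OF assms] fourier_lborel[OF \<open>reflect f \<in> borel_measurable borel\<close>]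
    by (subst lborel_integral_real_affine[of "-1" _ 0]) (auto simp: reflect_def)
qed

text \<open>A quadratic bound on the remainder can be integrated pointwise, which gives
  differentiation under the integral sign without a limit theorem.\<close>

lemma has_vector_derivative_quadratic:
  fixes f :: "real \<Rightarrow> complex"
  assumes bound: "\<And>h. cmod (f (x + h) - f x - of_real h * D) \<le> C * h\<^sup>2"
  shows "(f has_vector_derivative D) (at x)"
  unfolding has_vector_derivative_def has_derivative_at
proof (intro conjI bounded_linear_scaleR_left)
  have *: "cmod (f (x + h) - f x - h *\<^sub>R D) / norm h \<le> \<bar>C\<bar> * \<bar>h\<bar>" for h
  proof (cases "h = 0")
    case False
    have "cmod (f (x + h) - f x - h *\<^sub>R D) \<le> \<bar>C\<bar> * \<bar>h\<bar> * \<bar>h\<bar>"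
      using bound[of h] mult_right_mono[OF abs_ge_self[of C], of "h\<^sup>2"]
      by (simp add: scaleR_conv_of_real power2_eq_square mult.assoc)
    then show ?thesis using False by (simp add: field_simps)
  qed simp
  have "((\<lambda>h. \<bar>C\<bar> * \<bar>h\<bar>) \<longlongrightarrow> \<bar>C\<bar> * \<bar>0\<bar>) (at 0)"
    by (intro tendsto_intros)
  then have lim: "((\<lambda>h. \<bar>C\<bar> * \<bar>h\<bar>) \<longlongrightarrow> 0) (at 0)" by simp
  show "(\<lambda>h. cmod (f (x + h) - f x - h *\<^sub>R D) / norm h) \<midarrow>0\<rightarrow> 0"
    by (rule Lim_null_comparison[OF _ lim], intro always_eventually allI)
       (use * in \<open>simp add: abs_mult\<close>)
qed

text \<open>The first-order remainder of exp(i t h) is at most (t h)^2 / 2, and t^2 phi(t) is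
  integrable, so the remainder of the transform is of order h^2.\<close>

lemma fourier_has_vector_derivative:
  assumes "\<phi> \<in> schwartz"
  shows "(fourier \<phi> has_vector_derivative fourier (\<lambda>t. \<i> * (of_real t * \<phi> t)) \<omega>) (at \<omega>)"
proof (rule has_vector_derivative_quadratic)
  fix h
  have S1: "(\<lambda>t. \<i> * (of_real t * \<phi> t)) \<in> schwartz"
    by (rule schwartz_cmult[OF schwartz_times_x[OF assms]])
  have S2: "(\<lambda>t. of_real t * (of_real t * \<phi> t)) \<in> schwartz"
    by (rule schwartz_times_x[OF schwartz_times_x[OF assms]])
  note i0 = integrable_schwartz[OF assms]
  note i1 = integrable_schwartz[OF S1]
  have i2: "integrable lborel (\<lambda>t. h\<^sup>2 * cmod (of_real t * (of_real t * \<phi> t)))"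
    by (intro integrable_mult_right integrable_norm integrable_schwartz[OF S2])
  have e: "iexp (t * (\<omega> + h)) * \<phi> t - iexp (t * \<omega>) * \<phi> t - of_real h * (iexp (t * \<omega>) * (\<i> * (of_real t * \<phi> t)))
      = iexp (t * \<omega>) * (iexp (t * h) - (1 + \<i> * of_real (t * h))) * \<phi> t" for t
    by (simp add: exp_add algebra_simps)
  have "fourier \<phi> (\<omega> + h) - fourier \<phi> \<omega> - of_real h * fourier (\<lambda>t. \<i> * (of_real t * \<phi> t)) \<omega> =
    (CLBINT t. iexp (t * (\<omega> + h)) * \<phi> t - iexp (t * \<omega>) * \<phi> t
      - of_real h * (iexp (t * \<omega>) * (\<i> * (of_real t * \<phi> t))))"
    unfolding fourier_lborel[OF schwartz_borel[OF assms]] fourier_lborel[OF schwartz_borel[OF S1]]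
    unfolding Bochner_Integration.integral_diff[OF Bochner_Integration.integrable_diff[OF
        integrable_iexp_mult[OF i0] integrable_iexp_mult[OF i0]]
        integrable_mult_right[OF integrable_iexp_mult[OF i1]]]
      Bochner_Integration.integral_diff[OF integrable_iexp_mult[OF i0] integrable_iexp_mult[OF i0]]
    by (simp only: integral_mult_right_zero)
  moreover have "cmod (CLBINT t. iexp (t * (\<omega> + h)) * \<phi> t - iexp (t * \<omega>) * \<phi> t
      - of_real h * (iexp (t * \<omega>) * (\<i> * (of_real t * \<phi> t)))) \<le>
      (LBINT t. h\<^sup>2 * cmod (of_real t * (of_real t * \<phi> t)))"
    unfolding e
  proof (rule order_trans[OF integral_norm_bound Bochner_Integration.integral_mono[OF integrable_norm i2]])
    show "integrable lborel (\<lambda>t. iexp (t * \<omega>) * (iexp (t * h) - (1 + \<i> * of_real (t * h))) * \<phi> t)"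
      unfolding e[symmetric] using integrable_iexp_mult[OF i0] integrable_iexp_mult[OF i1]
      by (intro Bochner_Integration.integrable_diff integrable_mult_right)
    fix t
    have "cmod (iexp (t * h) - (1 + \<i> * of_real (t * h))) \<le> \<bar>t * h\<bar>\<^sup>2 / 2"
      using iexp_approx1[of "t * h" 1] by (simp add: numeral_2_eq_2)
    also have "\<dots> \<le> \<bar>t * h\<bar>\<^sup>2" by simp
    finally have "cmod (iexp (t * h) - (1 + \<i> * of_real (t * h))) * cmod (\<phi> t) \<le> \<bar>t * h\<bar>\<^sup>2 * cmod (\<phi> t)"
      by (rule mult_right_mono) simp
    then show "cmod (iexp (t * \<omega>) * (iexp (t * h) - (1 + \<i> * of_real (t * h))) * \<phi> t)
        \<le> h\<^sup>2 * cmod (of_real t * (of_real t * \<phi> t))"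
      by (simp add: norm_mult power2_eq_square mult_ac)
  qed
  ultimately show "cmod (fourier \<phi> (\<omega> + h) - fourier \<phi> \<omega> - of_real h * fourier (\<lambda>t. \<i> * (of_real t * \<phi> t)) \<omega>)
      \<le> (LBINT t. cmod (of_real t * (of_real t * \<phi> t))) * h\<^sup>2"
    by (simp add: mult.commute)
qed

section \<open>Derivatives, decay and the multiplication formula\<close>

lemma schwartz_tendsto_0:
  assumes "\<phi> \<in> schwartz"
  shows "(\<phi> \<longlongrightarrow> 0) at_top"
proof -
  obtain C where C: "\<And>x. \<bar>x\<bar> ^ 1 * cmod (\<phi> x) \<le> C" using assms schwartz_bound by blast
  have "((\<lambda>x::real. C / x) \<longlongrightarrow> 0) at_top"
    by (intro tendsto_divide_0[OF tendsto_const] filterlim_at_top_imp_at_infinity filterlim_ident)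
  moreover have "eventually (\<lambda>x. cmod (\<phi> x) \<le> C / x) at_top"
    using eventually_gt_at_top[of 0]
  proof eventually_elim
    case (elim x)
    then show ?case using C[of x] by (simp add: field_simps)
  qed
  ultimately show ?thesis by (rule Lim_null_comparison[rotated])
qed

text \<open>Integration by parts: exp(i t omega) phi(t) vanishes at both ends, so its derivative has
  integral zero. The minus sign reflects the convention exp(+ i t omega).\<close>

lemma fourier_deriv:
  assumes "\<phi> \<in> schwartz"
  shows "fourier (\<lambda>x. vector_derivative \<phi> (at x)) \<omega> = - \<i> * of_real \<omega> * fourier \<phi> \<omega>"
proof -
  let ?D = "\<lambda>x. vector_derivative \<phi> (at x)"
  note SD = schwartz_deriv[OF assms]
  note i0 = integrable_iexp_mult[OF integrable_schwartz[OF assms], of \<omega>]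
  note i1 = integrable_iexp_mult[OF integrable_schwartz[OF SD], of \<omega>]
  define F where "F = (\<lambda>t. iexp (t * \<omega>) * \<phi> t)"
  define f where "f = (\<lambda>t. iexp (t * \<omega>) * ?D t + \<i> * of_real \<omega> * (iexp (t * \<omega>) * \<phi> t))"
  have int: "integrable lborel f"
    unfolding f_def by (intro Bochner_Integration.integrable_add integrable_mult_right i0 i1)
  have D: "(F has_vector_derivative f t) (at t)" for t
  proof -
    have "((\<lambda>z. exp (\<i> * (z * of_real \<omega>))) has_field_derivative iexp (t * \<omega>) * (\<i> * of_real \<omega>)) (at (of_real t))"
      by (auto intro!: derivative_eq_intros)
    from has_vector_derivative_real_field[OF this]
    have "((\<lambda>t. iexp (t * \<omega>)) has_vector_derivative (iexp (t * \<omega>) * (\<i> * of_real \<omega>))) (at t)"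
      by (simp add: o_def)
    from has_vector_derivative_mult[OF this schwartz_has_vector_derivative[OF assms, of t]]
    show ?thesis unfolding F_def f_def by (simp add: algebra_simps)
  qed
  have cont: "isCont f t" for t
    unfolding f_def
    using schwartz_continuous[OF assms, of UNIV] schwartz_continuous[OF SD, of UNIV]
    by (intro continuous_intros) (auto simp: continuous_on_eq_continuous_at)
  have lim: "((\<lambda>t. iexp (t * c) * \<psi> t) \<longlongrightarrow> 0) at_top" if "\<psi> \<in> schwartz" for \<psi> c
    by (rule tendsto_0_le[OF schwartz_tendsto_0[OF that], where K = 1]) (simp add: norm_mult)
  have "(LBINT x=-\<infinity>..\<infinity>. f x) = 0 - 0"
  proof (rule interval_integral_FTC_integrable)
    show "set_integrable lborel (einterval (-\<infinity>) \<infinity>) f"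
      using int by (simp add: set_integrable_def)
    show "((F \<circ> real_of_ereal) \<longlongrightarrow> 0) (at_left \<infinity>)"
      unfolding ereal_tendsto_simps F_def by (rule lim[OF assms])
    show "((F \<circ> real_of_ereal) \<longlongrightarrow> 0) (at_right (-\<infinity>))"
      unfolding ereal_tendsto_simps filterlim_at_bot_mirror F_def
      using lim[OF schwartz_reflect[OF assms], of "- \<omega>"] by (simp add: reflect_def)
  qed (use D cont in auto)
  then have "(CLBINT t. f t) = 0"
    by (simp add: interval_lebesgue_integral_def set_lebesgue_integral_def)
  moreover have "(CLBINT t. f t) = fourier ?D \<omega> + \<i> * of_real \<omega> * fourier \<phi> \<omega>"
    unfolding f_def fourier_lborel[OF schwartz_borel[OF assms]] fourier_lborel[OF schwartz_borel[OF SD]]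
    by (subst Bochner_Integration.integral_add[OF i1 integrable_mult_right[OF i0]]) simp
  ultimately show ?thesis by (simp add: add_eq_0_iff2)
qed

text \<open>The transform exchanges smoothness and decay: its derivative is the transform of i t
  phi, and a factor omega is absorbed by differentiating phi. Hence the image of
  \<open>schwartz\<close> is itself a class to which \<open>schwartz_coinduct\<close>
  applies.\<close>

lemma fourier_schwartz:
  assumes "\<phi> \<in> schwartz"
  shows "fourier \<phi> \<in> schwartz"
proof (rule schwartz_coinduct[where S = "fourier ` schwartz"])
  show "fourier \<phi> \<in> fourier ` schwartz" using assms by blast
next
  fix f j assume "f \<in> fourier ` schwartz"
  then obtain \<phi> where f: "f = fourier \<phi>" and S: "\<phi> \<in> schwartz" by blast
  note D = fourier_has_vector_derivative[OF S]
  show "f differentiable (at x)" for x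
    unfolding f using D by (rule differentiableI_vector)
  show "(\<lambda>x. vector_derivative f (at x)) \<in> fourier ` schwartz"
    unfolding f vector_derivative_at[OF D] using schwartz_cmult[OF schwartz_times_x[OF S], of \<i>] by blast
  show "\<exists>C. \<forall>x. \<bar>x\<bar> ^ j * cmod (f x) \<le> C"
    unfolding f using S
  proof (induction j arbitrary: \<phi>)
    case 0
    then show ?case using fourier_bound[OF integrable_schwartz] by auto
  next
    case (Suc j)
    obtain C where C: "\<And>x. \<bar>x\<bar> ^ j * cmod (fourier (\<lambda>x. vector_derivative \<phi> (at x)) x) \<le> C"
      using Suc.IH[OF schwartz_deriv[OF Suc.prems]] by blast
    have "\<bar>x\<bar> ^ Suc j * cmod (fourier \<phi> x) \<le> C" for x
      using C[of x] unfolding fourier_deriv[OF Suc.prems] by (simp add: norm_mult mult_ac)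
    then show ?case by blast
  qed
qed

text \<open>Fubini for the kernel exp(i x y), whose modulus 1 leaves |f(x)| |g(y)| as integrable
  majorant. This symmetry drives the inversion theorem and all convolution formulas.\<close>

lemma integral_fourier_mult:
  assumes f: "integrable lborel f" and g: "integrable lborel g"
  shows "(CLBINT x. fourier f x * g x) = (CLBINT x. f x * fourier g x)"
proof -
  have [measurable]: "f \<in> borel_measurable borel" "g \<in> borel_measurable borel"
    using f g by auto
  have "integrable (lborel \<Otimes>\<^sub>M lborel) (\<lambda>(x, y). iexp (x * y) * f x * g y)"
  proof (rule lborel_pair.Fubini_integrable)
    have "integrable lborel (\<lambda>x. cmod (f x) * (LBINT y. cmod (g y)))"
      by (intro integrable_mult_left integrable_norm f)
    then show "integrable lborel (\<lambda>x. LBINT y. norm (case (x, y) of (x, y) \<Rightarrow> iexp (x * y) * f x * g y))"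
      by (simp add: norm_mult)
    show "AE x in lborel. integrable lborel (\<lambda>y. case (x, y) of (x, y) \<Rightarrow> iexp (x * y) * f x * g y)"
    proof (intro AE_I2)
      fix x
      have "integrable lborel (\<lambda>y. f x * (iexp (y * x) * g y))"
        by (intro integrable_mult_right integrable_iexp_mult g)
      then show "integrable lborel (\<lambda>y. case (x, y) of (x, y) \<Rightarrow> iexp (x * y) * f x * g y)"
        by (simp add: mult_ac)
    qed
  qed measurable
  from lborel_pair.Fubini_integral[OF this]
  have "(CLBINT y. CLBINT x. iexp (x * y) * f x * g y) = (CLBINT x. CLBINT y. iexp (x * y) * f x * g y)"
    by (simp only: prod.case)
  moreover have "(CLBINT x. iexp (x * y) * f x * g y) = fourier f y * g y" for y
    unfolding fourier_lborel[OF \<open>f \<in> borel_measurable borel\<close>] by (rule integral_mult_left_zero)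
  moreover have "(CLBINT y. iexp (x * y) * f x * g y) = f x * fourier g x" for x
  proof -
    have "(\<lambda>y. iexp (x * y) * f x * g y) = (\<lambda>y. f x * (iexp (y * x) * g y))"
      by (simp add: mult_ac)
    then show ?thesis
      unfolding fourier_lborel[OF \<open>g \<in> borel_measurable borel\<close>] by simp
  qed
  ultimately show ?thesis by (simp only:)
qed

section \<open>Fourier inversion and uniqueness\<close>

lemma iexp_add: "iexp (a + b) = iexp a * iexp b"
  by (simp add: exp_add distrib_left)

text \<open>Read off from the characteristic function of the standard normal law by removing its
  normalization.\<close>

lemma fourier_gaussian:
  "(CLBINT x. iexp (t * x) * of_real (exp (- x\<^sup>2 / 2))) = of_real (sqrt (2 * pi) * exp (- t\<^sup>2 / 2))"
proof -
  have "char std_normal_distribution t = (CLBINT x. std_normal_density x *\<^sub>R iexp (t * x))"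
    unfolding char_def by (subst integral_density) (auto simp: normal_density_nonneg)
  moreover have "(\<lambda>x. std_normal_density x *\<^sub>R iexp (t * x)) =
      (\<lambda>x. of_real (1 / sqrt (2 * pi)) * (iexp (t * x) * of_real (exp (- x\<^sup>2 / 2))))"
    by (simp add: std_normal_density_def scaleR_conv_of_real mult_ac)
  ultimately have "of_real (1 / sqrt (2 * pi)) * (CLBINT x. iexp (t * x) * of_real (exp (- x\<^sup>2 / 2)))
      = complex_of_real (exp (- t\<^sup>2 / 2))"
    unfolding char_std_normal_distribution by (simp only: integral_mult_right_zero)
  then show ?thesis
    by (simp add: field_simps)
qed

text \<open>As a function of t the right-hand side has integral 2 pi and concentrates at -x as N
  grows. This approximate identity is what inversion needs.\<close>

lemma fourier_modulated_gaussian: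
  assumes "N > 0"
  shows "fourier (\<lambda>\<omega>. iexp (x * \<omega>) * of_real (exp (- (\<omega> / N)\<^sup>2 / 2))) t =
    of_real (N * sqrt (2 * pi) * exp (- (N * (t + x))\<^sup>2 / 2))"
proof -
  have "fourier (\<lambda>\<omega>. iexp (x * \<omega>) * of_real (exp (- (\<omega> / N)\<^sup>2 / 2))) t =
      (CLBINT \<omega>. iexp (\<omega> * t) * (iexp (x * \<omega>) * of_real (exp (- (\<omega> / N)\<^sup>2 / 2))))"
    by (rule fourier_lborel) measurable
  also have "\<dots> = \<bar>N\<bar> *\<^sub>R (CLBINT y. iexp ((0 + N * y) * t) * (iexp (x * (0 + N * y)) * of_real (exp (- ((0 + N * y) / N)\<^sup>2 / 2))))"
    using assms by (subst lborel_integral_real_affine[of N _ 0]) auto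
  also have "(\<lambda>y. iexp ((0 + N * y) * t) * (iexp (x * (0 + N * y)) * complex_of_real (exp (- ((0 + N * y) / N)\<^sup>2 / 2)))) =
      (\<lambda>y. iexp (N * (t + x) * y) * of_real (exp (- y\<^sup>2 / 2)))"
  proof
    fix y
    have "iexp ((0 + N * y) * t) * iexp (x * (0 + N * y)) = iexp (N * (t + x) * y)"
      unfolding iexp_add[symmetric] by (rule arg_cong[where f = "\<lambda>r. iexp r"]) (simp add: algebra_simps)
    then show "iexp ((0 + N * y) * t) * (iexp (x * (0 + N * y)) * complex_of_real (exp (- ((0 + N * y) / N)\<^sup>2 / 2)))
        = iexp (N * (t + x) * y) * of_real (exp (- y\<^sup>2 / 2))"
      using assms by (simp only: mult.assoc[symmetric]) simp
  qed
  finally show ?thesis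
    using assms unfolding fourier_gaussian by (simp add: scaleR_conv_of_real mult.assoc)
qed

text \<open>Gaussian summability: the cutoff \<open>g n\<close> tends to exp(i x omega), while the
  multiplication formula turns the cut off integral into an average of phi around -x. Both limits
  are taken by dominated convergence. One factor sqrt(2 pi) comes from the transform of the cutoff,
  the other from the mass of the Gaussian.\<close>

lemma fourier_inversion:
  fixes \<phi> :: "real \<Rightarrow> complex"
  assumes "\<phi> \<in> schwartz"
  shows "fourier (fourier \<phi>) x = of_real (2 * pi) * \<phi> (- x)"
proof -
  define N where "N n = real (Suc n)" for n
  have N: "N n > 0" for n by (simp add: N_def)
  have Nlim: "(\<lambda>n. inverse (N n)) \<longlonglongrightarrow> 0"
    unfolding N_def by (rule LIMSEQ_inverse_real_of_nat)
  define g where "g n = (\<lambda>\<omega>. iexp (x * \<omega>) * complex_of_real (exp (- (\<omega> / N n)\<^sup>2 / 2)))" for n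
  have [measurable]: "g n \<in> borel_measurable borel" for n unfolding g_def by measurable
  have [measurable]: "\<phi> \<in> borel_measurable borel" using assms by (rule schwartz_borel)
  have g_int: "integrable lborel (g n)" for n
  proof -
    have "integrable lborel (\<lambda>\<omega>. iexp (x * N n * (0 + inverse (N n) * \<omega>)) * complex_of_real (exp (- (0 + inverse (N n) * \<omega>)\<^sup>2 / 2)))"
      using N[of n] by (intro lborel_integrable_real_affine integrable_schwartz[OF schwartz_gaussian]) simp
    moreover have "(\<lambda>\<omega>. iexp (x * N n * (0 + inverse (N n) * \<omega>)) * complex_of_real (exp (- (0 + inverse (N n) * \<omega>)\<^sup>2 / 2))) = g n"
      using N[of n] by (auto simp: fun_eq_iff g_def field_simps)
    ultimately show ?thesis by simp
  qed
  obtain B where B: "B > 0" "\<And>x. cmod (\<phi> x) \<le> B" using schwartz_bounded[OF assms] by blast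
  have gauss_int: "integrable lborel (\<lambda>y::real. complex_of_real (exp (- y\<^sup>2 / 2)))"
    using integrable_schwartz[OF schwartz_gaussian[of 0]] by simp
  \<comment> \<open>The substitution t = -x + y / N moves \<open>n\<close> from the Gaussian into
    the argument of phi, so one majorant serves for all \<open>n\<close>.\<close>
  have I: "(CLBINT \<omega>. fourier \<phi> \<omega> * g n \<omega>) =
      of_real (sqrt (2 * pi)) * (CLBINT y. \<phi> (- x + inverse (N n) * y) * of_real (exp (- y\<^sup>2 / 2)))" for n
  proof -
    have "(CLBINT \<omega>. fourier \<phi> \<omega> * g n \<omega>) = (CLBINT t. \<phi> t * fourier (g n) t)"
      by (rule integral_fourier_mult[OF integrable_schwartz[OF assms] g_int])
    moreover have "\<dots> = (CLBINT t. \<phi> t * of_real (N n * sqrt (2 * pi) * exp (- (N n * (t + x))\<^sup>2 / 2)))"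
      unfolding g_def fourier_modulated_gaussian[OF N] ..
    moreover have "\<dots> = \<bar>inverse (N n)\<bar> *\<^sub>R (CLBINT y. \<phi> (- x + inverse (N n) * y) *
        of_real (N n * sqrt (2 * pi) * exp (- (N n * ((- x + inverse (N n) * y) + x))\<^sup>2 / 2)))"
      using N[of n] by (subst lborel_integral_real_affine[of "inverse (N n)" _ "- x"]) auto
    moreover have "(\<lambda>y. \<phi> (- x + inverse (N n) * y) *
        complex_of_real (N n * sqrt (2 * pi) * exp (- (N n * ((- x + inverse (N n) * y) + x))\<^sup>2 / 2))) =
       (\<lambda>y. of_real (N n * sqrt (2 * pi)) * (\<phi> (- x + inverse (N n) * y) * of_real (exp (- y\<^sup>2 / 2))))"
      using N[of n] by (auto simp: fun_eq_iff field_simps)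
    ultimately show ?thesis
      using N[of n] by (simp add: scaleR_conv_of_real)
  qed
  have "(\<lambda>n. CLBINT \<omega>. fourier \<phi> \<omega> * g n \<omega>) \<longlonglongrightarrow> (CLBINT \<omega>. fourier \<phi> \<omega> * iexp (x * \<omega>))"
  proof (rule integral_dominated_convergence[where w = "\<lambda>\<omega>. cmod (fourier \<phi> \<omega>)"])
    show "integrable lborel (\<lambda>\<omega>. cmod (fourier \<phi> \<omega>))"
      by (intro integrable_norm integrable_schwartz fourier_schwartz assms)
    show "AE \<omega> in lborel. (\<lambda>n. fourier \<phi> \<omega> * g n \<omega>) \<longlonglongrightarrow> fourier \<phi> \<omega> * iexp (x * \<omega>)"
    proof (intro AE_I2)
      fix \<omega>
      have "(\<lambda>n. fourier \<phi> \<omega> * (iexp (x * \<omega>) * complex_of_real (exp (- (\<omega> * inverse (N n))\<^sup>2 / 2))))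
          \<longlonglongrightarrow> fourier \<phi> \<omega> * (iexp (x * \<omega>) * complex_of_real (exp (- (\<omega> * 0)\<^sup>2 / 2)))"
        by (intro tendsto_mult tendsto_const tendsto_of_real tendsto_exp tendsto_divide tendsto_minus
            tendsto_power Nlim) simp
      then show "(\<lambda>n. fourier \<phi> \<omega> * g n \<omega>) \<longlonglongrightarrow> fourier \<phi> \<omega> * iexp (x * \<omega>)"
        by (simp add: g_def divide_inverse[of \<omega>])
    qed
    show "AE \<omega> in lborel. norm (fourier \<phi> \<omega> * g n \<omega>) \<le> cmod (fourier \<phi> \<omega>)" for n
      by (auto simp: g_def norm_mult intro!: AE_I2 mult_left_le)
  qed measurable
  moreover have "(CLBINT \<omega>. fourier \<phi> \<omega> * iexp (x * \<omega>)) = fourier (fourier \<phi>) x"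
  proof -
    have "(\<lambda>\<omega>. fourier \<phi> \<omega> * iexp (x * \<omega>)) = (\<lambda>\<omega>. iexp (\<omega> * x) * fourier \<phi> \<omega>)"
      by (simp add: mult.commute)
    then show ?thesis by (simp only: fourier_lborel[OF fourier_borel[OF \<open>\<phi> \<in> borel_measurable borel\<close>]])
  qed
  ultimately have L: "(\<lambda>n. CLBINT \<omega>. fourier \<phi> \<omega> * g n \<omega>) \<longlonglongrightarrow> fourier (fourier \<phi>) x" by (simp only:)
  have "(\<lambda>n. CLBINT y. \<phi> (- x + inverse (N n) * y) * of_real (exp (- y\<^sup>2 / 2))) \<longlonglongrightarrow>
      (CLBINT y. \<phi> (- x) * of_real (exp (- y\<^sup>2 / 2)))"
  proof (rule integral_dominated_convergence[where w = "\<lambda>y. B * cmod (of_real (exp (- y\<^sup>2 / 2)))"])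
    show "integrable lborel (\<lambda>y::real. B * cmod (of_real (exp (- y\<^sup>2 / 2))))"
      by (intro integrable_mult_right integrable_norm gauss_int)
    show "AE y in lborel. (\<lambda>n. \<phi> (- x + inverse (N n) * y) * of_real (exp (- y\<^sup>2 / 2))) \<longlonglongrightarrow>
        \<phi> (- x) * of_real (exp (- y\<^sup>2 / 2))"
    proof (intro AE_I2 tendsto_mult tendsto_const)
      fix y
      have "isCont \<phi> (- x)"
        using schwartz_continuous[OF assms, of UNIV] by (auto simp: continuous_on_eq_continuous_at)
      moreover have "(\<lambda>n. - x + inverse (N n) * y) \<longlonglongrightarrow> - x + 0 * y"
        by (intro tendsto_intros Nlim)
      ultimately show "(\<lambda>n. \<phi> (- x + inverse (N n) * y)) \<longlonglongrightarrow> \<phi> (- x)"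
        by (intro isCont_tendsto_compose[of "- x" \<phi>]) auto
    qed
    show "AE y in lborel. norm (\<phi> (- x + inverse (N n) * y) * of_real (exp (- y\<^sup>2 / 2))) \<le>
        B * cmod (of_real (exp (- y\<^sup>2 / 2)))" for n
      by (intro AE_I2) (simp add: norm_mult B)
  qed measurable
  then have R: "(\<lambda>n. of_real (sqrt (2 * pi)) * (CLBINT y. \<phi> (- x + inverse (N n) * y) * of_real (exp (- y\<^sup>2 / 2)))) \<longlonglongrightarrow>
      of_real (sqrt (2 * pi)) * (CLBINT y. \<phi> (- x) * of_real (exp (- y\<^sup>2 / 2)))"
    by (rule tendsto_mult_left)
  have "(CLBINT y. of_real (exp (- y\<^sup>2 / 2))) = complex_of_real (sqrt (2 * pi))"
    using fourier_gaussian[of 0] by simp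
  then have "fourier (fourier \<phi>) x = of_real (sqrt (2 * pi)) * (\<phi> (- x) * of_real (sqrt (2 * pi)))"
    using LIMSEQ_unique[OF L[unfolded I] R] by (simp only: integral_mult_right_zero)
  moreover have "complex_of_real (sqrt (2 * pi)) * of_real (sqrt (2 * pi)) = of_real (2 * pi)"
    by (simp flip: of_real_mult)
  ultimately show ?thesis by (simp only: mult_ac)
qed

text \<open>Covariance identities see test functions only through their transforms; this makes every
  Schwartz function, in particular a modulated Gaussian, available there.\<close>

lemma fourier_surj:
  assumes "\<phi> \<in> schwartz"
  obtains \<psi> where "\<psi> \<in> schwartz" "fourier \<psi> = \<phi>"
proof
  show S: "(\<lambda>x. of_real (1 / (2 * pi)) * fourier (reflect \<phi>) x) \<in> schwartz"
    by (intro schwartz_cmult fourier_schwartz schwartz_reflect assms)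
  show "fourier (\<lambda>x. of_real (1 / (2 * pi)) * fourier (reflect \<phi>) x) = \<phi>"
    unfolding fourier_cmult[abs_def] fourier_inversion[OF schwartz_reflect[OF assms]]
    by (simp add: reflect_def)
qed

section \<open>Convolutions on the Fourier side\<close>

lemma conv_fourier:
  assumes \<kappa>: "integrable lborel \<kappa>" and a: "integrable lborel a"
  shows "conv \<kappa> (fourier a) t = (CLBINT \<omega>. fourier \<kappa> \<omega> * (iexp (- (t * \<omega>)) * a (- \<omega>)))"
proof -
  have [measurable]: "\<kappa> \<in> borel_measurable borel" "a \<in> borel_measurable borel" using \<kappa> a by auto
  \<comment> \<open>Seen as a function of u, \<open>fourier a (t - u)\<close> is itself a transform:
    reflecting the variable of \<open>a\<close> turns -u into u and the shift by t into a
    modulation. The multiplication formula then moves the transform onto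
    \<open>\<kappa>\<close>.\<close>
  define G where "G = (\<lambda>\<omega>. iexp (- (t * \<omega>)) * a (- \<omega>))"
  have [measurable]: "G \<in> borel_measurable borel" unfolding G_def by measurable
  have "integrable lborel (\<lambda>\<omega>. a (0 + (-1) * \<omega>))"
    by (rule lborel_integrable_real_affine[OF a]) simp
  then have G: "integrable lborel G"
    using integrable_iexp_mult[of "\<lambda>\<omega>. a (- \<omega>)" "- t"] unfolding G_def by (simp add: mult.commute)
  have "fourier a (t - u) = fourier G u" for u
  proof -
    have "iexp (\<omega> * u) * G \<omega> = iexp ((0 + (-1) * \<omega>) * (t - u)) * a (0 + (-1) * \<omega>)" for \<omega>
    proof -
      have "iexp (\<omega> * u) * iexp (- (t * \<omega>)) = iexp ((0 + (-1) * \<omega>) * (t - u))"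
        unfolding iexp_add[symmetric] by (rule arg_cong[where f = "\<lambda>r. iexp r"]) (simp add: algebra_simps)
      then show ?thesis by (simp add: G_def mult.assoc[symmetric])
    qed
    then show ?thesis
      unfolding fourier_lborel[OF \<open>a \<in> borel_measurable borel\<close>] fourier_lborel[OF \<open>G \<in> borel_measurable borel\<close>]
      by (subst lborel_integral_real_affine[of "-1" _ 0]) (simp_all only:, simp)
  qed
  then have "conv \<kappa> (fourier a) t = (CLBINT u. \<kappa> u * fourier G u)"
    unfolding conv_def by (subst integral_lebesgue_lborel) auto
  then show ?thesis
    unfolding integral_fourier_mult[OF \<kappa> G, symmetric] by (simp only: G_def)
qed

lemma conv_star:
  assumes \<phi>: "\<phi> \<in> schwartz" and \<psi>: "\<psi> \<in> schwartz"
  shows "conv \<phi> (star \<psi>) t =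
    of_real (1 / (2 * pi)) * (CLBINT \<omega>. iexp (- (t * \<omega>)) * (fourier \<phi> \<omega> * cnj (fourier \<psi> \<omega>)))"
proof -
  note F = fourier_schwartz[OF \<psi>]
  have [measurable]: "fourier \<psi> \<in> borel_measurable borel" by (rule schwartz_borel[OF F])
  \<comment> \<open>By inversion this is the preimage of \<open>star \<psi>\<close> under the
    transform; \<open>conv_fourier\<close> undoes the reflection in its argument.\<close>
  define a where "a = (\<lambda>\<omega>. of_real (1 / (2 * pi)) * cnj (fourier \<psi> (- \<omega>)))"
  have "integrable lborel (\<lambda>\<omega>. fourier \<psi> (0 + (-1) * \<omega>))"
    by (rule lborel_integrable_real_affine[OF integrable_schwartz[OF F]]) simp
  then have a: "integrable lborel a"
    unfolding a_def by (intro integrable_mult_right integrable_bounded_linear[OF bounded_linear_cnj]) simp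
  then have [measurable]: "a \<in> borel_measurable borel" by auto
  have "star \<psi> s = fourier a s" for s
  proof -
    have "star \<psi> s = of_real (1 / (2 * pi)) * cnj (fourier (fourier \<psi>) s)"
      by (simp add: star_def fourier_inversion[OF \<psi>])
    moreover have "cnj (fourier (fourier \<psi>) s) = (CLBINT \<omega>. cnj (iexp (\<omega> * s) * fourier \<psi> \<omega>))"
      unfolding fourier_lborel[OF \<open>fourier \<psi> \<in> borel_measurable borel\<close>] by (rule Bochner_Integration.integral_cnj[symmetric])
    moreover have "fourier a s = of_real (1 / (2 * pi)) * (CLBINT \<omega>. cnj (iexp (\<omega> * s) * fourier \<psi> \<omega>))"
      unfolding fourier_lborel[OF \<open>a \<in> borel_measurable borel\<close>]
      by (subst lborel_integral_real_affine[of "-1" _ 0])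
         (auto simp: a_def exp_cnj mult.left_commute)
    ultimately show ?thesis by simp
  qed
  then have "star \<psi> = fourier a" by (rule ext)
  then have "conv \<phi> (star \<psi>) t = (CLBINT \<omega>. fourier \<phi> \<omega> * (iexp (- (t * \<omega>)) * a (- \<omega>)))"
    by (simp only: conv_fourier[OF integrable_schwartz[OF \<phi>] a])
  moreover have "(\<lambda>\<omega>. fourier \<phi> \<omega> * (iexp (- (t * \<omega>)) * a (- \<omega>))) =
      (\<lambda>\<omega>. of_real (1 / (2 * pi)) * (iexp (- (t * \<omega>)) * (fourier \<phi> \<omega> * cnj (fourier \<psi> \<omega>))))"
    by (auto simp: a_def fun_eq_iff)
  ultimately show ?thesis by (simp only: integral_mult_right_zero)
qed

lemma conv_borel:
  assumes [measurable]: "f \<in> borel_measurable borel" "g \<in> borel_measurable borel"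
  shows "conv f g \<in> borel_measurable borel"
proof -
  have "conv f g = (\<lambda>t. CLBINT u. f u * g (t - u))"
    unfolding conv_def by (intro ext integral_lebesgue_lborel) measurable
  then show ?thesis by simp
qed

text \<open>For \<open>\<phi> = fourier a\<close> the convolution is the transform of
  \<open>H\<close>, so the multiplication formula applies to \<open>H\<close> and
  \<open>fourier \<psi>\<close>. The factor 2 pi from inverting at \<open>\<psi>\<close> turns
  \<open>a (- \<omega>)\<close> into \<open>fourier (fourier a)\<close>, that is,
  \<open>fourier \<phi>\<close>.\<close>

lemma integral_conv_fourier:
  assumes \<kappa>: "integrable lborel \<kappa>" and \<phi>: "\<phi> \<in> schwartz" and \<psi>: "\<psi> \<in> schwartz"
  shows "(CLBINT t. conv \<kappa> \<phi> t * fourier \<psi> t) = (CLBINT \<omega>. fourier \<kappa> \<omega> * fourier \<phi> \<omega> * \<psi> \<omega>)"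
proof -
  have [measurable]: "\<kappa> \<in> borel_measurable borel" using \<kappa> by auto
  obtain a where a: "a \<in> schwartz" "fourier a = \<phi>" using fourier_surj[OF \<phi>] by blast
  have [measurable]: "a \<in> borel_measurable borel" by (rule schwartz_borel[OF a(1)])
  have [measurable]: "\<psi> \<in> borel_measurable borel" by (rule schwartz_borel[OF \<psi>])
  define H where "H = (\<lambda>\<omega>. fourier \<kappa> (- \<omega>) * a \<omega>)"
  have [measurable]: "H \<in> borel_measurable borel" unfolding H_def by measurable
  have H: "integrable lborel H"
    unfolding H_def by (rule integrable_bounded_schwartz[OF a(1) _ fourier_bound[OF \<kappa>]]) measurable
  have "conv \<kappa> \<phi> t = fourier H t" for t
    unfolding a(2)[symmetric] conv_fourier[OF \<kappa> integrable_schwartz[OF a(1)]]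
      fourier_lborel[OF \<open>H \<in> borel_measurable borel\<close>]
    by (subst lborel_integral_real_affine[of "-1" _ 0]) (auto simp: H_def mult_ac)
  then have "(CLBINT t. conv \<kappa> \<phi> t * fourier \<psi> t) = (CLBINT t. fourier H t * fourier \<psi> t)"
    by (simp only:)
  moreover have "\<dots> = (CLBINT t. H t * fourier (fourier \<psi>) t)"
    by (rule integral_fourier_mult[OF H integrable_schwartz[OF fourier_schwartz[OF \<psi>]]])
  moreover have "\<dots> = (CLBINT \<omega>. fourier \<kappa> \<omega> * fourier (fourier a) \<omega> * \<psi> \<omega>)"
    unfolding fourier_inversion[OF \<psi>] fourier_inversion[OF a(1)]
    by (subst lborel_integral_real_affine[of "-1" _ 0]) (auto simp: H_def mult_ac)
  ultimately show ?thesis by (simp only: a(2))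
qed

section \<open>Uniqueness from Fourier transforms\<close>

lemma finite_measure_eqI_char:
  assumes "finite_measure M1" "finite_measure M2" "sets M1 = sets borel" "sets M2 = sets borel"
    and char: "\<And>t. (CLINT x|M1. iexp (t * x)) = (CLINT x|M2. iexp (t * x))"
  shows "M1 = M2"
proof -
  interpret M1: finite_measure M1 by fact
  interpret M2: finite_measure M2 by fact
  have sp: "space M1 = UNIV" "space M2 = UNIV"
    using assms(3,4)[THEN sets_eq_imp_space_eq] by auto
  \<comment> \<open>Levy's theorem concerns probability measures. At t = 0 the hypothesis equates
    the total masses, so dividing by the common mass reduces to it; mass zero is treated
    apart.\<close>
  define c where "c = measure M1 UNIV"
  have c: "measure M1 UNIV = c" "measure M2 UNIV = c"
    using char[of 0] sp by (auto simp: c_def)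
  have e: "emeasure M1 UNIV = ennreal c" "emeasure M2 UNIV = ennreal c"
    using M1.emeasure_eq_measure[of UNIV] M2.emeasure_eq_measure[of UNIV] c by auto
  show ?thesis
  proof (cases "c = 0")
    case True
    show ?thesis
    proof (rule measure_eqI)
      fix A
      have "emeasure M1 A \<le> 0" "emeasure M2 A \<le> 0"
        using emeasure_space[of M1 A] emeasure_space[of M2 A] e True sp by auto
      then show "emeasure M1 A = emeasure M2 A" by simp
    qed (simp add: assms)
  next
    case False
    then have cpos: "c > 0" using measure_nonneg[of M1 UNIV] c by linarith
    define D where "D M = density M (\<lambda>_. ennreal (1 / c))" for M :: "real measure"
    have dist: "real_distribution (D M)" if "emeasure M UNIV = ennreal c" "sets M = sets borel" "space M = UNIV" for M
    proof -
      have "prob_space (D M)"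
        using that cpos by (intro prob_spaceI) (auto simp: D_def emeasure_density nn_integral_cmult ennreal_mult[symmetric])
      then show ?thesis
        using that by (auto simp: real_distribution_def real_distribution_axioms_def D_def)
    qed
    have ch: "char (D M) t = (1 / c) *\<^sub>R (CLINT x|M. iexp (t * x))" if "sets M = sets borel" for M t
    proof -
      have [measurable_cong]: "sets M = sets borel" by fact
      show ?thesis
        unfolding char_def D_def using cpos by (subst integral_density) auto
    qed
    have D: "D M1 = D M2"
      by (rule Levy_uniqueness; (rule ext)?) (simp_all only: dist e assms sp ch char)
    show ?thesis
    proof (rule measure_eqI)
      fix A assume A: "A \<in> sets M1"
      have "emeasure (D M) A = ennreal (1 / c) * emeasure M A" if "A \<in> sets M" for M
        unfolding D_def using that by (simp add: emeasure_density nn_integral_cmult_indicator)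
      then have "ennreal (1 / c) * emeasure M1 A = ennreal (1 / c) * emeasure M2 A"
        using D A assms by metis
      then show "emeasure M1 A = emeasure M2 A"
        using cpos by (subst (asm) ennreal_mult_cancel_left) auto
    qed (simp add: assms)
  qed
qed

lemma AE_0_of_real_fourier_0:
  fixes f :: "real \<Rightarrow> real"
  assumes f: "integrable lborel f" and 0: "\<And>t. (CLBINT x. iexp (t * x) * of_real (f x)) = 0"
  shows "AE x in lborel. f x = 0"
proof -
  have [measurable]: "f \<in> borel_measurable borel" using f by auto
  \<comment> \<open>\<open>P 1\<close> and \<open>P (- 1)\<close> have the positive and the negative
    part of \<open>f\<close> as densities. The vanishing transform makes their characteristic
    functions equal, and a function whose positive and negative parts agree is zero.\<close>
  define P where "P s = density lborel (\<lambda>x. ennreal (max 0 (s * f x)))" for s :: real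
  have i: "integrable lborel (\<lambda>x. max 0 (s * f x))" for s
    by (intro integrable_max integrable_mult_right f) simp
  have ic: "integrable lborel (\<lambda>x. iexp (x * t) * complex_of_real (max 0 (s * f x)))" for s t
    by (intro integrable_iexp_mult integrable_of_real i)
  have "P 1 = P (- 1)"
  proof (rule finite_measure_eqI_char)
    have "finite_measure (P s)" for s
    proof (rule finite_measureI)
      have "emeasure (P s) (space (P s)) = (\<integral>\<^sup>+x. ennreal (max 0 (s * f x)) \<partial>lborel)"
        by (simp add: P_def emeasure_density)
      also have "\<dots> = ennreal (LBINT x. max 0 (s * f x))"
        by (rule nn_integral_eq_integral[OF i]) simp
      finally show "emeasure (P s) (space (P s)) \<noteq> \<infinity>" by simp
    qed
    then show "finite_measure (P 1)" "finite_measure (P (- 1))" by auto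
    show "sets (P 1) = sets borel" "sets (P (- 1)) = sets borel" by (auto simp: P_def)
    fix t
    have I: "(CLINT x|P s. iexp (t * x)) = (CLBINT x. iexp (x * t) * complex_of_real (max 0 (s * f x)))" for s
      unfolding P_def by (subst integral_density) (auto simp: scaleR_conv_of_real mult.commute)
    have "(CLBINT x. iexp (x * t) * complex_of_real (max 0 (1 * f x))) - (CLBINT x. iexp (x * t) * complex_of_real (max 0 (- 1 * f x))) =
      (CLBINT x. iexp (x * t) * complex_of_real (max 0 (1 * f x)) - iexp (x * t) * complex_of_real (max 0 (- 1 * f x)))"
      by (rule Bochner_Integration.integral_diff[OF ic ic, symmetric])
    moreover have "(\<lambda>x. iexp (x * t) * complex_of_real (max 0 (1 * f x)) - iexp (x * t) * complex_of_real (max 0 (- 1 * f x)))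
      = (\<lambda>x. iexp (t * x) * complex_of_real (f x))"
    proof
      fix x
      have "complex_of_real (max 0 (1 * f x)) - complex_of_real (max 0 (- 1 * f x)) = of_real (f x)"
        by (auto simp: max_def)
      then show "iexp (x * t) * complex_of_real (max 0 (1 * f x)) - iexp (x * t) * complex_of_real (max 0 (- 1 * f x))
        = iexp (t * x) * complex_of_real (f x)"
        by (simp only: right_diff_distrib[symmetric] mult.commute[of x t])
    qed
    ultimately show "(CLINT x|P 1. iexp (t * x)) = (CLINT x|P (- 1). iexp (t * x))"
      using 0[of t] unfolding I by (simp only: right_minus_eq)
  qed
  then have "AE x in lborel. ennreal (max 0 (1 * f x)) = ennreal (max 0 (- 1 * f x))"
    unfolding P_def by (rule sigma_finite_measure.density_unique[OF sigma_finite_lborel, rotated 2]) measurable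
  then show ?thesis
    by eventually_elim (auto simp: max_def split: if_splits)
qed

text \<open>The transform of the conjugate of \<open>h\<close> at t is the conjugate of that of
  \<open>h\<close> at -t. Hence every combination of the two has vanishing transform, in particular
  the real and the imaginary part.\<close>

lemma AE_0_of_fourier_0:
  assumes h: "integrable lborel h" and 0: "\<And>t. fourier h t = 0"
  shows "AE x in lborel. h x = 0"
proof -
  have [measurable]: "h \<in> borel_measurable borel" using h by auto
  have hc: "integrable lborel (\<lambda>x. cnj (h x))" using h by simp
  have 1: "(CLBINT x. iexp (x * t) * h x) = 0" for t
    using 0[of t] fourier_lborel[of h t] by simp
  have 2: "(CLBINT x. iexp (x * t) * cnj (h x)) = 0" for t
  proof -
    have "(\<lambda>x. iexp (x * t) * cnj (h x)) = (\<lambda>x. cnj (iexp (x * (- t)) * h x))"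
      by (auto simp: fun_eq_iff exp_cnj)
    then have "(CLBINT x. iexp (x * t) * cnj (h x)) = cnj (CLBINT x. iexp (x * (- t)) * h x)"
      by (simp only: Bochner_Integration.integral_cnj)
    then show ?thesis by (simp only: 1 complex_cnj_zero)
  qed
  have lin: "(CLBINT x. iexp (x * t) * (a * h x + b * cnj (h x))) = 0" for a b t
  proof -
    have "(\<lambda>x. iexp (x * t) * (a * h x + b * cnj (h x))) =
      (\<lambda>x. a * (iexp (x * t) * h x) + b * (iexp (x * t) * cnj (h x)))"
      by (simp add: algebra_simps)
    then show ?thesis
      by (simp only: Bochner_Integration.integral_add[OF integrable_mult_right[OF integrable_iexp_mult[OF h]]
        integrable_mult_right[OF integrable_iexp_mult[OF hc]]] integral_mult_right_zero 1 2) simp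
  qed
  have "AE x in lborel. Re (h x) = 0"
  proof (rule AE_0_of_real_fourier_0)
    fix t
    have "(\<lambda>x. iexp (t * x) * of_real (Re (h x))) = (\<lambda>x. iexp (x * t) * ((1/2) * h x + (1/2) * cnj (h x)))"
      by (auto simp: fun_eq_iff complex_eq_iff mult.commute)
    then show "(CLBINT x. iexp (t * x) * of_real (Re (h x))) = 0" by (simp only: lin)
  qed (use h in simp)
  moreover have "AE x in lborel. Im (h x) = 0"
  proof (rule AE_0_of_real_fourier_0)
    fix t
    have "(\<lambda>x. iexp (t * x) * of_real (Im (h x))) = (\<lambda>x. iexp (x * t) * ((- \<i>/2) * h x + (\<i>/2) * cnj (h x)))"
      by (auto simp: fun_eq_iff complex_eq_iff mult.commute)
    then show "(CLBINT x. iexp (t * x) * of_real (Im (h x))) = 0" by (simp only: lin)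
  qed (use h in simp)
  ultimately show ?thesis by eventually_elim (simp add: complex_eq_iff)
qed

text \<open>Membership in \<open>Dom\<close> only asserts that some representative exists; this
  identifies it with an explicit one. The Gaussian factor makes the difference integrable and,
  having no zeros, is cancelled at the end.\<close>

lemma is_function_unique:
  assumes 1: "is_function T h1" and 2: "is_function T h2"
  shows "AE x in lborel. h1 x = h2 x"
proof -
  have [measurable]: "h1 \<in> borel_measurable borel" "h2 \<in> borel_measurable borel"
    using assms by (auto simp: is_function_def)
  define g where "g = (\<lambda>s x. iexp (s * x) * complex_of_real (exp (- x\<^sup>2 / 2)))"
  have S: "g s \<in> schwartz" for s unfolding g_def by (rule schwartz_gaussian)
  have [measurable]: "g s \<in> borel_measurable borel" for s by (rule schwartz_borel[OF S])
  have i: "integrable lborel (\<lambda>x. h1 x * g s x)" "integrable lborel (\<lambda>x. h2 x * g s x)" for s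
    using 1 2 S by (auto simp: is_function_def integrable_lebesgue_lborel[symmetric])
  have e: "(CLBINT x. h1 x * g s x) = (CLBINT x. h2 x * g s x)" for s
  proof -
    have "dist_of h1 (g s) = dist_of h2 (g s)" using 1 2 by (auto simp: is_function_def)
    then show ?thesis
      unfolding dist_of_def using S by (simp add: integral_lebesgue_lborel)
  qed
  have "AE x in lborel. h1 x * g 0 x - h2 x * g 0 x = 0"
  proof (rule AE_0_of_fourier_0)
    show "integrable lborel (\<lambda>x. h1 x * g 0 x - h2 x * g 0 x)"
      by (intro Bochner_Integration.integrable_diff i)
    fix t
    have "(\<lambda>x. iexp (x * t) * (h1 x * g 0 x - h2 x * g 0 x)) = (\<lambda>x. h1 x * g t x - h2 x * g t x)"
      by (auto simp: fun_eq_iff g_def algebra_simps)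
    then show "fourier (\<lambda>x. h1 x * g 0 x - h2 x * g 0 x) t = 0"
      by (subst fourier_lborel) (auto simp: Bochner_Integration.integral_diff[OF i] e)
  qed
  then show ?thesis
    by eventually_elim (simp add: g_def)
qed

section \<open>Transforms of memory kernels\<close>

lemma integrable_sqrt_weight:
  "integrable lborel (\<lambda>\<omega>. (1 + 1 / sqrt \<bar>\<omega>\<bar>) / (1 + \<omega>\<^sup>2))"
proof -
  \<comment> \<open>The singularity at 0 on the positive side; its mirror image serves the negative
    side. Elsewhere 1 / sqrt |x| is at most 1, which twice the function 1 / (1 + x^2)
    accommodates.\<close>
  define s where "s = (\<lambda>x::real. indicator {0<..1} x *\<^sub>R x powr (- 1 / 2))"
  have [measurable]: "s \<in> borel_measurable borel" unfolding s_def by measurable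
  have "(\<lambda>x. x powr (- 1 / 2 :: real)) absolutely_integrable_on {0<..1}"
    by (intro nonnegative_absolutely_integrable_1 integrable_on_powr_from_0') auto
  then have "integrable lebesgue s" by (simp add: set_integrable_def s_def)
  then have s: "integrable lborel s" by (simp add: integrable_lebesgue_lborel)
  have s': "integrable lborel (\<lambda>x. s (0 + (-1) * x))"
    by (rule lborel_integrable_real_affine[OF s]) simp
  show ?thesis
  proof (rule Bochner_Integration.integrable_bound)
    show "integrable lborel (\<lambda>x. 2 * (1 / (1 + x\<^sup>2)) + (s x + s (0 + (-1) * x)))"
      by (intro Bochner_Integration.integrable_add integrable_mult_right integrable_Cauchy s s')
    show "AE x in lborel. norm ((1 + 1 / sqrt \<bar>x\<bar>) / (1 + x\<^sup>2)) \<le>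
        norm (2 * (1 / (1 + x\<^sup>2)) + (s x + s (0 + (-1) * x)))"
    proof (intro AE_I2)
      fix x :: real
      have p: "1 + x\<^sup>2 \<ge> 1" by simp
      have s0: "s y \<ge> 0" for y by (simp add: s_def)
      have "1 / sqrt \<bar>x\<bar> \<le> 1 + (s x + s (- x))"
      proof (cases "\<bar>x\<bar> \<le> 1 \<and> x \<noteq> 0")
        case True
        then have "1 / sqrt \<bar>x\<bar> = s x + s (- x)"
          by (cases "x > 0") (auto simp: s_def powr_minus powr_half_sqrt inverse_eq_divide)
        then show ?thesis by simp
      next
        \<comment> \<open>This includes x = 0, where the quotient is 0 by convention.\<close>
        case False
        then have "1 / sqrt \<bar>x\<bar> \<le> 1" by (auto simp: divide_le_eq_1)
        then show ?thesis using s0[of x] s0[of "- x"] by linarith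
      qed
      then have "(1 + 1 / sqrt \<bar>x\<bar>) / (1 + x\<^sup>2) \<le> (2 + (s x + s (- x))) / (1 + x\<^sup>2)"
        using p by (intro divide_right_mono) auto
      also have "\<dots> = 2 / (1 + x\<^sup>2) + (s x + s (- x)) / (1 + x\<^sup>2)"
        by (simp add: add_divide_distrib)
      also have "(s x + s (- x)) / (1 + x\<^sup>2) \<le> (s x + s (- x)) / 1"
        using s0[of x] s0[of "- x"] p by (intro divide_left_mono) (auto intro: add_pos_nonneg)
      finally show "norm ((1 + 1 / sqrt \<bar>x\<bar>) / (1 + x\<^sup>2)) \<le>
          norm (2 * (1 / (1 + x\<^sup>2)) + (s x + s (0 + (-1) * x)))"
        using s0[of x] s0[of "- x"] p by simp
    qed
  qed measurable
qed

lemma integrable_conv: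
  assumes f: "integrable lborel f" and g: "integrable lborel g"
  shows "integrable lborel (conv f g)"
proof -
  have [measurable]: "f \<in> borel_measurable borel" "g \<in> borel_measurable borel" using f g by auto
  have gs: "integrable lborel (\<lambda>t. g (- u + 1 * t))" for u
    by (rule lborel_integrable_real_affine[OF g]) simp
  have gn: "(LBINT t. cmod (g (t - u))) = (LBINT t. cmod (g t))" for u
    using lborel_integral_real_affine[of 1 "\<lambda>t. cmod (g t)" "- u"] by simp
  have "integrable (lborel \<Otimes>\<^sub>M lborel) (\<lambda>(u, t). f u * g (t - u))"
  proof (rule lborel_pair.Fubini_integrable)
    have "integrable lborel (\<lambda>u. cmod (f u) * (LBINT t. cmod (g t)))"
      by (intro integrable_mult_left integrable_norm f)
    then show "integrable lborel (\<lambda>u. LBINT t. norm (case (u, t) of (u, t) \<Rightarrow> f u * g (t - u)))"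
      by (simp add: norm_mult gn)
    show "AE u in lborel. integrable lborel (\<lambda>t. case (u, t) of (u, t) \<Rightarrow> f u * g (t - u))"
      using gs by (auto intro!: AE_I2)
  qed measurable
  then have "integrable lborel (\<lambda>t. CLBINT u. f u * g (t - u))"
    by (rule lborel_pair.integrable_snd)
  moreover have "conv f g = (\<lambda>t. CLBINT u. f u * g (t - u))"
    unfolding conv_def by (intro ext integral_lebesgue_lborel) measurable
  ultimately show ?thesis by simp
qed

text \<open>The kernel on the half line, extended by \<open>0\<close> to negative arguments.\<close>

locale memory_kernel =
  fixes k :: "real \<Rightarrow> real" and A C :: real
  assumes k_borel [measurable]: "k \<in> borel_measurable borel"
    and k_nonneg: "\<And>t. k t \<ge> 0"
    and k_neg: "\<And>t. t < 0 \<Longrightarrow> k t = 0"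
    and k_int: "\<And>T. integrable lborel (\<lambda>t. indicator {..T} t * k t)"
    and A_pos: "A > 0"
    and k_antimono: "\<And>s t. A \<le> s \<Longrightarrow> s \<le> t \<Longrightarrow> k t \<le> k s"
    and k_decay: "\<And>t. A \<le> t \<Longrightarrow> k t \<le> C / t"
begin

section \<open>Oscillation bounds for truncated kernels\<close>

definition trunc :: "real \<Rightarrow> real \<Rightarrow> complex" where
  "trunc T t = of_real (indicator {..T} t * k t)"

text \<open>A limit along the integers is measurable as the limit of a sequence. At frequency 0 the
  truncations need not converge and the value may be unspecified; {0} is a null set.\<close>

definition khat :: "real \<Rightarrow> complex" where
  "khat \<omega> = lim (\<lambda>n. fourier (trunc (real n)) \<omega>)"

lemma C_nonneg: "C \<ge> 0"
  using k_decay[of A] k_nonneg[of A] A_pos order_trans[of 0 "k A" "C / A"]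
  by (simp add: zero_le_divide_iff)

lemma trunc_integrable: "integrable lborel (trunc T)"
  unfolding trunc_def[abs_def] by (intro integrable_of_real k_int)

lemma trunc_borel [measurable]: "trunc T \<in> borel_measurable borel"
  using trunc_integrable by auto

text \<open>Second mean value theorem: beyond \<open>A\<close> the kernel is monotone, so only its
  values at the two endpoints come out, multiplied by integrals of \<open>f\<close> alone. The
  cancellation in \<open>f\<close> thus replaces integrability of \<open>k\<close> at
  infinity.\<close>

lemma k_segment_bound:
  assumes ST: "A \<le> S" "S \<le> T" and f: "continuous_on UNIV f"
    and B: "\<And>p q. p \<le> q \<Longrightarrow> \<bar>integral {p..q} f\<bar> \<le> B"
  shows "\<bar>LBINT t. indicator {S<..T} t * k t * f t\<bar> \<le> 2 * B * k S"
proof -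
  have [measurable]: "f \<in> borel_measurable borel" using f by (rule borel_measurable_continuous_onI)
  obtain c where c: "c \<in> {S..T}" and
    I: "integral {S..T} (\<lambda>x. - k x * f x) = - k S * integral {S..c} f + - k T * integral {c..T} f"
  \<comment> \<open>The sign is reversed because the theorem expects an increasing weight.\<close>
  proof (rule second_mean_value_theorem[of f S T "\<lambda>x. - k x"])
    show "f integrable_on {S..T}"
      using f by (intro integrable_continuous_real) (auto intro: continuous_on_subset)
    show "- k x \<le> - k y" if "S \<le> x" "x \<le> y" "y \<le> T" for x y
      using k_antimono[of x y] that ST by auto
  qed (use ST in auto)
  have "compact (f ` {S..T})"
    using f by (intro compact_continuous_image) (auto intro: continuous_on_subset)
  then have "bounded (f ` {S..T})" by (rule compact_imp_bounded)
  then obtain D where "\<forall>x\<in>{S..T}. norm (f x) \<le> D"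
    unfolding bounded_iff by auto
  then have D: "\<bar>f x\<bar> \<le> D" if "x \<in> {S..T}" for x using that by simp
  have D0: "D \<ge> 0" using D[of S] ST by auto
  have int: "set_integrable lborel {S..T} (\<lambda>x. - k x * f x)"
    unfolding set_integrable_def
  proof (rule Bochner_Integration.integrable_bound)
    show "integrable lborel (\<lambda>t. D * (indicator {..T} t * k t))"
      by (intro integrable_mult_right k_int)
    show "AE x in lborel. norm (indicat_real {S..T} x *\<^sub>R (- k x * f x)) \<le> norm (D * (indicator {..T} x * k x))"
      using D D0 k_nonneg by (intro AE_I2) (auto simp: indicator_def abs_mult mult.commute[of "k _"] intro!: mult_right_mono)
  qed measurable
  have "(LBINT t. indicator {S<..T} t * k t * f t) = - (LBINT t : {S..T}. - k t * f t)"
    unfolding set_lebesgue_integral_def Bochner_Integration.integral_minus[symmetric]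
  proof (rule integral_cong_AE)
    show "AE x in lborel. indicat_real {S<..T} x * k x * f x = - (indicat_real {S..T} x *\<^sub>R (- k x * f x))"
      using AE_lborel_singleton[of S] by eventually_elim (auto simp: indicator_def)
  qed measurable
  also have "\<dots> = - integral {S..T} (\<lambda>x. - k x * f x)"
    by (simp only: set_borel_integral_eq_integral(2)[OF int])
  also have "\<bar>\<dots>\<bar> \<le> k S * B + k T * B"
  proof -
    have 1: "\<bar>k S * integral {S..c} f\<bar> \<le> k S * B" "\<bar>k T * integral {c..T} f\<bar> \<le> k T * B"
      using c k_nonneg by (auto simp: abs_mult intro!: mult_left_mono B)
    then show ?thesis unfolding I by linarith
  qed
  also have "\<dots> \<le> 2 * B * k S"
  proof -
    have "B \<ge> 0" using B[of S S] by simp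
    then have "k T * B \<le> k S * B" using k_antimono[of S T] ST by (intro mult_right_mono) auto
    then show ?thesis by (simp add: mult.commute[of B])
  qed
  finally show ?thesis .
qed

text \<open>Integrals of cos and sin over any interval are at most 2 / |omega|. The segment bound
  doubles this, and adding real and imaginary parts gives the constant 8.\<close>

lemma fourier_trunc_diff:
  assumes ST: "A \<le> S" "S \<le> T" and \<omega>: "\<omega> \<noteq> 0"
  shows "cmod (fourier (trunc T) \<omega> - fourier (trunc S) \<omega>) \<le> 8 * k S / \<bar>\<omega>\<bar>"
proof -
  define F where "F t = iexp (t * \<omega>) * of_real (indicator {S<..T} t * k t)" for t
  have "fourier (trunc T) \<omega> - fourier (trunc S) \<omega> =
     (CLBINT t. iexp (t * \<omega>) * trunc T t - iexp (t * \<omega>) * trunc S t)"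
    unfolding fourier_lborel[OF trunc_borel]
    by (rule Bochner_Integration.integral_diff[symmetric]) (intro integrable_iexp_mult trunc_integrable)+
  moreover have "(\<lambda>t. iexp (t * \<omega>) * trunc T t - iexp (t * \<omega>) * trunc S t) = F"
  proof
    fix t
    have "trunc T t - trunc S t = of_real (indicator {S<..T} t * k t)"
      using ST by (auto simp: trunc_def indicator_def)
    then show "iexp (t * \<omega>) * trunc T t - iexp (t * \<omega>) * trunc S t = F t"
      unfolding F_def by (simp only: right_diff_distrib[symmetric])
  qed
  ultimately have E: "fourier (trunc T) \<omega> - fourier (trunc S) \<omega> = (CLBINT t. F t)"
    by simp
  have F: "integrable lborel F"
  proof -
    have "integrable lborel (\<lambda>t. iexp (t * \<omega>) * trunc T t - iexp (t * \<omega>) * trunc S t)"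
      by (intro Bochner_Integration.integrable_diff integrable_iexp_mult trunc_integrable)
    then show ?thesis
      unfolding \<open>(\<lambda>t. iexp (t * \<omega>) * trunc T t - iexp (t * \<omega>) * trunc S t) = F\<close> .
  qed
  have c: "\<bar>integral {p..q} (\<lambda>t. cos (t * \<omega>))\<bar> \<le> 2 / \<bar>\<omega>\<bar>" if "p \<le> q" for p q
  proof -
    have "((\<lambda>t. cos (t * \<omega>)) has_integral (sin (q * \<omega>) / \<omega> - sin (p * \<omega>) / \<omega>)) {p..q}"
      using that \<omega> by (intro fundamental_theorem_of_calculus)
        (auto intro!: derivative_eq_intros simp: has_real_derivative_iff_has_vector_derivative[symmetric])
    then have "\<bar>integral {p..q} (\<lambda>t. cos (t * \<omega>))\<bar> = \<bar>sin (q * \<omega>) - sin (p * \<omega>)\<bar> / \<bar>\<omega>\<bar>"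
      by (simp add: integral_unique diff_divide_distrib[symmetric])
    also have "\<dots> \<le> 2 / \<bar>\<omega>\<bar>"
      using abs_sin_le_one[of "q * \<omega>"] abs_sin_le_one[of "p * \<omega>"] by (intro divide_right_mono) linarith+
    finally show ?thesis .
  qed
  have s: "\<bar>integral {p..q} (\<lambda>t. sin (t * \<omega>))\<bar> \<le> 2 / \<bar>\<omega>\<bar>" if "p \<le> q" for p q
  proof -
    have "((\<lambda>t. sin (t * \<omega>)) has_integral ((- cos (q * \<omega>) / \<omega>) - (- cos (p * \<omega>) / \<omega>))) {p..q}"
      using that \<omega> by (intro fundamental_theorem_of_calculus)
        (auto intro!: derivative_eq_intros simp: has_real_derivative_iff_has_vector_derivative[symmetric])
    then have "\<bar>integral {p..q} (\<lambda>t. sin (t * \<omega>))\<bar> = \<bar>cos (p * \<omega>) - cos (q * \<omega>)\<bar> / \<bar>\<omega>\<bar>"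
      by (simp add: integral_unique diff_divide_distrib[symmetric])
    also have "\<dots> \<le> 2 / \<bar>\<omega>\<bar>"
      using abs_cos_le_one[of "q * \<omega>"] abs_cos_le_one[of "p * \<omega>"] by (intro divide_right_mono) linarith+
    finally show ?thesis .
  qed
  have "Re (CLBINT t. F t) = (LBINT t. indicator {S<..T} t * k t * cos (t * \<omega>))"
    unfolding integral_Re[OF F, symmetric] by (simp add: F_def Re_exp mult.commute)
  then have 1: "\<bar>Re (CLBINT t. F t)\<bar> \<le> 2 * (2 / \<bar>\<omega>\<bar>) * k S"
    by (simp only:) (rule k_segment_bound[OF ST _ c], auto intro!: continuous_intros)
  have "Im (CLBINT t. F t) = (LBINT t. indicator {S<..T} t * k t * sin (t * \<omega>))"
    unfolding integral_Im[OF F, symmetric] by (simp add: F_def Im_exp mult.commute)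
  then have 2: "\<bar>Im (CLBINT t. F t)\<bar> \<le> 2 * (2 / \<bar>\<omega>\<bar>) * k S"
    by (simp only:) (rule k_segment_bound[OF ST _ s], auto intro!: continuous_intros)
  have "cmod (CLBINT t. F t) \<le> \<bar>Re (CLBINT t. F t)\<bar> + \<bar>Im (CLBINT t. F t)\<bar>"
    by (rule cmod_le)
  also have "\<dots> \<le> 2 * (2 / \<bar>\<omega>\<bar>) * k S + 2 * (2 / \<bar>\<omega>\<bar>) * k S"
    using 1 2 by (rule add_mono)
  also have "\<dots> = 8 * k S / \<bar>\<omega>\<bar>" by simp
  finally show ?thesis unfolding E .
qed

lemma fourier_trunc_diff_decay:
  assumes "A \<le> S" "S \<le> T" "\<omega> \<noteq> 0"
  shows "cmod (fourier (trunc T) \<omega> - fourier (trunc S) \<omega>) \<le> 8 * C / (S * \<bar>\<omega>\<bar>)"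
proof -
  have "8 * k S / \<bar>\<omega>\<bar> \<le> 8 * (C / S) / \<bar>\<omega>\<bar>"
    using k_decay[OF assms(1)] by (intro divide_right_mono mult_left_mono) auto
  then show ?thesis using fourier_trunc_diff[OF assms] by simp
qed

lemma fourier_trunc_bound:
  obtains M where "M \<ge> 0" "\<And>T \<omega>. \<omega> \<noteq> 0 \<Longrightarrow> cmod (fourier (trunc T) \<omega>) \<le> M * (1 + 1 / sqrt \<bar>\<omega>\<bar>)"
proof
  define I where "I = (LBINT t. indicator {..A} t * k t)"
  \<comment> \<open>The summands stand for the mass of \<open>k\<close> up to \<open>A\<close>, the
    growth of the head past \<open>A\<close>, where \<open>k\<close> is at most \<open>k A\<close>,
    and the oscillating tail.\<close>
  define M where "M = I + k A + 8 * C"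
  have I: "I \<ge> 0" unfolding I_def by (intro integral_nonneg_AE AE_I2) (simp add: k_nonneg)
  show "M \<ge> 0" using I k_nonneg[of A] C_nonneg by (simp add: M_def)
  fix T \<omega> :: real assume \<omega>: "\<omega> \<noteq> 0"
  \<comment> \<open>Splitting at \<open>A + s\<close> balances the mass of the head against the oscillation of the tail.\<close>
  define s where "s = 1 / sqrt \<bar>\<omega>\<bar>"
  have s: "s > 0" using \<omega> by (simp add: s_def)
  have head: "cmod (fourier (trunc S) \<omega>) \<le> I + k A * s" if S: "S \<le> A + s" for S
  proof -
    have "cmod (fourier (trunc S) \<omega>) \<le> (LBINT t. cmod (trunc S t))"
      by (rule fourier_bound[OF trunc_integrable])
    also have "\<dots> \<le> (LBINT t. indicator {..A} t * k t + k A * indicator {A..A + s} t)"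
    proof (rule Bochner_Integration.integral_mono)
      show "cmod (trunc S t) \<le> indicator {..A} t * k t + k A * indicator {A..A + s} t" for t
        using S k_nonneg[of t] k_nonneg[of A] k_antimono[of A t] by (auto simp: trunc_def indicator_def)
      show "integrable lborel (\<lambda>t. indicat_real {..A} t * k t + k A * indicat_real {A..A + s} t)"
        by (intro Bochner_Integration.integrable_add k_int integrable_mult_right integrable_real_indicator)
           (use s in auto)
    qed (intro integrable_norm trunc_integrable)
    also have "\<dots> = I + k A * s"
      unfolding I_def using s by (subst Bochner_Integration.integral_add[OF k_int])
        (auto intro!: integrable_mult_right integrable_real_indicator)
    finally show ?thesis .
  qed
  have "cmod (fourier (trunc T) \<omega>) \<le> I + k A * s + 8 * C * s"
  proof (cases "T \<le> A + s")
    case True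
    have "8 * C * s \<ge> 0" using s C_nonneg by simp
    then show ?thesis using head[OF True] by linarith
  next
    case False
    have "8 * C / ((A + s) * \<bar>\<omega>\<bar>) \<le> 8 * C / (s * \<bar>\<omega>\<bar>)"
      using s \<omega> A_pos C_nonneg by (intro divide_left_mono mult_right_mono mult_pos_pos) auto
    also have "s * \<bar>\<omega>\<bar> = 1 / s"
      using \<omega> by (simp add: s_def field_simps flip: real_sqrt_mult)
    finally have "8 * C / ((A + s) * \<bar>\<omega>\<bar>) \<le> 8 * C * s" by simp
    moreover have "cmod (fourier (trunc T) \<omega> - fourier (trunc (A + s)) \<omega>) \<le> 8 * C / ((A + s) * \<bar>\<omega>\<bar>)"
      using False s \<omega> by (intro fourier_trunc_diff_decay) auto
    moreover have "cmod (fourier (trunc T) \<omega>) \<le>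
        cmod (fourier (trunc (A + s)) \<omega>) + cmod (fourier (trunc T) \<omega> - fourier (trunc (A + s)) \<omega>)"
      using norm_triangle_ineq[of "fourier (trunc (A + s)) \<omega>" "fourier (trunc T) \<omega> - fourier (trunc (A + s)) \<omega>"] by simp
    ultimately show ?thesis using head[of "A + s"] by simp
  qed
  also have "\<dots> \<le> M * (1 + s)"
    using I k_nonneg[of A] C_nonneg s by (simp add: M_def algebra_simps add_nonneg_nonneg)
  finally show "cmod (fourier (trunc T) \<omega>) \<le> M * (1 + 1 / sqrt \<bar>\<omega>\<bar>)" by (simp add: s_def)
qed

lemma fourier_trunc_LIMSEQ:
  assumes \<omega>: "\<omega> \<noteq> 0"
  shows "(\<lambda>n. fourier (trunc (real n)) \<omega>) \<longlonglongrightarrow> khat \<omega>"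
proof -
  have lim: "(\<lambda>n. 8 * C / (real n * \<bar>\<omega>\<bar>)) \<longlonglongrightarrow> 0"
  proof -
    have "(\<lambda>n. (8 * C / \<bar>\<omega>\<bar>) * inverse (real n)) \<longlonglongrightarrow> (8 * C / \<bar>\<omega>\<bar>) * 0"
      by (intro tendsto_mult tendsto_const lim_inverse_n)
    then show ?thesis by (simp add: field_simps)
  qed
  have "Cauchy (\<lambda>n. fourier (trunc (real n)) \<omega>)"
  proof (rule metric_CauchyI)
    fix e :: real assume "e > 0"
    from order_tendstoD(2)[OF lim this] obtain n0 where n0: "\<And>n. n \<ge> n0 \<Longrightarrow> 8 * C / (real n * \<bar>\<omega>\<bar>) < e"
      by (auto simp: eventually_sequentially)
    define n1 where "n1 = max n0 (nat \<lceil>A\<rceil>)"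
    have *: "dist (fourier (trunc (real m)) \<omega>) (fourier (trunc (real n)) \<omega>) < e" if "n1 \<le> n" "n \<le> m" for m n
      using fourier_trunc_diff_decay[of "real n" "real m" \<omega>] n0[of n] that \<omega>
      by (auto simp: n1_def dist_norm nat_ceiling_le_eq)
    show "\<exists>M. \<forall>m\<ge>M. \<forall>n\<ge>M. dist (fourier (trunc (real m)) \<omega>) (fourier (trunc (real n)) \<omega>) < e"
    proof (intro exI allI impI)
      fix m n assume "n1 \<le> m" "n1 \<le> n"
      then show "dist (fourier (trunc (real m)) \<omega>) (fourier (trunc (real n)) \<omega>) < e"
        using *[of n m] *[of m n] by (cases "n \<le> m") (auto simp: dist_commute)
    qed
  qed
  then show ?thesis
    unfolding khat_def by (simp add: Cauchy_convergent_iff convergent_LIMSEQ_iff)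
qed

text \<open>\<open>K_cos\<close> and \<open>K_sin\<close> are limits over real T, while
  \<open>khat\<close> is a limit along the integers. Letting the larger truncation point tend to
  infinity in the difference bound gives an error of order 1 / T for every real T.\<close>

lemma fourier_trunc_tendsto:
  assumes \<omega>: "\<omega> \<noteq> 0"
  shows "((\<lambda>T. fourier (trunc T) \<omega>) \<longlongrightarrow> khat \<omega>) at_top"
proof -
  have bound: "cmod (khat \<omega> - fourier (trunc T) \<omega>) \<le> 8 * C / (T * \<bar>\<omega>\<bar>)" if "T \<ge> A" for T
  proof (rule tendsto_upperbound)
    show "(\<lambda>n. cmod (fourier (trunc (real n)) \<omega> - fourier (trunc T) \<omega>)) \<longlonglongrightarrow> cmod (khat \<omega> - fourier (trunc T) \<omega>)"
      by (intro tendsto_intros fourier_trunc_LIMSEQ \<omega>)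
    show "\<forall>\<^sub>F n in sequentially. cmod (fourier (trunc (real n)) \<omega> - fourier (trunc T) \<omega>) \<le> 8 * C / (T * \<bar>\<omega>\<bar>)"
      using eventually_ge_at_top[of "nat \<lceil>T\<rceil>"]
      by eventually_elim (use that \<omega> in \<open>auto intro!: fourier_trunc_diff_decay simp: nat_ceiling_le_eq\<close>)
  qed simp
  have "((\<lambda>T. (8 * C / \<bar>\<omega>\<bar>) * inverse T) \<longlongrightarrow> (8 * C / \<bar>\<omega>\<bar>) * 0) at_top"
    by (intro tendsto_mult tendsto_const tendsto_inverse_0_at_top filterlim_ident)
  then have lim: "((\<lambda>T. 8 * C / (T * \<bar>\<omega>\<bar>)) \<longlongrightarrow> 0) at_top" by (simp add: field_simps)
  have "((\<lambda>T. fourier (trunc T) \<omega> - khat \<omega>) \<longlongrightarrow> 0) at_top"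
    by (rule Lim_null_comparison[OF _ lim])
       (use eventually_ge_at_top[of A] in \<open>eventually_elim, simp add: bound norm_minus_commute\<close>)
  then show ?thesis by (simp add: Lim_null[symmetric])
qed

lemma khat_borel [measurable]: "khat \<in> borel_measurable borel"
  unfolding khat_def[abs_def] by measurable

lemma fourier_trunc_minus: "fourier (trunc T) (- \<omega>) = cnj (fourier (trunc T) \<omega>)"
proof -
  have "(\<lambda>t. iexp (t * (- \<omega>)) * trunc T t) = (\<lambda>t. cnj (iexp (t * \<omega>) * trunc T t))"
    by (auto simp: exp_cnj trunc_def)
  then show ?thesis
    by (simp only: fourier_lborel[OF trunc_borel] Bochner_Integration.integral_cnj)
qed

lemma khat_minus: "\<omega> \<noteq> 0 \<Longrightarrow> khat (- \<omega>) = cnj (khat \<omega>)"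
  using fourier_trunc_LIMSEQ[of "- \<omega>"] tendsto_cnj[OF fourier_trunc_LIMSEQ[of \<omega>]]
  by (auto simp: fourier_trunc_minus intro: LIMSEQ_unique)

text \<open>The weight 1 + |omega|^(-1/2) is only locally integrable; the decay of \<open>g\<close>
  supplies what is missing at infinity.\<close>

lemma integrable_khat_mult:
  assumes [measurable]: "g \<in> borel_measurable borel" and g: "\<And>\<omega>. cmod (g \<omega>) \<le> D / (1 + \<omega>\<^sup>2)"
  shows "integrable lborel (\<lambda>\<omega>. khat \<omega> * g \<omega>)"
    and "(\<lambda>n. CLBINT \<omega>. fourier (trunc (real n)) \<omega> * g \<omega>) \<longlonglongrightarrow> (CLBINT \<omega>. khat \<omega> * g \<omega>)"
proof -
  obtain M where M: "M \<ge> 0" "\<And>T \<omega>. \<omega> \<noteq> 0 \<Longrightarrow> cmod (fourier (trunc T) \<omega>) \<le> M * (1 + 1 / sqrt \<bar>\<omega>\<bar>)"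
    using fourier_trunc_bound by blast
  have w: "integrable lborel (\<lambda>\<omega>. (M * D) * ((1 + 1 / sqrt \<bar>\<omega>\<bar>) / (1 + \<omega>\<^sup>2)))"
    by (intro integrable_mult_right integrable_sqrt_weight)
  have 0: "AE \<omega> in lborel. \<omega> \<noteq> (0::real)" by (rule AE_lborel_singleton)
  have bd: "AE \<omega> in lborel. norm (fourier (trunc (real n)) \<omega> * g \<omega>) \<le> (M * D) * ((1 + 1 / sqrt \<bar>\<omega>\<bar>) / (1 + \<omega>\<^sup>2))" for n
    using 0
  proof eventually_elim
    case (elim \<omega>)
    have "norm (fourier (trunc (real n)) \<omega> * g \<omega>) \<le> (M * (1 + 1 / sqrt \<bar>\<omega>\<bar>)) * (D / (1 + \<omega>\<^sup>2))"
      unfolding norm_mult using M elim by (intro mult_mono g) auto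
    then show ?case by (simp only: times_divide_times_eq times_divide_eq_right mult_ac)
  qed
  have l: "AE \<omega> in lborel. (\<lambda>n. fourier (trunc (real n)) \<omega> * g \<omega>) \<longlonglongrightarrow> khat \<omega> * g \<omega>"
    using 0 by eventually_elim (intro tendsto_mult tendsto_const fourier_trunc_LIMSEQ)
  show "integrable lborel (\<lambda>\<omega>. khat \<omega> * g \<omega>)"
    by (rule integrable_dominated_convergence[OF _ _ w l bd]) measurable
  show "(\<lambda>n. CLBINT \<omega>. fourier (trunc (real n)) \<omega> * g \<omega>) \<longlonglongrightarrow> (CLBINT \<omega>. khat \<omega> * g \<omega>)"
    by (rule integral_dominated_convergence[OF _ _ w l bd]) measurable
qed

end

section \<open>The convolution with the kernel and the noise covariance\<close>

lemma schwartz_mult_bound: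
  assumes "\<phi> \<in> schwartz" "\<psi> \<in> schwartz"
  obtains D where "\<And>x. cmod (\<phi> x * \<psi> x) \<le> D / (1 + x\<^sup>2)" "\<And>x. cmod (\<phi> x * cnj (\<psi> x)) \<le> D / (1 + x\<^sup>2)"
proof -
  obtain C where C: "C \<ge> 0" "\<And>x. (1 + x\<^sup>2) ^ 1 * cmod (\<phi> x) \<le> C" using schwartz_decay[OF assms(1)] by blast
  obtain B where B: "B > 0" "\<And>x. cmod (\<psi> x) \<le> B" using schwartz_bounded[OF assms(2)] by blast
  have *: "cmod (\<phi> x) * cmod (\<psi> x) \<le> C * B / (1 + x\<^sup>2)" for x
  proof -
    have p: "1 + x\<^sup>2 > 0" by (simp add: add_pos_nonneg)
    have "((1 + x\<^sup>2) * cmod (\<phi> x)) * cmod (\<psi> x) \<le> C * B"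
      using C B by (intro mult_mono) auto
    then show ?thesis using p by (simp add: pos_le_divide_eq mult_ac)
  qed
  then show ?thesis using that[of "C * B"] by (simp add: norm_mult)
qed

lemma integrable_of_Cauchy_bound:
  assumes [measurable]: "f \<in> borel_measurable borel" and "\<And>x. cmod (f x) \<le> D / (1 + x\<^sup>2)"
  shows "integrable lborel f"
proof (rule Bochner_Integration.integrable_bound)
  show "integrable lborel (\<lambda>x::real. D * (1 / (1 + x\<^sup>2)))"
    by (intro integrable_mult_right integrable_Cauchy)
  show "AE x in lborel. norm (f x) \<le> norm (D * (1 / (1 + x\<^sup>2)))"
    using assms(2) by (intro AE_I2) (metis abs_ge_self mult_1_right order_trans real_norm_def times_divide_eq_right)
qed measurable

context memory_kernel
begin

definition kc :: "real \<Rightarrow> complex" where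
  "kc t = of_real (k t)"

lemma kc_borel [measurable]: "kc \<in> borel_measurable borel"
  unfolding kc_def[abs_def] by measurable

lemma trunc_LIMSEQ: "(\<lambda>n. trunc (real n) t) \<longlonglongrightarrow> kc t"
proof (rule tendsto_eventually)
  show "\<forall>\<^sub>F n in sequentially. trunc (real n) t = kc t"
    using eventually_ge_at_top[of "nat \<lceil>t\<rceil>"]
    by eventually_elim (auto simp: trunc_def kc_def nat_ceiling_le_eq indicator_def)
qed

text \<open>Near the origin the kernel is integrable, and beyond \<open>A\<close> it is bounded by \<open>k A\<close>.\<close>

lemma kernel_mult_bound:
  assumes g: "integrable lborel g" and B: "\<And>t. cmod (g t) \<le> B"
  defines "w \<equiv> \<lambda>t. B * (indicator {..A} t * k t) + k A * cmod (g t)"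
  shows "integrable lborel w" "cmod (kc t * g t) \<le> w t" "cmod (trunc T t * g t) \<le> w t"
proof -
  show "integrable lborel w"
    unfolding w_def by (intro Bochner_Integration.integrable_add integrable_mult_right k_int integrable_norm g)
  show 1: "cmod (kc t * g t) \<le> w t"
  proof (cases "t \<le> A")
    case True
    have "k t * cmod (g t) \<le> B * k t" using mult_left_mono[OF B k_nonneg] by (simp add: mult.commute)
    then show ?thesis using True k_nonneg[of t] k_nonneg[of A]
      by (simp add: w_def kc_def norm_mult add_increasing2)
  next
    case False
    then have "k t * cmod (g t) \<le> k A * cmod (g t)" using k_antimono[of A t] by (intro mult_right_mono) auto
    then show ?thesis using False k_nonneg[of t] by (simp add: w_def kc_def norm_mult)
  qed
  have "cmod (trunc T t * g t) \<le> cmod (kc t * g t)"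
    using k_nonneg[of t] by (auto simp: trunc_def kc_def norm_mult indicator_def)
  then show "cmod (trunc T t * g t) \<le> w t" using 1 by simp
qed

lemma kernel_mult_integrable:
  assumes g: "integrable lborel g" and B: "\<And>t. cmod (g t) \<le> B"
  shows "integrable lborel (\<lambda>t. kc t * g t)"
    and "(\<lambda>n. CLBINT t. trunc (real n) t * g t) \<longlonglongrightarrow> (CLBINT t. kc t * g t)"
proof -
  have [measurable]: "g \<in> borel_measurable borel" using g by auto
  note w = kernel_mult_bound[OF g B]
  have l: "AE t in lborel. (\<lambda>n. trunc (real n) t * g t) \<longlonglongrightarrow> kc t * g t"
    by (intro AE_I2 tendsto_mult tendsto_const trunc_LIMSEQ)
  have b: "AE t in lborel. cmod (trunc (real n) t * g t) \<le> B * (indicator {..A} t * k t) + k A * cmod (g t)" for n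
    by (intro AE_I2 w)
  show "integrable lborel (\<lambda>t. kc t * g t)"
    by (rule integrable_dominated_convergence[OF _ _ w(1) l b]) measurable
  show "(\<lambda>n. CLBINT t. trunc (real n) t * g t) \<longlonglongrightarrow> (CLBINT t. kc t * g t)"
    by (rule integral_dominated_convergence[OF _ _ w(1) l b]) measurable
qed

lemma conv_kernel_lborel:
  assumes [measurable]: "\<phi> \<in> borel_measurable borel" "f \<in> borel_measurable borel"
  shows "conv f \<phi> t = (CLBINT u. f u * \<phi> (t - u))"
  unfolding conv_def by (rule integral_lebesgue_lborel) measurable

lemma integrable_shift_reflect:
  assumes "integrable lborel (\<phi> :: real \<Rightarrow> complex)"
  shows "integrable lborel (\<lambda>u. \<phi> (t - u))"
  using lborel_integrable_real_affine[OF assms, of "-1" t] by simp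

lemma conv_kernel_LIMSEQ:
  assumes "\<phi> \<in> schwartz"
  shows "(\<lambda>n. conv (trunc (real n)) \<phi> t) \<longlonglongrightarrow> conv kc \<phi> t"
proof -
  have [measurable]: "\<phi> \<in> borel_measurable borel" using assms by (rule schwartz_borel)
  obtain B where B: "\<And>x. cmod (\<phi> x) \<le> B" using schwartz_bounded[OF assms] by blast
  show ?thesis
    unfolding conv_kernel_lborel[OF \<open>\<phi> \<in> borel_measurable borel\<close> trunc_borel]
      conv_kernel_lborel[OF \<open>\<phi> \<in> borel_measurable borel\<close> kc_borel]
    by (rule kernel_mult_integrable(2)[OF integrable_shift_reflect[OF integrable_schwartz[OF assms]] B])
qed

text \<open>Below \<open>A\<close> the mass of \<open>k\<close> meets the supremum of phi, beyond
  \<open>A\<close> the bound \<open>k A\<close> meets the mass of phi. The constant is the same for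
  all truncations, so it can serve as a majorant.\<close>

lemma conv_kernel_bound:
  assumes "\<phi> \<in> schwartz"
  obtains B where "\<And>t. cmod (conv kc \<phi> t) \<le> B" "\<And>T t. cmod (conv (trunc T) \<phi> t) \<le> B"
proof -
  have [measurable]: "\<phi> \<in> borel_measurable borel" using assms by (rule schwartz_borel)
  obtain B where B: "\<And>x. cmod (\<phi> x) \<le> B" using schwartz_bounded[OF assms] by blast
  define D where "D = B * (LBINT t. indicator {..A} t * k t) + k A * (LBINT t. cmod (\<phi> t))"
  have 2: "cmod (conv (trunc T) \<phi> t) \<le> D" for T t
  proof -
    note i = integrable_shift_reflect[OF integrable_schwartz[OF assms], of t]
    note w = kernel_mult_bound[OF i B]
    have "cmod (conv (trunc T) \<phi> t) \<le> (LBINT u. B * (indicator {..A} u * k u) + k A * cmod (\<phi> (t - u)))"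
      unfolding conv_kernel_lborel[OF \<open>\<phi> \<in> borel_measurable borel\<close> trunc_borel]
    proof (rule order_trans[OF integral_norm_bound Bochner_Integration.integral_mono])
      show "integrable lborel (\<lambda>u. norm (trunc T u * \<phi> (t - u)))"
        by (rule Bochner_Integration.integrable_bound[OF w(1)])
           (auto intro!: AE_I2 order_trans[OF w(3)] simp del: norm_mult)
    qed (rule w)+
    also have "\<dots> = B * (LBINT t. indicator {..A} t * k t) + k A * (LBINT u. cmod (\<phi> (t - u)))"
      by (simp only: Bochner_Integration.integral_add[OF integrable_mult_right[OF k_int]
            integrable_mult_right[OF integrable_norm[OF i]]] integral_mult_right_zero)
    also have "(LBINT u. cmod (\<phi> (t - u))) = (LBINT t. cmod (\<phi> t))"
      using lborel_integral_real_affine[of "-1" "\<lambda>t. cmod (\<phi> t)" t] by simp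
    finally show ?thesis by (simp only: D_def)
  qed
  moreover have "cmod (conv kc \<phi> t) \<le> D" for t
    by (rule tendsto_upperbound[OF tendsto_norm[OF conv_kernel_LIMSEQ[OF assms]]]) (use 2 in auto)
  ultimately show ?thesis using that by blast
qed

lemma conv_kernel_borel:
  assumes "\<phi> \<in> schwartz"
  shows "conv kc \<phi> \<in> borel_measurable borel"
  using schwartz_borel[OF assms] by (intro conv_borel kc_borel)

text \<open>Limit of \<open>integral_conv_fourier\<close> for the truncations. In time the uniform
  bound on the convolutions times the modulus of \<open>fourier \<psi>\<close> dominates, in
  frequency the weight with the inverse square root.\<close>

lemma integral_conv_kernel:
  assumes \<phi>: "\<phi> \<in> schwartz" and \<psi>: "\<psi> \<in> schwartz"
  shows "(CLBINT t. conv kc \<phi> t * fourier \<psi> t) = (CLBINT \<omega>. khat \<omega> * (fourier \<phi> \<omega> * \<psi> \<omega>))"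
proof (rule LIMSEQ_unique)
  have [measurable]: "\<phi> \<in> borel_measurable borel" "\<psi> \<in> borel_measurable borel"
    using \<phi> \<psi> by (auto intro: schwartz_borel)
  obtain B where B: "\<And>t. cmod (conv kc \<phi> t) \<le> B" "\<And>T t. cmod (conv (trunc T) \<phi> t) \<le> B"
    using conv_kernel_bound[OF \<phi>] by blast
  have [measurable]: "conv kc \<phi> \<in> borel_measurable borel" "conv (trunc T) \<phi> \<in> borel_measurable borel" for T
    by (auto intro!: conv_borel)
  have i: "integrable lborel (\<lambda>t. B * cmod (fourier \<psi> t))"
    by (intro integrable_mult_right integrable_norm integrable_schwartz fourier_schwartz \<psi>)
  show "(\<lambda>n. CLBINT t. conv (trunc (real n)) \<phi> t * fourier \<psi> t) \<longlonglongrightarrow> (CLBINT t. conv kc \<phi> t * fourier \<psi> t)"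
    by (rule integral_dominated_convergence[OF _ _ i])
       (auto intro!: AE_I2 tendsto_mult conv_kernel_LIMSEQ \<phi> mult_right_mono B simp: norm_mult)
  obtain D where D: "\<And>x. cmod (fourier \<phi> x * \<psi> x) \<le> D / (1 + x\<^sup>2)"
    using schwartz_mult_bound[OF fourier_schwartz[OF \<phi>] \<psi>] by metis
  have "(\<lambda>n. CLBINT \<omega>. fourier (trunc (real n)) \<omega> * (fourier \<phi> \<omega> * \<psi> \<omega>)) \<longlonglongrightarrow>
      (CLBINT \<omega>. khat \<omega> * (fourier \<phi> \<omega> * \<psi> \<omega>))"
    by (rule integrable_khat_mult(2)[OF _ D]) measurable
  then show "(\<lambda>n. CLBINT t. conv (trunc (real n)) \<phi> t * fourier \<psi> t) \<longlonglongrightarrow>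
      (CLBINT \<omega>. khat \<omega> * (fourier \<phi> \<omega> * \<psi> \<omega>))"
    unfolding integral_conv_fourier[OF trunc_integrable \<phi> \<psi>] mult.assoc .
qed

text \<open>The same passage to the limit for the multiplication formula. Integrability of
  \<open>fourier g\<close> is assumed because the majorant of the kernel beyond \<open>A\<close> is
  the constant \<open>k A\<close>.\<close>

lemma integral_kernel_fourier:
  assumes [measurable]: "g \<in> borel_measurable borel" and D: "\<And>\<omega>. cmod (g \<omega>) \<le> D / (1 + \<omega>\<^sup>2)"
    and i: "integrable lborel (fourier g)"
  shows "(CLBINT t. kc t * fourier g t) = (CLBINT \<omega>. khat \<omega> * g \<omega>)"
proof (rule LIMSEQ_unique)
  have g: "integrable lborel g" by (rule integrable_of_Cauchy_bound[OF _ D]) measurable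
  show "(\<lambda>n. CLBINT t. trunc (real n) t * fourier g t) \<longlonglongrightarrow> (CLBINT t. kc t * fourier g t)"
    by (rule kernel_mult_integrable(2)[OF i fourier_bound[OF g]])
  show "(\<lambda>n. CLBINT t. trunc (real n) t * fourier g t) \<longlonglongrightarrow> (CLBINT \<omega>. khat \<omega> * g \<omega>)"
    unfolding integral_fourier_mult[OF trunc_integrable g, symmetric]
    by (rule integrable_khat_mult(2)[OF _ D]) measurable
qed

text \<open>The even kernel splits into half-line kernels in t and -t, whose transforms are
  \<open>khat\<close> at opposite frequencies. These are conjugate, so they add up to twice a real
  part; with the factor 1 / (2 pi) of \<open>conv_star\<close> this leaves 1 / pi.\<close>

lemma noise_covariance:
  assumes \<phi>: "\<phi> \<in> schwartz" and \<psi>: "\<psi> \<in> schwartz"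
  shows "(CLBINT t. of_real (k \<bar>t\<bar>) * conv \<phi> (star \<psi>) t) =
    of_real (1 / pi) * (CLBINT \<omega>. of_real (Re (khat \<omega>)) * (fourier \<phi> \<omega> * cnj (fourier \<psi> \<omega>)))"
proof -
  note F = fourier_schwartz[OF \<phi>] fourier_schwartz[OF \<psi>]
  have [measurable]: "fourier \<phi> \<in> borel_measurable borel" "fourier \<psi> \<in> borel_measurable borel"
    "\<phi> \<in> borel_measurable borel" "\<psi> \<in> borel_measurable borel"
    by (auto intro: schwartz_borel F \<phi> \<psi>)
  define g where "g \<omega> = fourier \<phi> \<omega> * cnj (fourier \<psi> \<omega>)" for \<omega>
  have gb [measurable]: "g \<in> borel_measurable borel" unfolding g_def[abs_def] by measurable
  have rg [measurable]: "reflect g \<in> borel_measurable borel" unfolding reflect_def[abs_def] by measurable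
  obtain D where D: "\<And>\<omega>. cmod (g \<omega>) \<le> D / (1 + \<omega>\<^sup>2)"
    unfolding g_def using schwartz_mult_bound[OF F] by metis
  have Dr: "cmod (reflect g \<omega>) \<le> D / (1 + \<omega>\<^sup>2)" for \<omega>
    using D[of "- \<omega>"] by (simp add: reflect_def)
  define G where "G = conv \<phi> (star \<psi>)"
  have star: "integrable lborel (star \<psi>)"
  proof -
    have "integrable lborel (\<lambda>t. \<psi> (0 + (-1) * t))"
      by (rule lborel_integrable_real_affine[OF integrable_schwartz[OF \<psi>]]) simp
    then show ?thesis
      unfolding star_def[abs_def] by (intro integrable_bounded_linear[OF bounded_linear_cnj]) simp
  qed
  \<comment> \<open>Up to reflection and the factor 2 pi, \<open>G\<close> is
    \<open>fourier g\<close>; its integrability as a convolution is what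
    \<open>integral_kernel_fourier\<close> asks for.\<close>
  have Gi: "integrable lborel G"
    unfolding G_def by (rule integrable_conv[OF integrable_schwartz[OF \<phi>] star])
  have G: "G t = of_real (1 / (2 * pi)) * fourier g (- t)" for t
  proof -
    have "(\<lambda>\<omega>. iexp (- (t * \<omega>)) * g \<omega>) = (\<lambda>\<omega>. iexp (\<omega> * (- t)) * g \<omega>)"
      by (auto simp: mult.commute)
    then show ?thesis
      unfolding G_def conv_star[OF \<phi> \<psi>] fourier_lborel[OF gb] g_def[symmetric] by (simp only:)
  qed
  have Fr: "fourier (reflect g) t = of_real (2 * pi) * G t" for t
    unfolding G fourier_reflect[OF gb] by simp
  have Fg: "fourier g t = of_real (2 * pi) * G (- t)" for t
    unfolding G by simp
  have Gi': "integrable lborel (\<lambda>t. G (- t))"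
    using lborel_integrable_real_affine[OF Gi, of "-1" 0] by simp
  have i1: "integrable lborel (fourier (reflect g))"
    unfolding Fr[abs_def] by (intro integrable_mult_right Gi)
  have i2: "integrable lborel (fourier g)"
    unfolding Fg[abs_def] by (intro integrable_mult_right Gi')
  have I1: "of_real (2 * pi) * (CLBINT t. kc t * G t) = (CLBINT \<omega>. khat \<omega> * reflect g \<omega>)"
    using integral_kernel_fourier[OF rg Dr i1] unfolding Fr
    by (simp only: mult.left_commute[of "kc _"] integral_mult_right_zero)
  have I2: "of_real (2 * pi) * (CLBINT t. kc t * G (- t)) = (CLBINT \<omega>. khat \<omega> * g \<omega>)"
    using integral_kernel_fourier[OF gb D i2] unfolding Fg
    by (simp only: mult.left_commute[of "kc _"] integral_mult_right_zero)
  have Gb: "cmod (fourier g t) \<le> (LBINT \<omega>. cmod (g \<omega>))" for t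
    by (rule fourier_bound[OF integrable_of_Cauchy_bound[OF gb D]])
  have Gbound: "cmod (G t) \<le> 1 / (2 * pi) * (LBINT \<omega>. cmod (g \<omega>))" for t
    unfolding G norm_mult norm_of_real using Gb[of "- t"] by (simp add: divide_right_mono)
  have k1: "integrable lborel (\<lambda>t. kc t * G t)" by (rule kernel_mult_integrable(1)[OF Gi Gbound])
  have k2: "integrable lborel (\<lambda>t. kc t * G (- t))" by (rule kernel_mult_integrable(1)[OF Gi' Gbound])
  have k3: "integrable lborel (\<lambda>t. kc (- t) * G t)"
    using lborel_integrable_real_affine[OF k2, of "-1" 0] by simp
  have [measurable]: "G \<in> borel_measurable borel" using Gi by auto
  have "(CLBINT t. of_real (k \<bar>t\<bar>) * G t) = (CLBINT t. kc t * G t + kc (- t) * G t)"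
  proof (rule integral_cong_AE)
    show "AE t in lborel. complex_of_real (k \<bar>t\<bar>) * G t = kc t * G t + kc (- t) * G t"
      using AE_lborel_singleton[of 0]
    proof eventually_elim
      case (elim t)
      then show ?case using k_neg[of t] k_neg[of "- t"] by (cases "t > 0") (auto simp: kc_def)
    qed
  qed measurable
  moreover have "\<dots> = (CLBINT t. kc t * G t) + (CLBINT t. kc (- t) * G t)"
    by (rule Bochner_Integration.integral_add[OF k1 k3])
  moreover have "(CLBINT t. kc (- t) * G t) = (CLBINT t. kc t * G (- t))"
    by (subst lborel_integral_real_affine[of "-1" _ 0]) auto
  moreover have "(CLBINT \<omega>. khat \<omega> * reflect g \<omega>) = (CLBINT \<omega>. khat (- \<omega>) * g \<omega>)"
    by (subst lborel_integral_real_affine[of "-1" _ 0]) (auto simp: reflect_def)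
  moreover have "(CLBINT \<omega>. khat (- \<omega>) * g \<omega>) + (CLBINT \<omega>. khat \<omega> * g \<omega>) =
      (CLBINT \<omega>. khat (- \<omega>) * g \<omega> + khat \<omega> * g \<omega>)"
  proof (rule Bochner_Integration.integral_add[symmetric])
    show "integrable lborel (\<lambda>\<omega>. khat \<omega> * g \<omega>)" by (rule integrable_khat_mult(1)[OF gb D])
    show "integrable lborel (\<lambda>\<omega>. khat (- \<omega>) * g \<omega>)"
      using lborel_integrable_real_affine[OF integrable_khat_mult(1)[OF rg Dr], of "-1" 0]
      by (simp add: reflect_def)
  qed
  moreover have "(CLBINT \<omega>. khat (- \<omega>) * g \<omega> + khat \<omega> * g \<omega>) =
      (CLBINT \<omega>. 2 * (of_real (Re (khat \<omega>)) * g \<omega>))"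
  proof (rule integral_cong_AE)
    show "AE \<omega> in lborel. khat (- \<omega>) * g \<omega> + khat \<omega> * g \<omega> = 2 * (of_real (Re (khat \<omega>)) * g \<omega>)"
      using AE_lborel_singleton[of 0]
    proof eventually_elim
      case (elim \<omega>)
      have "khat (- \<omega>) + khat \<omega> = 2 * of_real (Re (khat \<omega>))"
        using khat_minus[OF elim] by (simp add: complex_eq_iff)
      then show ?case by (simp only: distrib_right[symmetric] mult.assoc)
    qed
  qed measurable
  ultimately have "of_real (2 * pi) * (CLBINT t. of_real (k \<bar>t\<bar>) * G t) =
      2 * (CLBINT \<omega>. of_real (Re (khat \<omega>)) * g \<omega>)"
    using I1 I2 by (simp only: distrib_left integral_mult_right_zero)
  then show ?thesis
    unfolding G_def g_def by (simp add: field_simps)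
qed

end

section \<open>Tempered distributions and the spectral domain\<close>

text \<open>The seminorms with powers 0 and 2, both without derivatives, add up to the weight 1 +
  x^2 and so yield an integrable profile for the error.\<close>

lemma schwartz_tendsto_integral_bound:
  assumes conv: "schwartz_tendsto \<phi>s \<phi>" and e: "e > 0"
  shows "\<forall>\<^sub>F n in sequentially. \<forall>x. cmod (\<phi>s n x - \<phi> x) \<le> e / (1 + x\<^sup>2)"
proof -
  have u: "uniform_limit UNIV (\<lambda>n x. of_real x ^ j * \<phi>s n x) (\<lambda>x. of_real x ^ j * \<phi> x) sequentially" for j
    using conv[unfolded schwartz_tendsto_def, rule_format, of j 0] by simp
  have "\<forall>\<^sub>F n in sequentially. \<forall>x\<in>UNIV. dist (of_real x ^ j * \<phi>s n x) (of_real x ^ j * \<phi> x) < e / 2" for j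
    using u[of j, unfolded uniform_limit_iff, rule_format, of "e / 2"] e by simp
  from this[of 0] this[of 2] show ?thesis
  proof eventually_elim
    case (elim n)
    show ?case
    proof
      fix x :: real
      have p: "1 + x\<^sup>2 > 0" by (simp add: add_pos_nonneg)
      have "cmod (\<phi>s n x - \<phi> x) < e / 2"
        using elim(1) by (simp add: dist_norm)
      moreover have "x\<^sup>2 * cmod (\<phi>s n x - \<phi> x) < e / 2"
        using bspec[OF elim(2), of x] by (simp add: dist_norm norm_mult norm_power flip: right_diff_distrib)
      ultimately have "(1 + x\<^sup>2) * cmod (\<phi>s n x - \<phi> x) \<le> e"
        by (simp add: algebra_simps)
      then show "cmod (\<phi>s n x - \<phi> x) \<le> e / (1 + x\<^sup>2)"
        using p by (simp add: pos_le_divide_eq mult.commute)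
    qed
  qed
qed

lemma dist_of_tempered:
  assumes fb [measurable]: "f \<in> borel_measurable borel" and B: "\<And>x. cmod (f x) \<le> B"
  shows "dist_of f \<in> tempered"
proof -
  have i: "integrable lborel (\<lambda>x. f x * \<phi> x)" if "\<phi> \<in> schwartz" for \<phi>
    by (rule integrable_bounded_schwartz[OF that fb B])
  have d: "dist_of f \<phi> = (CLBINT x. f x * \<phi> x)" if "\<phi> \<in> schwartz" for \<phi>
    unfolding dist_of_def using that schwartz_borel[OF that] by (simp add: integral_lebesgue_lborel)
  show ?thesis
    unfolding tempered_def
  proof (intro CollectI conjI ballI allI impI)
    fix \<phi> \<psi> a b assume S: "\<phi> \<in> schwartz" "\<psi> \<in> schwartz"
    have "dist_of f (\<lambda>x. a * \<phi> x + b * \<psi> x) = (CLBINT x. a * (f x * \<phi> x) + b * (f x * \<psi> x))"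
      unfolding d[OF schwartz_lincomb[OF S]] by (simp add: algebra_simps)
    also have "\<dots> = a * (CLBINT x. f x * \<phi> x) + b * (CLBINT x. f x * \<psi> x)"
      by (simp only: Bochner_Integration.integral_add[OF integrable_mult_right[OF i[OF S(1)]] integrable_mult_right[OF i[OF S(2)]]]
          integral_mult_right_zero)
    finally show "dist_of f (\<lambda>x. a * \<phi> x + b * \<psi> x) = a * dist_of f \<phi> + b * dist_of f \<psi>"
      by (simp only: d S)
  next
    fix \<phi>s \<phi> assume S: "\<forall>n. \<phi>s n \<in> schwartz" "\<phi> \<in> schwartz" and c: "schwartz_tendsto \<phi>s \<phi>"
    define J where "J = (LBINT x::real. 1 / (1 + x\<^sup>2))"
    have J: "J \<ge> 0" unfolding J_def by (intro integral_nonneg_AE AE_I2) simp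
    have B0: "B \<ge> 0" using B[of 0] norm_ge_zero order_trans by blast
    show "(\<lambda>n. dist_of f (\<phi>s n)) \<longlonglongrightarrow> dist_of f \<phi>"
    proof (rule tendstoI)
      fix e :: real assume e: "e > 0"
      \<comment> \<open>The error is at most \<open>B * J * \<delta>\<close>. The summand 1 keeps
        the denominator positive and the final inequality strict.\<close>
      define \<delta> where "\<delta> = e / (B * J + 1)"
      have \<delta>: "\<delta> > 0" using e B0 J by (simp add: \<delta>_def add_nonneg_pos)
      show "\<forall>\<^sub>F n in sequentially. dist (dist_of f (\<phi>s n)) (dist_of f \<phi>) < e"
        using schwartz_tendsto_integral_bound[OF c \<delta>]
      proof eventually_elim
        case (elim n)
        have "dist_of f (\<phi>s n) - dist_of f \<phi> = (CLBINT x. f x * \<phi>s n x - f x * \<phi> x)"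
          unfolding d[OF S(2)] d[OF S(1)[rule_format]]
          by (rule Bochner_Integration.integral_diff[symmetric]) (use i S in auto)
        also have "cmod \<dots> \<le> (LBINT x. (B * \<delta>) * (1 / (1 + x\<^sup>2)))"
        proof (rule order_trans[OF integral_norm_bound Bochner_Integration.integral_mono])
          show "integrable lborel (\<lambda>x. cmod (f x * \<phi>s n x - f x * \<phi> x))"
            using i S by (intro integrable_norm Bochner_Integration.integrable_diff) auto
          show "integrable lborel (\<lambda>x::real. (B * \<delta>) * (1 / (1 + x\<^sup>2)))"
            by (intro integrable_mult_right integrable_Cauchy)
          fix x
          have "cmod (f x * \<phi>s n x - f x * \<phi> x) = cmod (f x) * cmod (\<phi>s n x - \<phi> x)"
            by (simp flip: right_diff_distrib norm_mult)
          also have "\<dots> \<le> B * (\<delta> / (1 + x\<^sup>2))"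
            using elim B B0 by (intro mult_mono) auto
          finally show "cmod (f x * \<phi>s n x - f x * \<phi> x) \<le> (B * \<delta>) * (1 / (1 + x\<^sup>2))" by simp
        qed
        also have "\<dots> = (B * J) * \<delta>" by (simp only: integral_mult_right_zero J_def mult_ac)
        also have "\<dots> < e"
        proof -
          have "(B * J) * e < (B * J + 1) * e" using e by (simp add: distrib_right)
          then show ?thesis using B0 J by (simp add: \<delta>_def divide_less_eq add_nonneg_pos mult.commute)
        qed
        finally show ?case by (simp add: dist_norm)
      qed
    qed
  next
    fix \<phi> :: "real \<Rightarrow> complex" assume "\<phi> \<notin> schwartz"
    then show "dist_of f \<phi> = 0" by (simp add: dist_of_def)
  qed
qed

lemma is_function_fourier_distI:
  assumes [measurable]: "f \<in> borel_measurable borel" "h \<in> borel_measurable borel"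
    and i: "\<And>\<psi>. \<psi> \<in> schwartz \<Longrightarrow> integrable lborel (\<lambda>\<omega>. h \<omega> * \<psi> \<omega>)"
    and e: "\<And>\<psi>. \<psi> \<in> schwartz \<Longrightarrow> (CLBINT t. f t * fourier \<psi> t) = (CLBINT \<omega>. h \<omega> * \<psi> \<omega>)"
  shows "is_function (fourier_dist (dist_of f)) h"
  unfolding is_function_def
proof (intro conjI ballI ext)
  fix \<psi> assume S: "\<psi> \<in> schwartz"
  have [measurable]: "\<psi> \<in> borel_measurable borel" using S by (rule schwartz_borel)
  show "integrable lebesgue (\<lambda>x. h x * \<psi> x)" using i[OF S] by (simp add: integrable_lebesgue_lborel)
next
  fix \<psi> :: "real \<Rightarrow> complex"
  show "fourier_dist (dist_of f) \<psi> = dist_of h \<psi>"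
  proof (cases "\<psi> \<in> schwartz")
    case S: True
    have [measurable]: "\<psi> \<in> borel_measurable borel" using S by (rule schwartz_borel)
    show ?thesis
      using S e[OF S] by (simp add: fourier_dist_def dist_of_def fourier_schwartz integral_lebesgue_lborel)
  qed (simp add: fourier_dist_def dist_of_def)
qed fact

section \<open>Square integrability for the spectral measure\<close>

lemma square_integrable_lincomb:
  assumes f: "square_integrable M f" and g: "square_integrable M g"
  shows "square_integrable M (\<lambda>x. a * f x + b * g x)"
proof -
  have [measurable]: "f \<in> borel_measurable M" "g \<in> borel_measurable M"
    using f g by (auto simp: square_integrable_def)
  have i: "integrable M (\<lambda>x. 2 * (cmod a)\<^sup>2 * (cmod (f x))\<^sup>2 + 2 * (cmod b)\<^sup>2 * (cmod (g x))\<^sup>2)"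
    using f g by (auto simp: square_integrable_def)
  have "(cmod (a * f x + b * g x))\<^sup>2 \<le> 2 * (cmod a)\<^sup>2 * (cmod (f x))\<^sup>2 + 2 * (cmod b)\<^sup>2 * (cmod (g x))\<^sup>2" for x
  proof -
    have "(cmod (a * f x + b * g x))\<^sup>2 \<le> (cmod a * cmod (f x) + cmod b * cmod (g x))\<^sup>2"
      by (intro power_mono) (auto intro: order_trans[OF norm_triangle_ineq] simp: norm_mult)
    also have "\<dots> \<le> 2 * (cmod a * cmod (f x))\<^sup>2 + 2 * (cmod b * cmod (g x))\<^sup>2"
      using sum_squares_bound[of "cmod a * cmod (f x)" "cmod b * cmod (g x)"]
      by (simp add: power2_sum)
    finally show ?thesis by (simp add: power_mult_distrib)
  qed
  then have "integrable M (\<lambda>x. (cmod (a * f x + b * g x))\<^sup>2)"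
    by (intro Bochner_Integration.integrable_bound[OF i]) (auto intro!: AE_I2)
  then show ?thesis by (simp add: square_integrable_def)
qed

lemma square_integrable_cong_norm:
  assumes "square_integrable M f" "g \<in> borel_measurable M" "AE x in M. cmod (g x) = cmod (f x)"
  shows "square_integrable M g"
proof -
  have [measurable]: "f \<in> borel_measurable M" "g \<in> borel_measurable M"
    using assms by (auto simp: square_integrable_def)
  have "integrable M (\<lambda>x. (cmod (f x))\<^sup>2)" using assms by (simp add: square_integrable_def)
  then have "integrable M (\<lambda>x. (cmod (g x))\<^sup>2)"
    by (rule integrable_cong_AE_imp) (use assms(3) in \<open>measurable, eventually_elim, simp\<close>)
  then show ?thesis using assms(2) by (simp add: square_integrable_def)
qed

text \<open>In |phi|^2 one factor is bounded by a constant and the other by a multiple of the weight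
  that is assumed integrable.\<close>

lemma square_integrable_schwartz:
  assumes sets: "sets \<nu> = sets borel"
    and fin: "(\<integral>\<^sup>+x. ennreal ((1 + x\<^sup>2) powi (- k)) \<partial>\<nu>) < \<infinity>"
    and \<phi>: "\<phi> \<in> schwartz"
  shows "square_integrable \<nu> \<phi>"
proof -
  have [measurable_cong]: "sets \<nu> = sets borel" by fact
  have [measurable]: "\<phi> \<in> borel_measurable borel" using \<phi> by (rule schwartz_borel)
  \<comment> \<open>For negative \<open>k\<close> the exponent \<open>nat k\<close> is 0; the weight
    is then at least 1 and boundedness of phi is enough.\<close>
  obtain B where B: "B > 0" "\<And>x. cmod (\<phi> x) \<le> B" using schwartz_bounded[OF \<phi>] by blast
  obtain D where D: "D \<ge> 0" "\<And>x. (1 + x\<^sup>2) ^ nat k * cmod (\<phi> x) \<le> D" using schwartz_decay[OF \<phi>] by blast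
  have le: "(cmod (\<phi> x))\<^sup>2 \<le> B * D * (1 + x\<^sup>2) powi (- k)" for x
  proof -
    have p: "1 + x\<^sup>2 > 0" by (simp add: add_pos_nonneg)
    have "inverse ((1 + x\<^sup>2) ^ nat k) \<le> (1 + x\<^sup>2) powi (- k)"
    proof (cases "k \<ge> 0")
      case True
      then show ?thesis by (simp add: power_int_def power_inverse)
    next
      case False
      have "1 \<le> (1 + x\<^sup>2) ^ nat (- k)" by (rule one_le_power) simp
      then show ?thesis using False by (simp add: power_int_def)
    qed
    then have "D * inverse ((1 + x\<^sup>2) ^ nat k) \<le> D * (1 + x\<^sup>2) powi (- k)"
      using D by (intro mult_left_mono)
    moreover have "cmod (\<phi> x) \<le> D * inverse ((1 + x\<^sup>2) ^ nat k)"
      using D(2)[of x] p by (simp add: field_simps)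
    ultimately have "cmod (\<phi> x) \<le> D * (1 + x\<^sup>2) powi (- k)" by linarith
    then have "cmod (\<phi> x) * cmod (\<phi> x) \<le> B * (D * (1 + x\<^sup>2) powi (- k))"
      using B by (intro mult_mono) auto
    then show ?thesis by (simp add: power2_eq_square mult.assoc)
  qed
  have int: "integrable \<nu> (\<lambda>x. B * D * (1 + x\<^sup>2) powi (- k))"
  proof (intro integrable_mult_right integrableI_nonneg)
    have "(\<lambda>x::real. (1 + x\<^sup>2) powi (- k)) \<in> borel_measurable borel"
      by (intro borel_measurable_continuous_onI continuous_on_power_int continuous_intros)
         (metis add_pos_nonneg zero_le_power2 zero_less_one less_irrefl)
    then show "(\<lambda>x::real. (1 + x\<^sup>2) powi (- k)) \<in> borel_measurable \<nu>" by measurable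
    show "AE x in \<nu>. 0 \<le> (1 + x\<^sup>2) powi (- k)"
      by (intro AE_I2 zero_le_power_int) simp
  qed (use fin in simp)
  have "integrable \<nu> (\<lambda>x. (cmod (\<phi> x))\<^sup>2)"
  proof (rule Bochner_Integration.integrable_bound[OF int])
    show "AE x in \<nu>. norm ((cmod (\<phi> x))\<^sup>2) \<le> norm (B * D * (1 + x\<^sup>2) powi (- k))"
    proof (rule AE_I2)
      fix x
      show "norm ((cmod (\<phi> x))\<^sup>2) \<le> norm (B * D * (1 + x\<^sup>2) powi (- k))"
        unfolding real_norm_def abs_power2 by (rule order_trans[OF le abs_ge_self])
    qed
  qed measurable
  then show ?thesis by (simp add: square_integrable_def)
qed

lemma AE_absolutely_continuous:
  assumes "sets \<nu> = sets borel" "absolutely_continuous lborel \<nu>" "AE x in lborel. P x"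
  shows "AE x in \<nu>. P x"
  using assms by (intro absolutely_continuous_AE[of \<nu> lborel]) auto

section \<open>Transforms of the test functionals\<close>

context memory_kernel
begin

lemma khat_schwartz_borel:
  "\<phi> \<in> schwartz \<Longrightarrow> (\<lambda>\<omega>. khat \<omega> * \<phi> \<omega>) \<in> borel_measurable borel"
  using schwartz_borel[of \<phi>] by measurable

lemma khat_mult_integrable:
  assumes "\<phi> \<in> schwartz" "\<psi> \<in> schwartz"
  shows "integrable lborel (\<lambda>\<omega>. khat \<omega> * \<phi> \<omega> * \<psi> \<omega>)"
proof -
  have [measurable]: "\<phi> \<in> borel_measurable borel" "\<psi> \<in> borel_measurable borel"
    using assms by (auto intro: schwartz_borel)
  obtain D where "\<And>x. cmod (\<phi> x * \<psi> x) \<le> D / (1 + x\<^sup>2)" using schwartz_mult_bound[OF assms] by metis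
  then show ?thesis
    unfolding mult.assoc by (intro integrable_khat_mult(1)) measurable
qed

lemma conv_kernel_tempered: "\<phi> \<in> schwartz \<Longrightarrow> dist_of (conv kc \<phi>) \<in> tempered"
  using conv_kernel_bound[of \<phi>] by (metis dist_of_tempered conv_kernel_borel)

lemma is_function_conv_kernel:
  assumes \<phi>: "\<phi> \<in> schwartz"
  shows "is_function (fourier_dist (dist_of (conv kc \<phi>))) (\<lambda>\<omega>. khat \<omega> * fourier \<phi> \<omega>)"
  by (intro is_function_fourier_distI conv_kernel_borel khat_schwartz_borel khat_mult_integrable
      fourier_schwartz \<phi>) (simp_all add: integral_conv_kernel[OF \<phi>] mult.assoc)

text \<open>The conjugate stems from the reflections around the convolution, which turn
  \<open>khat \<omega>\<close> into \<open>khat (- \<omega>)\<close>. The plus sign is the product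
  of the sign in -m phi' and the one in \<open>fourier_deriv\<close>.\<close>

definition response :: "real \<Rightarrow> real \<Rightarrow> real \<Rightarrow> complex" where
  "response m \<beta> \<omega> = of_real \<beta> * cnj (khat \<omega>) + \<i> * of_real (m * \<omega>)"

text \<open>The function \<open>gle_test\<close> with the Borel kernel \<open>kc\<close> in place of
  \<open>K_plus K\<close>; by \<open>gle_test_eq\<close> the two coincide at every point.\<close>

definition gle_kernel_test :: "real \<Rightarrow> real \<Rightarrow> (real \<Rightarrow> complex) \<Rightarrow> real \<Rightarrow> complex" where
  "gle_kernel_test m \<beta> \<phi> t = - of_real m * vector_derivative \<phi> (at t) +
     of_real \<beta> * reflect (conv kc (reflect \<phi>)) t"

lemma reflect_conv_borel:
  assumes "\<phi> \<in> schwartz"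
  shows "reflect (conv kc (reflect \<phi>)) \<in> borel_measurable borel"
proof -
  have [measurable]: "conv kc (reflect \<phi>) \<in> borel_measurable borel"
    by (rule conv_kernel_borel[OF schwartz_reflect[OF assms]])
  show ?thesis unfolding reflect_def[of "conv _ _", abs_def] by measurable
qed

lemma gle_kernel_test_borel:
  assumes "\<phi> \<in> schwartz"
  shows "gle_kernel_test m \<beta> \<phi> \<in> borel_measurable borel"
proof -
  note [measurable] = reflect_conv_borel[OF assms] schwartz_borel[OF schwartz_deriv[OF assms]]
  show ?thesis unfolding gle_kernel_test_def[abs_def] by measurable
qed

lemma gle_kernel_test_tempered:
  assumes "\<phi> \<in> schwartz"
  shows "dist_of (gle_kernel_test m \<beta> \<phi>) \<in> tempered"
proof -
  obtain B1 where B1: "\<And>x. cmod (vector_derivative \<phi> (at x)) \<le> B1"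
    using schwartz_bounded[OF schwartz_deriv[OF assms]] by blast
  obtain B2 where B2: "\<And>t. cmod (conv kc (reflect \<phi>) t) \<le> B2"
    using conv_kernel_bound[OF schwartz_reflect[OF assms]] by metis
  show ?thesis
  proof (rule dist_of_tempered[OF gle_kernel_test_borel[OF assms]])
    fix t
    have "cmod (gle_kernel_test m \<beta> \<phi> t) \<le>
        cmod (- of_real m) * cmod (vector_derivative \<phi> (at t)) + cmod (of_real \<beta>) * cmod (reflect (conv kc (reflect \<phi>)) t)"
      unfolding gle_kernel_test_def norm_mult[symmetric] by (rule norm_triangle_ineq)
    also have "\<dots> \<le> cmod (- of_real m) * B1 + cmod (of_real \<beta>) * B2"
      by (intro add_mono mult_left_mono B1) (auto simp: reflect_def B2)
    finally show "cmod (gle_kernel_test m \<beta> \<phi> t) \<le> cmod (- of_real m) * B1 + cmod (of_real \<beta>) * B2" .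
  qed
qed

lemma response_borel [measurable]: "response m \<beta> \<in> borel_measurable borel"
  unfolding response_def[abs_def] by measurable

lemma is_function_gle_kernel_test:
  assumes \<phi>: "\<phi> \<in> schwartz"
  shows "is_function (fourier_dist (dist_of (gle_kernel_test m \<beta> \<phi>))) (\<lambda>\<omega>. response m \<beta> \<omega> * fourier \<phi> \<omega>)"
proof (rule is_function_fourier_distI)
  note F = fourier_schwartz[OF \<phi>]
  note [measurable] = schwartz_borel[OF \<phi>] schwartz_borel[OF schwartz_deriv[OF \<phi>]] reflect_conv_borel[OF \<phi>]
  show "(\<lambda>\<omega>. response m \<beta> \<omega> * fourier \<phi> \<omega>) \<in> borel_measurable borel" by measurable
  fix \<psi> assume \<psi>: "\<psi> \<in> schwartz"
  note [measurable] = schwartz_borel[OF \<psi>]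
  note D = schwartz_deriv[OF \<phi>]
  have i1: "integrable lborel (\<lambda>\<omega>. cnj (khat \<omega>) * (fourier \<phi> \<omega> * \<psi> \<omega>))"
    by (rule Bochner_Integration.integrable_bound[OF khat_mult_integrable[OF F \<psi>]]) (auto simp: norm_mult mult.assoc)
  have i2: "integrable lborel (\<lambda>\<omega>. fourier (\<lambda>x. vector_derivative \<phi> (at x)) \<omega> * \<psi> \<omega>)"
    by (rule integrable_bounded_schwartz[OF \<psi> _ fourier_bound[OF integrable_schwartz[OF D]]]) measurable
  have e: "response m \<beta> \<omega> * fourier \<phi> \<omega> * \<psi> \<omega> =
     of_real \<beta> * (cnj (khat \<omega>) * (fourier \<phi> \<omega> * \<psi> \<omega>)) +
     (- of_real m) * (fourier (\<lambda>x. vector_derivative \<phi> (at x)) \<omega> * \<psi> \<omega>)" for \<omega>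
    unfolding response_def fourier_deriv[OF \<phi>] by (simp add: algebra_simps)
  show "integrable lborel (\<lambda>\<omega>. response m \<beta> \<omega> * fourier \<phi> \<omega> * \<psi> \<omega>)"
    unfolding e by (intro Bochner_Integration.integrable_add integrable_mult_right i1 i2)
  \<comment> \<open>Reflecting both factors reduces this to \<open>integral_conv_kernel\<close> for
    the reflected functions; reflecting back changes \<open>khat\<close> to
    \<open>khat (- \<omega>)\<close>, its conjugate off 0.\<close>
  have R: "(CLBINT t. reflect (conv kc (reflect \<phi>)) t * fourier \<psi> t) =
      (CLBINT \<omega>. cnj (khat \<omega>) * (fourier \<phi> \<omega> * \<psi> \<omega>))"
  proof -
    have "(CLBINT t. reflect (conv kc (reflect \<phi>)) t * fourier \<psi> t) =
        (CLBINT t. conv kc (reflect \<phi>) t * fourier (reflect \<psi>) t)"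
      unfolding fourier_reflect[OF schwartz_borel[OF \<psi>]]
      by (subst lborel_integral_real_affine[of "-1" _ 0]) (auto simp: reflect_def)
    also have "\<dots> = (CLBINT \<omega>. khat \<omega> * (fourier (reflect \<phi>) \<omega> * reflect \<psi> \<omega>))"
      by (rule integral_conv_kernel[OF schwartz_reflect[OF \<phi>] schwartz_reflect[OF \<psi>]])
    also have "\<dots> = (CLBINT \<omega>. khat (- \<omega>) * (fourier \<phi> \<omega> * \<psi> \<omega>))"
      unfolding fourier_reflect[OF schwartz_borel[OF \<phi>]]
      by (subst lborel_integral_real_affine[of "-1" _ 0]) (auto simp: reflect_def)
    also have "\<dots> = (CLBINT \<omega>. cnj (khat \<omega>) * (fourier \<phi> \<omega> * \<psi> \<omega>))"
    proof (rule integral_cong_AE)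
      show "AE \<omega> in lborel. khat (- \<omega>) * (fourier \<phi> \<omega> * \<psi> \<omega>) = cnj (khat \<omega>) * (fourier \<phi> \<omega> * \<psi> \<omega>)"
        using AE_lborel_singleton[of 0] by eventually_elim (simp add: khat_minus)
    qed measurable
    finally show ?thesis .
  qed
  obtain B2 where B2: "\<And>t. cmod (conv kc (reflect \<phi>) t) \<le> B2"
    using conv_kernel_bound[OF schwartz_reflect[OF \<phi>]] by metis
  have j1: "integrable lborel (\<lambda>t. reflect (conv kc (reflect \<phi>)) t * fourier \<psi> t)"
    by (rule integrable_bounded_schwartz[OF fourier_schwartz[OF \<psi>] reflect_conv_borel[OF \<phi>], where B = B2])
       (simp add: reflect_def[of "conv _ _"] B2)
  obtain B1 where B1: "\<And>x. cmod (vector_derivative \<phi> (at x)) \<le> B1"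
    using schwartz_bounded[OF D] by blast
  have j2: "integrable lborel (\<lambda>t. vector_derivative \<phi> (at t) * fourier \<psi> t)"
    by (rule integrable_bounded_schwartz[OF fourier_schwartz[OF \<psi>] _ B1]) measurable
  have "(\<lambda>t. gle_kernel_test m \<beta> \<phi> t * fourier \<psi> t) =
     (\<lambda>t. of_real \<beta> * (reflect (conv kc (reflect \<phi>)) t * fourier \<psi> t) +
       (- of_real m) * (vector_derivative \<phi> (at t) * fourier \<psi> t))"
    unfolding gle_kernel_test_def by (simp add: algebra_simps)
  then have "(CLBINT t. gle_kernel_test m \<beta> \<phi> t * fourier \<psi> t) =
     of_real \<beta> * (CLBINT t. reflect (conv kc (reflect \<phi>)) t * fourier \<psi> t) +
     (- of_real m) * (CLBINT t. vector_derivative \<phi> (at t) * fourier \<psi> t)"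
    by (simp only: Bochner_Integration.integral_add[OF integrable_mult_right[OF j1] integrable_mult_right[OF j2]]
       integral_mult_right_zero)
  also have "\<dots> = of_real \<beta> * (CLBINT \<omega>. cnj (khat \<omega>) * (fourier \<phi> \<omega> * \<psi> \<omega>)) +
     (- of_real m) * (CLBINT \<omega>. fourier (\<lambda>x. vector_derivative \<phi> (at x)) \<omega> * \<psi> \<omega>)"
    unfolding R integral_fourier_mult[OF integrable_schwartz[OF D] integrable_schwartz[OF \<psi>]] ..
  also have "\<dots> = (CLBINT \<omega>. response m \<beta> \<omega> * fourier \<phi> \<omega> * \<psi> \<omega>)"
    unfolding e by (simp only: Bochner_Integration.integral_add[OF integrable_mult_right[OF i1] integrable_mult_right[OF i2]]
       integral_mult_right_zero)
  finally show "(CLBINT t. gle_kernel_test m \<beta> \<phi> t * fourier \<psi> t) =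
    (CLBINT \<omega>. response m \<beta> \<omega> * fourier \<phi> \<omega> * \<psi> \<omega>)" .
qed (fact gle_kernel_test_borel[OF \<phi>])

end

section \<open>The spectral density\<close>

context memory_kernel
begin

text \<open>Condition (a) of a weak solution concerns \<open>khat\<close> alone, the covariance of
  \<open>V\<close> the whole response. Up to a conjugation, which keeps the modulus, and the factor
  \<open>\<beta>\<close>, they differ by a multiple of omega phi, which the moment condition makes
  square integrable.\<close>

lemma square_integrable_khat_iff:
  assumes sets: "sets \<nu> = sets borel"
    and fin: "(\<integral>\<^sup>+x. ennreal ((1 + x\<^sup>2) powi (- j)) \<partial>\<nu>) < \<infinity>"
    and \<beta>: "\<beta> > 0" and \<phi>: "\<phi> \<in> schwartz"
  shows "square_integrable \<nu> (\<lambda>\<omega>. khat \<omega> * \<phi> \<omega>) \<longleftrightarrow> square_integrable \<nu> (\<lambda>\<omega>. response m \<beta> \<omega> * \<phi> \<omega>)"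
proof -
  have [measurable_cong]: "sets \<nu> = sets borel" by fact
  have [measurable]: "\<phi> \<in> borel_measurable borel" using \<phi> by (rule schwartz_borel)
  have x: "square_integrable \<nu> (\<lambda>\<omega>. of_real \<omega> * \<phi> \<omega>)"
    by (rule square_integrable_schwartz[OF sets fin schwartz_times_x[OF \<phi>]])
  have c: "square_integrable \<nu> (\<lambda>\<omega>. khat \<omega> * \<phi> \<omega>) \<longleftrightarrow> square_integrable \<nu> (\<lambda>\<omega>. cnj (khat \<omega>) * \<phi> \<omega>)"
    by (intro iffI; erule square_integrable_cong_norm) (auto simp: norm_mult)
  have 1: "(\<lambda>\<omega>. response m \<beta> \<omega> * \<phi> \<omega>) = (\<lambda>\<omega>. of_real \<beta> * (cnj (khat \<omega>) * \<phi> \<omega>) + (\<i> * of_real m) * (of_real \<omega> * \<phi> \<omega>))"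
    by (simp add: response_def fun_eq_iff algebra_simps)
  have 2: "(\<lambda>\<omega>. cnj (khat \<omega>) * \<phi> \<omega>) =
      (\<lambda>\<omega>. of_real (1 / \<beta>) * (response m \<beta> \<omega> * \<phi> \<omega>) + (- \<i> * of_real (m / \<beta>)) * (of_real \<omega> * \<phi> \<omega>))"
    using \<beta> by (simp add: response_def fun_eq_iff field_simps)
  show ?thesis
    unfolding c
  proof
    assume "square_integrable \<nu> (\<lambda>\<omega>. cnj (khat \<omega>) * \<phi> \<omega>)"
    then show "square_integrable \<nu> (\<lambda>\<omega>. response m \<beta> \<omega> * \<phi> \<omega>)"
      unfolding 1 by (rule square_integrable_lincomb[OF _ x])
  next
    assume "square_integrable \<nu> (\<lambda>\<omega>. response m \<beta> \<omega> * \<phi> \<omega>)"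
    then show "square_integrable \<nu> (\<lambda>\<omega>. cnj (khat \<omega>) * \<phi> \<omega>)"
      unfolding 2 by (rule square_integrable_lincomb[OF _ x])
  qed
qed

text \<open>This is \<open>r_hat\<close> off 0: its factor 2 beta / (2 pi) is reduced, and its
  denominator is recognised as a squared modulus. Written through \<open>khat\<close>, it is visibly
  Borel.\<close>

definition spectral_density :: "real \<Rightarrow> real \<Rightarrow> real \<Rightarrow> real" where
  "spectral_density m \<beta> \<omega> = \<beta> * Re (khat \<omega>) / (pi * (cmod (response m \<beta> \<omega>))\<^sup>2)"

lemma spectral_density_borel [measurable]: "spectral_density m \<beta> \<in> borel_measurable borel"
  unfolding spectral_density_def[abs_def] by measurable

text \<open>The positivity of \<open>K_cos\<close> enters here, since the real part of the response
  is beta times that of \<open>khat\<close>.\<close>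

lemma response_nonzero:
  assumes "\<beta> > 0" "Re (khat \<omega>) > 0"
  shows "cmod (response m \<beta> \<omega>) > 0"
proof -
  have "Re (response m \<beta> \<omega>) > 0" using assms by (simp add: response_def)
  then show ?thesis by auto
qed

lemma spectral_density_mult:
  assumes "\<beta> > 0" "Re (khat \<omega>) > 0"
  shows "spectral_density m \<beta> \<omega> * (cmod (response m \<beta> \<omega>))\<^sup>2 = \<beta> / pi * Re (khat \<omega>)"
  using response_nonzero[OF assms, of m] by (simp add: spectral_density_def)

lemma response_covariance:
  "response m \<beta> \<omega> * a * cnj (response m \<beta> \<omega> * b) = of_real ((cmod (response m \<beta> \<omega>))\<^sup>2) * (a * cnj b)"
proof -
  have "response m \<beta> \<omega> * cnj (response m \<beta> \<omega>) = of_real ((cmod (response m \<beta> \<omega>))\<^sup>2)"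
    by (rule complex_norm_square[symmetric])
  then show ?thesis by (simp add: mult_ac)
qed

lemma khat_covariance_integrable:
  assumes "\<phi> \<in> schwartz" "\<psi> \<in> schwartz"
  shows "integrable lborel (\<lambda>\<omega>. of_real (Re (khat \<omega>)) * (\<phi> \<omega> * cnj (\<psi> \<omega>)))"
proof (rule Bochner_Integration.integrable_bound[OF khat_mult_integrable[OF assms]])
  have [measurable]: "\<phi> \<in> borel_measurable borel" "\<psi> \<in> borel_measurable borel"
    using assms by (auto intro: schwartz_borel)
  show "(\<lambda>\<omega>. complex_of_real (Re (khat \<omega>)) * (\<phi> \<omega> * cnj (\<psi> \<omega>))) \<in> borel_measurable lborel"
    by measurable
  show "AE \<omega> in lborel. norm (of_real (Re (khat \<omega>)) * (\<phi> \<omega> * cnj (\<psi> \<omega>))) \<le> norm (khat \<omega> * \<phi> \<omega> * \<psi> \<omega>)"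
    by (intro AE_I2) (simp add: norm_mult mult.assoc mult_right_mono abs_Re_le_cmod)
qed

text \<open>Testing the covariance identity against modulated Gaussians turns it into an identity of
  characteristic functions of two finite measures.\<close>

lemma spectral_measure_unique:
  assumes sets: "sets \<nu> = sets borel" and ac: "absolutely_continuous lborel \<nu>"
    and \<beta>: "\<beta> > 0" and pos: "\<And>\<omega>. \<omega> \<noteq> 0 \<Longrightarrow> Re (khat \<omega>) > 0"
    and sq: "\<And>\<phi>. \<phi> \<in> schwartz \<Longrightarrow> square_integrable \<nu> (\<lambda>\<omega>. response m \<beta> \<omega> * fourier \<phi> \<omega>)"
    and cov: "\<And>\<phi> \<psi>. \<phi> \<in> schwartz \<Longrightarrow> \<psi> \<in> schwartz \<Longrightarrow>
      (CLINT \<omega>|\<nu>. response m \<beta> \<omega> * fourier \<phi> \<omega> * cnj (response m \<beta> \<omega> * fourier \<psi> \<omega>)) =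
      of_real (\<beta> / pi) * (CLBINT \<omega>. of_real (Re (khat \<omega>)) * (fourier \<phi> \<omega> * cnj (fourier \<psi> \<omega>)))"
  shows "\<nu> = density lborel (\<lambda>\<omega>. ennreal (spectral_density m \<beta> \<omega>))"
proof -
  have [measurable_cong]: "sets \<nu> = sets borel" by fact
  define g where "g s \<omega> = iexp (s * \<omega>) * complex_of_real (exp (- \<omega>\<^sup>2 / 2))" for s \<omega>
  have gS: "g s \<in> schwartz" for s unfolding g_def by (rule schwartz_gaussian)
  have "\<exists>\<phi>\<in>schwartz. fourier \<phi> = g s" for s using fourier_surj[OF gS] by metis
  then obtain \<phi> where \<phi>: "\<And>s. \<phi> s \<in> schwartz" "\<And>s. fourier (\<phi> s) = g s" by metis
  \<comment> \<open>The product of \<open>g s\<close> and the conjugate of \<open>g 0\<close> is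
    exp(i s omega) exp(-omega^2). The covariance identity therefore compares the characteristic
    functions of the measures with density \<open>u\<close> against \<open>\<nu>\<close> and
    \<open>v\<close> against Lebesgue measure.\<close>
  define u where "u \<omega> = (cmod (response m \<beta> \<omega>))\<^sup>2 * exp (- \<omega>\<^sup>2)" for \<omega>
  define v where "v \<omega> = \<beta> / pi * Re (khat \<omega>) * exp (- \<omega>\<^sup>2)" for \<omega>
  have [measurable]: "u \<in> borel_measurable borel" "v \<in> borel_measurable borel"
    unfolding u_def[abs_def] v_def[abs_def] by measurable
  have gg: "g s \<omega> * cnj (g 0 \<omega>) = iexp (s * \<omega>) * of_real (exp (- \<omega>\<^sup>2))" for s \<omega>
  proof -
    have "exp (- \<omega>\<^sup>2 / 2) * exp (- \<omega>\<^sup>2 / 2) = exp (- \<omega>\<^sup>2)" by (simp flip: exp_add)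
    then show ?thesis unfolding g_def by (simp add: mult.assoc flip: of_real_mult)
  qed
  have u_int: "integrable \<nu> u"
  proof -
    have "(cmod (g 0 \<omega>))\<^sup>2 = exp (- \<omega>\<^sup>2)" for \<omega>
      by (simp add: g_def norm_mult flip: exp_of_nat_mult)
    then have "(\<lambda>\<omega>. (cmod (response m \<beta> \<omega> * g 0 \<omega>))\<^sup>2) = u"
      by (simp add: u_def[abs_def] norm_mult power_mult_distrib)
    then show ?thesis
      using sq[OF \<phi>(1)[of 0]] unfolding \<phi>(2) square_integrable_def by simp
  qed
  have v_int: "integrable lborel v"
  proof -
    have "integrable lborel (\<lambda>\<omega>. Re (of_real (\<beta> / pi) * (of_real (Re (khat \<omega>)) * (g 0 \<omega> * cnj (g 0 \<omega>)))))"
      by (intro integrable_Re integrable_mult_right khat_covariance_integrable gS)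
    then show ?thesis unfolding gg by (simp add: v_def[abs_def] mult.assoc)
  qed
  have nz: "AE \<omega> in lborel. \<omega> \<noteq> (0::real)" by (rule AE_lborel_singleton)
  \<comment> \<open>Absolute continuity excludes an atom at 0, the only frequency where
    \<open>u\<close> may vanish.\<close>
  then have nz': "AE \<omega> in \<nu>. \<omega> \<noteq> 0" by (rule AE_absolutely_continuous[OF sets ac])
  have v0: "AE \<omega> in lborel. 0 \<le> v \<omega>"
    using nz by eventually_elim (use pos \<beta> in \<open>auto simp: v_def intro!: mult_nonneg_nonneg divide_nonneg_nonneg less_imp_le\<close>)
  have u0: "0 \<le> u \<omega>" for \<omega> by (simp add: u_def)
  have eq: "density \<nu> (\<lambda>\<omega>. ennreal (u \<omega>)) = density lborel (\<lambda>\<omega>. ennreal (v \<omega>))"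
  proof (rule finite_measure_eqI_char)
    show "finite_measure (density \<nu> (\<lambda>\<omega>. ennreal (u \<omega>)))"
      using u0 u_int by (intro finite_measureI) (simp add: emeasure_density nn_integral_eq_integral)
    show "finite_measure (density lborel (\<lambda>\<omega>. ennreal (v \<omega>)))"
      using v0 v_int by (intro finite_measureI) (simp add: emeasure_density nn_integral_eq_integral)
    fix s
    have "(CLINT \<omega>|density \<nu> (\<lambda>\<omega>. ennreal (u \<omega>)). iexp (s * \<omega>)) = (CLINT \<omega>|\<nu>. u \<omega> *\<^sub>R iexp (s * \<omega>))"
      using u0 by (intro integral_density) auto
    also have "(\<lambda>\<omega>. u \<omega> *\<^sub>R iexp (s * \<omega>)) = (\<lambda>\<omega>. response m \<beta> \<omega> * fourier (\<phi> s) \<omega> * cnj (response m \<beta> \<omega> * fourier (\<phi> 0) \<omega>))"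
      unfolding \<phi>(2) response_covariance gg by (simp add: u_def scaleR_conv_of_real mult_ac)
    also have "(CLINT \<omega>|\<nu>. response m \<beta> \<omega> * fourier (\<phi> s) \<omega> * cnj (response m \<beta> \<omega> * fourier (\<phi> 0) \<omega>)) =
      of_real (\<beta> / pi) * (CLBINT \<omega>. of_real (Re (khat \<omega>)) * (fourier (\<phi> s) \<omega> * cnj (fourier (\<phi> 0) \<omega>)))"
      by (rule cov[OF \<phi>(1) \<phi>(1)])
    also have "\<dots> = (CLBINT \<omega>. of_real (\<beta> / pi) * (of_real (Re (khat \<omega>)) * (g s \<omega> * cnj (g 0 \<omega>))))"
      unfolding \<phi>(2) by (rule integral_mult_right_zero[symmetric])
    also have "(\<lambda>\<omega>. of_real (\<beta> / pi) * (of_real (Re (khat \<omega>)) * (g s \<omega> * cnj (g 0 \<omega>)))) = (\<lambda>\<omega>. v \<omega> *\<^sub>R iexp (s * \<omega>))"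
      unfolding gg by (simp add: v_def scaleR_conv_of_real mult_ac)
    also have "(CLBINT \<omega>. v \<omega> *\<^sub>R iexp (s * \<omega>)) = (CLINT \<omega>|density lborel (\<lambda>\<omega>. ennreal (v \<omega>)). iexp (s * \<omega>))"
      using v0 by (intro integral_density[symmetric]) auto
    finally show "(CLINT \<omega>|density \<nu> (\<lambda>\<omega>. ennreal (u \<omega>)). iexp (s * \<omega>)) =
      (CLINT \<omega>|density lborel (\<lambda>\<omega>. ennreal (v \<omega>)). iexp (s * \<omega>))" .
  qed (auto simp: sets)
  have upos: "u \<omega> > 0" if "\<omega> \<noteq> 0" for \<omega>
    using response_nonzero[OF \<beta> pos[OF that], of m] by (simp add: u_def)
  \<comment> \<open>As \<open>u\<close> is positive almost everywhere, the density 1 / u recovers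
    \<open>\<nu>\<close> from the two equal measures; the Gaussian factor cancels in v / u.\<close>
  have "\<nu> = density \<nu> (\<lambda>_. 1)" by (rule density_1[symmetric])
  also have "\<dots> = density \<nu> (\<lambda>\<omega>. ennreal (u \<omega>) * ennreal (1 / u \<omega>))"
  proof (rule density_cong)
    show "AE \<omega> in \<nu>. 1 = ennreal (u \<omega>) * ennreal (1 / u \<omega>)"
      using nz' by eventually_elim (use upos u0 in \<open>simp add: ennreal_mult[symmetric] less_imp_neq[OF upos, symmetric]\<close>)
  qed measurable
  also have "\<dots> = density (density \<nu> (\<lambda>\<omega>. ennreal (u \<omega>))) (\<lambda>\<omega>. ennreal (1 / u \<omega>))"
    by (rule density_density_eq[symmetric]) measurable
  also have "\<dots> = density lborel (\<lambda>\<omega>. ennreal (v \<omega>) * ennreal (1 / u \<omega>))"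
    unfolding eq by (rule density_density_eq) measurable
  also have "\<dots> = density lborel (\<lambda>\<omega>. ennreal (spectral_density m \<beta> \<omega>))"
  proof (rule density_cong)
    show "AE \<omega> in lborel. ennreal (v \<omega>) * ennreal (1 / u \<omega>) = ennreal (spectral_density m \<beta> \<omega>)"
      using nz v0
    proof eventually_elim
      case (elim \<omega>)
      have "v \<omega> * (1 / u \<omega>) = spectral_density m \<beta> \<omega>"
        by (simp add: v_def u_def spectral_density_def)
      then show ?case using elim u0 by (simp add: ennreal_mult[symmetric])
    qed
  qed measurable
  finally show ?thesis .
qed

text \<open>Off 0 the density cancels the squared modulus of the response and leaves beta / pi times
  the real part of \<open>khat\<close>, which is integrable against products of Schwartz functions.
  Both claims rest on this cancellation.\<close>

lemma spectral_measure_works: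
  fixes m \<beta> :: real
  assumes \<beta>: "\<beta> > 0" and pos: "\<And>\<omega>. \<omega> \<noteq> 0 \<Longrightarrow> Re (khat \<omega>) > 0"
  defines "\<nu> \<equiv> density lborel (\<lambda>\<omega>. ennreal (spectral_density m \<beta> \<omega>))"
  assumes \<phi>: "\<phi> \<in> schwartz" and \<psi>: "\<psi> \<in> schwartz"
  shows "square_integrable \<nu> (\<lambda>\<omega>. response m \<beta> \<omega> * \<phi> \<omega>)"
    and "(CLINT \<omega>|\<nu>. response m \<beta> \<omega> * \<phi> \<omega> * cnj (response m \<beta> \<omega> * \<psi> \<omega>)) =
      of_real (\<beta> / pi) * (CLBINT \<omega>. of_real (Re (khat \<omega>)) * (\<phi> \<omega> * cnj (\<psi> \<omega>)))"
proof -
  have [measurable]: "\<phi> \<in> borel_measurable borel" "\<psi> \<in> borel_measurable borel"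
    using \<phi> \<psi> by (auto intro: schwartz_borel)
  have nz: "AE \<omega> in lborel. \<omega> \<noteq> (0::real)" by (rule AE_lborel_singleton)
  have s0: "AE \<omega> in lborel. 0 \<le> spectral_density m \<beta> \<omega>"
    using nz
  proof eventually_elim
    case (elim \<omega>)
    have "Re (khat \<omega>) \<ge> 0" using pos[OF elim] by simp
    then show ?case using \<beta> by (simp add: spectral_density_def)
  qed
  have "integrable lborel (\<lambda>\<omega>. spectral_density m \<beta> \<omega> *\<^sub>R (cmod (response m \<beta> \<omega> * \<phi> \<omega>))\<^sup>2)"
  proof (rule integrable_cong_AE_imp)
    show "integrable lborel (\<lambda>\<omega>. Re (of_real (\<beta> / pi) * (of_real (Re (khat \<omega>)) * (\<phi> \<omega> * cnj (\<phi> \<omega>)))))"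
      by (intro integrable_Re integrable_mult_right khat_covariance_integrable \<phi>)
    show "AE \<omega> in lborel. Re (of_real (\<beta> / pi) * (of_real (Re (khat \<omega>)) * (\<phi> \<omega> * cnj (\<phi> \<omega>)))) =
        spectral_density m \<beta> \<omega> *\<^sub>R (cmod (response m \<beta> \<omega> * \<phi> \<omega>))\<^sup>2"
      using nz
    proof eventually_elim
      case (elim \<omega>)
      have "spectral_density m \<beta> \<omega> *\<^sub>R (cmod (response m \<beta> \<omega> * \<phi> \<omega>))\<^sup>2 = \<beta> / pi * Re (khat \<omega>) * (cmod (\<phi> \<omega>))\<^sup>2"
        unfolding spectral_density_mult[OF \<beta> pos[OF elim], of m, symmetric]
        by (simp add: norm_mult power_mult_distrib)
      moreover have "Re (of_real (\<beta> / pi) * (of_real (Re (khat \<omega>)) * (\<phi> \<omega> * cnj (\<phi> \<omega>)))) =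
          \<beta> / pi * Re (khat \<omega>) * (cmod (\<phi> \<omega>))\<^sup>2"
        unfolding complex_norm_square[symmetric] of_real_mult[symmetric] Re_complex_of_real by simp
      ultimately show ?case by simp
    qed
  qed measurable
  then show "square_integrable \<nu> (\<lambda>\<omega>. response m \<beta> \<omega> * \<phi> \<omega>)"
    unfolding square_integrable_def \<nu>_def by (subst integrable_density) (use s0 in auto)
  have "(CLINT \<omega>|\<nu>. response m \<beta> \<omega> * \<phi> \<omega> * cnj (response m \<beta> \<omega> * \<psi> \<omega>)) =
      (CLBINT \<omega>. spectral_density m \<beta> \<omega> *\<^sub>R (response m \<beta> \<omega> * \<phi> \<omega> * cnj (response m \<beta> \<omega> * \<psi> \<omega>)))"
    unfolding \<nu>_def by (rule integral_density[OF _ _ s0]) measurable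
  also have "\<dots> = (CLBINT \<omega>. of_real (\<beta> / pi) * (of_real (Re (khat \<omega>)) * (\<phi> \<omega> * cnj (\<psi> \<omega>))))"
  proof (rule integral_cong_AE)
    show "AE \<omega> in lborel. spectral_density m \<beta> \<omega> *\<^sub>R (response m \<beta> \<omega> * \<phi> \<omega> * cnj (response m \<beta> \<omega> * \<psi> \<omega>)) =
        of_real (\<beta> / pi) * (of_real (Re (khat \<omega>)) * (\<phi> \<omega> * cnj (\<psi> \<omega>)))"
      using nz
    proof eventually_elim
      case (elim \<omega>)
      show ?case
        unfolding response_covariance scaleR_conv_of_real mult.assoc[symmetric] of_real_mult[symmetric]
          spectral_density_mult[OF \<beta> pos[OF elim], of m] ..
    qed
  qed measurable
  also have "\<dots> = of_real (\<beta> / pi) * (CLBINT \<omega>. of_real (Re (khat \<omega>)) * (\<phi> \<omega> * cnj (\<psi> \<omega>)))"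
    by (rule integral_mult_right_zero)
  finally show "(CLINT \<omega>|\<nu>. response m \<beta> \<omega> * \<phi> \<omega> * cnj (response m \<beta> \<omega> * \<psi> \<omega>)) =
      of_real (\<beta> / pi) * (CLBINT \<omega>. of_real (Re (khat \<omega>)) * (\<phi> \<omega> * cnj (\<psi> \<omega>)))" .
qed

end

section \<open>The generalized Langevin equation\<close>

lemma borel_measurable_lebesgue:
  "f \<in> borel_measurable borel \<Longrightarrow> f \<in> borel_measurable lebesgue"
  by (rule measurable_completion) simp

text \<open>Local integrability makes \<open>K\<close> only Lebesgue measurable, and
  \<open>K 0\<close> may be infinite; hence the link to the Borel kernel holds almost everywhere.
  The absolute value encodes the symmetry of \<open>K\<close>.\<close>

locale gle_kernel = memory_kernel k A C for k A C +
  fixes K :: "real \<Rightarrow> ereal"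
  assumes K_measurable: "(\<lambda>t. real_of_ereal (K t)) \<in> borel_measurable lebesgue"
    and K_eq: "AE t in lborel. real_of_ereal (K t) = k \<bar>t\<bar>"
begin

lemma K_eq_lebesgue: "AE t in lebesgue. real_of_ereal (K t) = k \<bar>t\<bar>"
  using K_eq by (rule AE_completion)

lemma K_plus_eq: "AE t in lebesgue. K_plus K t = kc t"
  using K_eq_lebesgue by eventually_elim (auto simp: K_plus_def kc_def k_neg)

lemma K_plus_measurable: "K_plus K \<in> borel_measurable lebesgue"
proof -
  have "K_plus K = (\<lambda>t. indicator {0..} t * of_real (real_of_ereal (K t)))"
    by (auto simp: K_plus_def fun_eq_iff)
  also have "\<dots> \<in> borel_measurable lebesgue"
    by (rule borel_measurable_times[OF borel_measurable_lebesgue measurable_compose[OF K_measurable borel_measurable_of_real]]) measurable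
  finally show ?thesis .
qed

text \<open>The exceptional null set lies under the integral, so equality holds at every point and
  the associated distributions are literally the same.\<close>

lemma conv_K_plus:
  assumes \<phi>: "\<phi> \<in> borel_measurable borel"
  shows "conv (K_plus K) \<phi> = conv kc \<phi>"
proof
  fix t
  note [measurable] = K_plus_measurable
  have b: "(\<lambda>u. \<phi> (t - u)) \<in> borel_measurable borel" using \<phi> by measurable
  have [measurable]: "(\<lambda>u. \<phi> (t - u)) \<in> borel_measurable lebesgue" "kc \<in> borel_measurable lebesgue"
    using b by (auto intro: borel_measurable_lebesgue)
  show "conv (K_plus K) \<phi> t = conv kc \<phi> t"
    unfolding conv_def
  proof (rule integral_cong_AE)
    show "AE u in lebesgue. K_plus K u * \<phi> (t - u) = kc u * \<phi> (t - u)"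
      using K_plus_eq by eventually_elim simp
  qed measurable
qed

lemma gle_test_eq:
  assumes "\<phi> \<in> schwartz"
  shows "gle_test m \<beta> K \<phi> = gle_kernel_test m \<beta> \<phi>"
  unfolding gle_test_def[abs_def] gle_kernel_test_def[abs_def]
    conv_K_plus[OF schwartz_borel[OF schwartz_reflect[OF assms]]] ..

lemma K_trunc_integral:
  assumes h: "h \<in> borel_measurable borel"
  shows "(LINT t:{0..T}|lebesgue. real_of_ereal (K t) * h t) = (LBINT t. indicator {..T} t * k t * h t)"
proof -
  have [measurable]: "h \<in> borel_measurable borel" by fact
  have "(LINT t:{0..T}|lebesgue. real_of_ereal (K t) * h t) = (LINT t|lebesgue. indicator {..T} t * k t * h t)"
    unfolding set_lebesgue_integral_def
  proof (rule integral_cong_AE)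
    show "AE t in lebesgue. indicat_real {0..T} t *\<^sub>R (real_of_ereal (K t) * h t) = indicator {..T} t * k t * h t"
      using K_eq_lebesgue by eventually_elim (auto simp: indicator_def k_neg)
    show "(\<lambda>t. indicat_real {0..T} t *\<^sub>R (real_of_ereal (K t) * h t)) \<in> borel_measurable lebesgue"
      by (intro borel_measurable_scaleR borel_measurable_times K_measurable h borel_measurable_lebesgue) measurable
    show "(\<lambda>t. indicat_real {..T} t * k t * h t) \<in> borel_measurable lebesgue"
      by (intro borel_measurable_lebesgue) measurable
  qed
  also have "\<dots> = (LBINT t. indicator {..T} t * k t * h t)"
    by (rule integral_lebesgue_lborel) measurable
  finally show ?thesis .
qed

lemma Re_fourier_trunc: "Re (fourier (trunc T) \<omega>) = (LBINT t. indicator {..T} t * k t * cos (t * \<omega>))"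
  unfolding fourier_lborel[OF trunc_borel] integral_Re[OF integrable_iexp_mult[OF trunc_integrable], symmetric]
  by (simp add: trunc_def Re_exp mult.commute)

lemma Im_fourier_trunc: "Im (fourier (trunc T) \<omega>) = (LBINT t. indicator {..T} t * k t * sin (t * \<omega>))"
  unfolding fourier_lborel[OF trunc_borel] integral_Im[OF integrable_iexp_mult[OF trunc_integrable], symmetric]
  by (simp add: trunc_def Im_exp mult.commute)

lemma K_cos_eq:
  assumes "\<omega> \<noteq> 0"
  shows "K_cos K \<omega> = Re (khat \<omega>)"
proof -
  have "(LINT t:{0..T}|lebesgue. real_of_ereal (K t) * cos (t * \<omega>)) = Re (fourier (trunc T) \<omega>)" for T
    unfolding Re_fourier_trunc by (rule K_trunc_integral) measurable
  then show ?thesis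
    unfolding K_cos_def using tendsto_Re[OF fourier_trunc_tendsto[OF assms]] by (simp add: tendsto_Lim)
qed

lemma K_sin_eq:
  assumes "\<omega> \<noteq> 0"
  shows "K_sin K \<omega> = Im (khat \<omega>)"
proof -
  have "(LINT t:{0..T}|lebesgue. real_of_ereal (K t) * sin (t * \<omega>)) = Im (fourier (trunc T) \<omega>)" for T
    unfolding Im_fourier_trunc by (rule K_trunc_integral) measurable
  then show ?thesis
    unfolding K_sin_def using tendsto_Im[OF fourier_trunc_tendsto[OF assms]] by (simp add: tendsto_Lim)
qed

lemma r_hat_eq:
  assumes "\<omega> \<noteq> 0"
  shows "r_hat m \<beta> K \<omega> = spectral_density m \<beta> \<omega>"
proof -
  have "(cmod (response m \<beta> \<omega>))\<^sup>2 = (\<beta> * Re (khat \<omega>))\<^sup>2 + (m * \<omega> - \<beta> * Im (khat \<omega>))\<^sup>2"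
    by (simp add: cmod_power2 response_def power2_commute)
  then show ?thesis
    unfolding r_hat_def spectral_density_def K_cos_eq[OF assms] K_sin_eq[OF assms] by simp
qed

lemma density_r_hat:
  "density lborel (\<lambda>\<omega>. ennreal (r_hat m \<beta> K \<omega>)) = density lborel (\<lambda>\<omega>. ennreal (spectral_density m \<beta> \<omega>))"
proof (rule density_cong)
  \<comment> \<open>\<open>K_cos\<close> and \<open>K_sin\<close> are limits over the reals, so
    measurability is not immediate; it is obtained by changing a Borel function at the single point
    0.\<close>
  have "r_hat m \<beta> K = (\<lambda>\<omega>. if \<omega> = 0 then r_hat m \<beta> K 0 else spectral_density m \<beta> \<omega>)"
    by (auto simp: r_hat_eq)
  also have "\<dots> \<in> borel_measurable borel" by measurable
  finally have [measurable]: "r_hat m \<beta> K \<in> borel_measurable borel" .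
  show "(\<lambda>\<omega>. ennreal (r_hat m \<beta> K \<omega>)) \<in> borel_measurable lborel" by measurable
  show "AE \<omega> in lborel. ennreal (r_hat m \<beta> K \<omega>) = ennreal (spectral_density m \<beta> \<omega>)"
    using AE_lborel_singleton[of 0] by eventually_elim (simp add: r_hat_eq)
qed measurable

lemma noise_integral:
  assumes \<phi>: "\<phi> \<in> schwartz" and \<psi>: "\<psi> \<in> schwartz"
  shows "(LINT t|lebesgue. of_real (real_of_ereal (K t)) * conv \<phi> (star \<psi>) t) =
    of_real (1 / pi) * (CLBINT \<omega>. of_real (Re (khat \<omega>)) * (fourier \<phi> \<omega> * cnj (fourier \<psi> \<omega>)))"
proof -
  note [measurable] = K_measurable schwartz_borel[OF \<phi>] schwartz_borel[OF \<psi>]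
  have [measurable]: "star \<psi> \<in> borel_measurable borel"
    unfolding star_def[abs_def] by measurable
  have [measurable]: "conv \<phi> (star \<psi>) \<in> borel_measurable borel" by (rule conv_borel) measurable
  have b: "(\<lambda>t. complex_of_real (k \<bar>t\<bar>) * conv \<phi> (star \<psi>) t) \<in> borel_measurable borel" by measurable
  have [measurable]: "conv \<phi> (star \<psi>) \<in> borel_measurable lebesgue" by (rule measurable_completion) simp
  have "(LINT t|lebesgue. of_real (real_of_ereal (K t)) * conv \<phi> (star \<psi>) t) =
      (LINT t|lebesgue. of_real (k \<bar>t\<bar>) * conv \<phi> (star \<psi>) t)"
  proof (rule integral_cong_AE)
    show "(\<lambda>t. complex_of_real (k \<bar>t\<bar>) * conv \<phi> (star \<psi>) t) \<in> borel_measurable lebesgue"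
      by (rule measurable_completion) (use b in simp)
    show "AE t in lebesgue. of_real (real_of_ereal (K t)) * conv \<phi> (star \<psi>) t = of_real (k \<bar>t\<bar>) * conv \<phi> (star \<psi>) t"
      using K_eq_lebesgue by eventually_elim simp
  qed measurable
  then show ?thesis
    unfolding integral_lebesgue_lborel[OF b] noise_covariance[OF \<phi> \<psi>] .
qed

text \<open>Condition (a) amounts to square integrability of the response times every transform,
  which is what permits evaluating the covariance of \<open>V\<close> in (b). After that, (b)
  equates two integrals on the Fourier side.\<close>

lemma weak_solution_iff:
  assumes pos: "m > 0" "\<beta> > 0" and Re_pos: "\<And>\<omega>. \<omega> \<noteq> 0 \<Longrightarrow> Re (khat \<omega>) > 0"
    and sets: "sets \<nu> = sets borel" and ac: "absolutely_continuous lborel \<nu>"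
    and fin: "(\<integral>\<^sup>+x. ennreal ((1 + x\<^sup>2) powi (- j)) \<partial>\<nu>) < \<infinity>"
    and V: "associated_operator M \<nu> V" and F: "noise K N F"
  shows "weak_solution m \<beta> K N F M \<nu> V \<longleftrightarrow> \<nu> = density lborel (\<lambda>\<omega>. ennreal (spectral_density m \<beta> \<omega>))"
proof -
  have [measurable_cong]: "sets \<nu> = sets borel" by fact
  \<comment> \<open>The representative supplied by \<open>Dom\<close> agrees with
    \<open>khat \<omega> * fourier \<phi> \<omega>\<close> only Lebesgue almost everywhere; absolute
    continuity carries this over to \<open>\<nu>\<close>.\<close>
  have Dom_conv: "dist_of (conv (K_plus K) \<phi>) \<in> Dom \<nu> \<longleftrightarrow> square_integrable \<nu> (\<lambda>\<omega>. response m \<beta> \<omega> * fourier \<phi> \<omega>)"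
    if \<phi>: "\<phi> \<in> schwartz" for \<phi>
    unfolding square_integrable_khat_iff[OF sets fin pos(2) fourier_schwartz[OF \<phi>], symmetric]
      conv_K_plus[OF schwartz_borel[OF \<phi>]]
  proof
    assume "dist_of (conv kc \<phi>) \<in> Dom \<nu>"
    then obtain h where h: "is_function (fourier_dist (dist_of (conv kc \<phi>))) h" "square_integrable \<nu> h"
      by (auto simp: Dom_def)
    have "AE \<omega> in \<nu>. khat \<omega> * fourier \<phi> \<omega> = h \<omega>"
      by (rule AE_absolutely_continuous[OF sets ac is_function_unique[OF is_function_conv_kernel[OF \<phi>] h(1)]])
    then show "square_integrable \<nu> (\<lambda>\<omega>. khat \<omega> * fourier \<phi> \<omega>)"
      using khat_schwartz_borel[OF fourier_schwartz[OF \<phi>]]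
      by (intro square_integrable_cong_norm[OF h(2)]) auto
  next
    assume "square_integrable \<nu> (\<lambda>\<omega>. khat \<omega> * fourier \<phi> \<omega>)"
    then show "dist_of (conv kc \<phi>) \<in> Dom \<nu>"
      unfolding Dom_def using conv_kernel_tempered[OF \<phi>] is_function_conv_kernel[OF \<phi>] by blast
  qed
  have V_cov: "(LINT w|M. V (dist_of (gle_test m \<beta> K \<phi>)) w * cnj (V (dist_of (gle_test m \<beta> K \<psi>)) w)) =
      (LINT \<omega>|\<nu>. response m \<beta> \<omega> * fourier \<phi> \<omega> * cnj (response m \<beta> \<omega> * fourier \<psi> \<omega>))"
    if \<phi>: "\<phi> \<in> schwartz" "square_integrable \<nu> (\<lambda>\<omega>. response m \<beta> \<omega> * fourier \<phi> \<omega>)"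
      and \<psi>: "\<psi> \<in> schwartz" "square_integrable \<nu> (\<lambda>\<omega>. response m \<beta> \<omega> * fourier \<psi> \<omega>)" for \<phi> \<psi>
  proof -
    have D: "dist_of (gle_kernel_test m \<beta> \<phi>) \<in> Dom \<nu>" "dist_of (gle_kernel_test m \<beta> \<psi>) \<in> Dom \<nu>"
      unfolding Dom_def using \<phi> \<psi> gle_kernel_test_tempered is_function_gle_kernel_test by blast+
    from V[unfolded associated_operator_def, THEN conjunct2, THEN conjunct2, THEN conjunct2, rule_format,
        OF D is_function_gle_kernel_test[OF \<phi>(1)] \<phi>(2) is_function_gle_kernel_test[OF \<psi>(1)] \<psi>(2)]
    show ?thesis unfolding gle_test_eq[OF \<phi>(1)] gle_test_eq[OF \<psi>(1)] .
  qed
  have F_cov: "(LINT w|N. (of_real (sqrt \<beta>) * F \<phi> w) * cnj (of_real (sqrt \<beta>) * F \<psi> w)) =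
      of_real (\<beta> / pi) * (CLBINT \<omega>. of_real (Re (khat \<omega>)) * (fourier \<phi> \<omega> * cnj (fourier \<psi> \<omega>)))"
    if "\<phi> \<in> schwartz" "\<psi> \<in> schwartz" for \<phi> \<psi>
  proof -
    have "complex_of_real (sqrt \<beta>) * (of_real (sqrt \<beta>) * z) = of_real \<beta> * z" for z
      using pos by (simp flip: of_real_mult mult.assoc)
    note sqrt = this
    have "(\<lambda>w. (of_real (sqrt \<beta>) * F \<phi> w) * cnj (of_real (sqrt \<beta>) * F \<psi> w)) =
        (\<lambda>w. of_real \<beta> * (F \<phi> w * cnj (F \<psi> w)))"
      by (simp only: complex_cnj_mult complex_cnj_complex_of_real mult.assoc mult.left_commute[of "F \<phi> _"] sqrt)
    then have "(LINT w|N. (of_real (sqrt \<beta>) * F \<phi> w) * cnj (of_real (sqrt \<beta>) * F \<psi> w)) =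
        of_real \<beta> * (LINT w|N. F \<phi> w * cnj (F \<psi> w))"
      by (simp only: integral_mult_right_zero)
    also have "(LINT w|N. F \<phi> w * cnj (F \<psi> w)) =
        (LINT t|lebesgue. of_real (real_of_ereal (K t)) * conv \<phi> (star \<psi>) t)"
      using F that by (auto simp: noise_def)
    finally show ?thesis
      unfolding noise_integral[OF that] by simp
  qed
  show ?thesis
  proof
    assume W: "weak_solution m \<beta> K N F M \<nu> V"
    have sq: "square_integrable \<nu> (\<lambda>\<omega>. response m \<beta> \<omega> * fourier \<phi> \<omega>)" if "\<phi> \<in> schwartz" for \<phi>
      using W that Dom_conv[OF that] by (simp add: weak_solution_def)
    show "\<nu> = density lborel (\<lambda>\<omega>. ennreal (spectral_density m \<beta> \<omega>))"
    proof (rule spectral_measure_unique[OF sets ac pos(2) Re_pos sq])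
      fix \<phi> \<psi> assume S: "\<phi> \<in> schwartz" "\<psi> \<in> schwartz"
      show "(LINT \<omega>|\<nu>. response m \<beta> \<omega> * fourier \<phi> \<omega> * cnj (response m \<beta> \<omega> * fourier \<psi> \<omega>)) =
          of_real (\<beta> / pi) * (CLBINT \<omega>. of_real (Re (khat \<omega>)) * (fourier \<phi> \<omega> * cnj (fourier \<psi> \<omega>)))"
        using W[unfolded weak_solution_def, THEN conjunct2, rule_format, OF S]
        unfolding V_cov[OF S(1) sq[OF S(1)] S(2) sq[OF S(2)]] F_cov[OF S] .
    qed
  next
    assume \<nu>: "\<nu> = density lborel (\<lambda>\<omega>. ennreal (spectral_density m \<beta> \<omega>))"
    note works = spectral_measure_works[OF pos(2) Re_pos fourier_schwartz fourier_schwartz, of _ _ m, folded \<nu>]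
    show "weak_solution m \<beta> K N F M \<nu> V"
      unfolding weak_solution_def
    proof (intro conjI ballI)
      fix \<phi> assume "\<phi> \<in> schwartz"
      then show "dist_of (conv (K_plus K) \<phi>) \<in> Dom \<nu>" using Dom_conv works(1) by blast
    next
      fix \<phi> \<psi> assume S: "\<phi> \<in> schwartz" "\<psi> \<in> schwartz"
      have sq: "square_integrable \<nu> (\<lambda>\<omega>. response m \<beta> \<omega> * fourier \<phi> \<omega>)"
        "square_integrable \<nu> (\<lambda>\<omega>. response m \<beta> \<omega> * fourier \<psi> \<omega>)"
        using works(1) S by blast+
      show "(LINT w|M. V (dist_of (gle_test m \<beta> K \<phi>)) w * cnj (V (dist_of (gle_test m \<beta> K \<psi>)) w)) =
          (LINT w|N. (of_real (sqrt \<beta>) * F \<phi> w) * cnj (of_real (sqrt \<beta>) * F \<psi> w))"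
        unfolding V_cov[OF S(1) sq(1) S(2) sq(2)] F_cov[OF S] by (rule works(2)[OF _ S]) (auto)
    qed
  qed
qed

end

text \<open>Monotonicity and decay must hold at every point beyond \<open>A\<close>, whereas a Borel
  version agrees with \<open>K\<close> only almost everywhere. Beyond \<open>A\<close>, however,
  monotonicity itself gives Borel measurability, so a version is taken only below
  \<open>A\<close>.\<close>

lemma gle_kernel_exists:
  fixes K :: "real \<Rightarrow> ereal"
  assumes K_range: "\<And>t. K t \<noteq> -\<infinity>" "\<And>t. t \<noteq> 0 \<Longrightarrow> K t \<noteq> \<infinity>"
    and int: "locally_integrable (\<lambda>t. real_of_ereal (K t))"
    and sym: "\<And>t. K (- t) = K t" and K_pos: "\<And>t. t \<noteq> 0 \<Longrightarrow> K t > 0"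
    and dec: "\<exists>A. antimono_on {A..} K"
    and sim: "sim_at_top (\<lambda>t. real_of_ereal (K t)) (\<lambda>t. inverse t)"
  shows "\<exists>k A C. gle_kernel k A C K"
proof -
  define f where "f t = real_of_ereal (K t)" for t
  have f_sym: "f \<bar>t\<bar> = f t" for t using sym[of t] by (simp add: f_def abs_if)
  have f_nonneg: "f t \<ge> 0" if "t \<noteq> 0" for t
    using K_pos[OF that] by (simp add: f_def real_of_ereal_pos less_imp_le)
  obtain A0 where A0: "antimono_on {A0..} K" using dec by blast
  obtain c where c: "((\<lambda>t. f t / inverse t) \<longlongrightarrow> c) at_top"
    using sim unfolding sim_at_top_def f_def by blast
  have "\<forall>\<^sub>F t in at_top. f t / inverse t < c + 1"
    using c by (rule order_tendstoD) simp
  \<comment> \<open>Any bound above the limit \<open>c\<close> would serve; \<open>c + 1\<close>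
    becomes the decay constant.\<close>
  then obtain A1 where A1: "\<And>t. t \<ge> A1 \<Longrightarrow> f t / inverse t < c + 1"
    by (auto simp: eventually_at_top_linorder)
  define A where "A = max 1 (max A0 A1)"
  have A: "A > 0" "A \<ge> A0" "A \<ge> A1" by (auto simp: A_def)
  have f_anti: "f t \<le> f s" if "A \<le> s" "s \<le> t" for s t
  proof -
    have "K t \<le> K s" using A0 that A by (auto simp: monotone_on_def)
    moreover have "\<bar>K s\<bar> \<noteq> \<infinity>" "\<bar>K t\<bar> \<noteq> \<infinity>" using K_range[of s] K_range[of t] that A by auto
    ultimately show ?thesis unfolding f_def by (cases "K s"; cases "K t") auto
  qed
  have f_decay: "f t \<le> (c + 1) / t" if "A \<le> t" for t
    using A1[of t] that A by (simp add: field_simps)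
  have fm: "f \<in> borel_measurable lebesgue"
  \<comment> \<open>Local integrability gives measurability on bounded intervals, and the cut off
    functions converge pointwise.\<close>
  proof (rule borel_measurable_LIMSEQ_real)
    show "(\<lambda>t. indicator {- real n..real n} t *\<^sub>R f t) \<in> borel_measurable lebesgue" for n
      using int unfolding locally_integrable_def set_integrable_def f_def by blast
    show "(\<lambda>n. indicator {- real n..real n} t *\<^sub>R f t) \<longlonglongrightarrow> f t" for t
    proof (rule tendsto_eventually)
      show "\<forall>\<^sub>F n in sequentially. indicator {- real n..real n} t *\<^sub>R f t = f t"
        using eventually_ge_at_top[of "nat \<lceil>\<bar>t\<bar>\<rceil>"]
        by eventually_elim (auto simp: nat_ceiling_le_eq indicator_def)
    qed
  qed
  then obtain g where [measurable]: "g \<in> borel_measurable borel" and g: "AE t in lborel. f t = g t"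
    using completion_ex_borel_measurable_real[of f lborel] by auto
  have "mono (\<lambda>t. - f (max A t))"
    by (intro monoI) (auto intro!: f_anti)
  then have "(\<lambda>t. - f (max A t)) \<in> borel_measurable borel" by (rule borel_measurable_mono)
  then have [measurable]: "(\<lambda>t. f (max A t)) \<in> borel_measurable borel"
    using borel_measurable_uminus_eq by blast
  \<comment> \<open>Clipping with \<open>max 0\<close> restores the sign that the version
    \<open>g\<close> has only almost everywhere. The composition with \<open>max A t\<close>, which
    equals t in the last case, is monotone on the whole line and hence Borel.\<close>
  define k where "k t = (if t < 0 then 0 else if t < A then max 0 (g t) else f (max A t))" for t
  have [measurable]: "k \<in> borel_measurable borel" unfolding k_def[abs_def] by measurable
  have fk: "AE t in lborel. 0 < t \<longrightarrow> k t = f t"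
    using g
  proof eventually_elim
    case (elim t)
    then show ?case using f_nonneg[of t] by (auto simp: k_def)
  qed
  show ?thesis
  proof (intro exI)
    show "gle_kernel k A (c + 1) K"
    proof
      show "k \<in> borel_measurable borel" by measurable
      show "k t \<ge> 0" for t using f_nonneg[of "max A t"] A by (auto simp: k_def)
      show "k t = 0" if "t < 0" for t using that by (simp add: k_def)
      show "k t \<le> k s" if "A \<le> s" "s \<le> t" for s t
        using that A f_anti[OF that] by (simp add: k_def)
      show "k t \<le> (c + 1) / t" if "A \<le> t" for t
        using that A f_decay[OF that] by (simp add: k_def)
      show "A > 0" by (rule A)
      show "(\<lambda>t. real_of_ereal (K t)) \<in> borel_measurable lebesgue" using fm by (simp add: f_def[abs_def])
      show "integrable lborel (\<lambda>t. indicator {..T} t * k t)" for T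
      proof -
        have i: "integrable lebesgue (\<lambda>t. indicator {0..T} t *\<^sub>R f t)"
          using int unfolding locally_integrable_def set_integrable_def f_def by blast
        have ae: "AE t in lebesgue. indicator {0..T} t *\<^sub>R f t = indicator {..T} t * k t"
        proof (rule AE_completion)
          show "AE t in lborel. indicator {0..T} t *\<^sub>R f t = indicator {..T} t * k t"
            using fk AE_lborel_singleton[of 0]
            by eventually_elim (auto simp: indicator_def k_def)
        qed
        have b: "(\<lambda>t. indicat_real {..T} t * k t) \<in> borel_measurable borel" by measurable
        have "integrable lebesgue (\<lambda>t. indicat_real {..T} t * k t)"
          by (rule integrable_cong_AE_imp[OF i borel_measurable_lebesgue[OF b]])
             (rule ae)
        then show ?thesis using b by (simp add: integrable_lebesgue_lborel)
      qed
      show "AE t in lborel. real_of_ereal (K t) = k \<bar>t\<bar>"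
      proof -
        \<comment> \<open>Agreement of \<open>k\<close> and \<open>f\<close> is known for positive
          arguments only. Discarding the exceptional null set together with its mirror image puts
          |t| outside it for almost every t of either sign.\<close>
        obtain Z where Z: "Z \<in> null_sets lborel" "{t \<in> space lborel. \<not> (0 < t \<longrightarrow> k t = f t)} \<subseteq> Z"
          using fk by (rule AE_E) (auto simp: null_sets_def)
        have [measurable]: "Z \<in> sets borel" using Z by (auto simp: null_sets_def)
        have 1: "AE t in lborel. t \<notin> Z" using Z(1) by (rule AE_not_in)
        have 2: "AE t in lborel. 0 + (-1) * t \<notin> Z"
          by (rule AE_borel_affine[OF _ _ 1]) auto
        show ?thesis
          using 1 2 AE_lborel_singleton[of 0]
        proof eventually_elim
          case (elim t)
          then have "\<bar>t\<bar> \<notin> Z" "\<bar>t\<bar> > 0" by (auto simp: abs_if)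
          then have "k \<bar>t\<bar> = f \<bar>t\<bar>" using subsetD[OF Z(2), of "\<bar>t\<bar>"] by auto
          then show ?case unfolding f_sym by (simp add: f_def)
        qed
      qed
    qed
  qed
qed

theorem theorem4p2:
  fixes K :: "real \<Rightarrow> ereal" and m \<beta> :: real and \<nu> :: "real measure"
    and M :: "'w measure" and V :: "((real \<Rightarrow> complex) \<Rightarrow> complex) \<Rightarrow> 'w \<Rightarrow> complex"
    and N :: "'v measure" and F :: "(real \<Rightarrow> complex) \<Rightarrow> 'v \<Rightarrow> complex"
  assumes K_range: "\<And>t. K t \<noteq> -\<infinity>" "\<And>t. t \<noteq> 0 \<Longrightarrow> K t \<noteq> \<infinity>"
    and Ia: "locally_integrable (\<lambda>t. real_of_ereal (K t))"
      "\<And>t. K (- t) = K t" "\<And>t. t \<noteq> 0 \<Longrightarrow> K t > 0"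
    and Ib: "(K \<longlongrightarrow> 0) at_top" "\<exists>A. antimono_on {A..} K"
    and Ic: "\<And>\<omega>. \<omega> \<noteq> 0 \<Longrightarrow> K_cos K \<omega> > 0"
    and II: "sim_at_top (\<lambda>t. real_of_ereal (K t)) (\<lambda>t. inverse t)"
    and pos: "m > 0" "\<beta> > 0"
    and \<nu>: "sets \<nu> = sets borel" "absolutely_continuous lborel \<nu>"
      "\<exists>k::int. (\<integral>\<^sup>+x. ennreal ((1 + x\<^sup>2) powi (- k)) \<partial>\<nu>) < \<infinity>"
    and V: "associated_operator M \<nu> V"
    and F: "noise K N F"
  shows "weak_solution m \<beta> K N F M \<nu> V \<longleftrightarrow>
         \<nu> = density lborel (\<lambda>\<omega>. ennreal (r_hat m \<beta> K \<omega>))"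
proof -
  obtain k A C where "gle_kernel k A C K"
    using gle_kernel_exists[OF K_range Ia Ib(2) II] by blast
  then interpret gle_kernel k A C K .
  obtain j :: int where fin: "(\<integral>\<^sup>+x. ennreal ((1 + x\<^sup>2) powi (- j)) \<partial>\<nu>) < \<infinity>"
    using \<nu>(3) by blast
  show ?thesis
    unfolding density_r_hat
    by (rule weak_solution_iff[OF pos _ \<nu>(1,2) fin V F]) (simp add: Ic flip: K_cos_eq)
qed

end
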